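(* Assume $\mathrm{char}(\mathbb F)=0$ and $0\ne h\in R=\mathbb F[x]$. Then $$\mathsf{HH}^1(A_h)=\mathsf Z(\mathsf{HH}^1(A_h))\oplus[\mathsf{HH}^1(A_h),\mathsf{HH}^1(A_h)],$$ where $$\mathsf Z(\mathsf{HH}^1(A_h))=\Big\{D_{r\frac{h}{\pi_h}}\ \Big|\ r\in R,\ \deg r<\deg\pi_h\Big\}\quad\text{and}\quad \dim\mathsf Z(\mathsf{HH}^1(A_h))=\deg\pi_h.$$
   Context: $\mathbb F$ is a field, $R=\mathbb F[x]$, $0\ne h\in R$. $A_h$ is the unital associative $\mathbb F$-algebra with generators $x,\hat y$ and relation $\hat yx-x\hat y=h$. $\mathsf{HH}^1(A_h)=\mathrm{Der}_{\mathbb F}(A_h)/\mathrm{Inder}_{\mathbb F}(A_h)$ (derivations modulo inner derivations, as a Lie algebra); $\mathsf Z(\cdot)$ denotes the center and $[\cdot,\cdot]$ the derived ideal. For $g\in R$, $D_g$ is the derivation of $A_h$ with $D_g(x)=0$, $D_g(\hat y)=g$; its image in $\mathsf{HH}^1(A_h)$ is denoted by the same symbol. $\pi_h\in R$ is the unique monic polynomial such that for all $r\in R$: $h\mid h'r\iff\pi_h\mid r$ (in characteristic 0, the product of the distinct monic prime factors of $h$; $1$ if $h$ is constant). $\deg 0=-\infty$. *)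

theory Defs
  imports
    "HOL-Library.Poly_Mapping"
    "HOL-Computational_Algebra.Polynomial"
    "HOL-Algebra.QuotRing"
    "Jordan_Normal_Form.VS_Connect"
begin

text \<open>
  Algebras over a field, associative or not, are represented by the record type
  \<^typ>\<open>('a, 'b) module\<close>: its multiplication field holds the product, which for a Lie algebra is
  the bracket, and the unit field is irrelevant for Lie algebras. The ground field is a type
  \<^typ>\<open>'a::field\<close>; where the libraries expect a ring record it appears as \<^term>\<open>class_ring\<close>.
\<close>

section \<open>Quotient algebras, derivations and the first Hochschild cohomology\<close>

definition alg_quot :: "('a, 'b) module \<Rightarrow> 'b set \<Rightarrow> ('a, 'b set) module" where
  "alg_quot A I =
     ring.extend (A Quot I) (module.fields (\<lambda>c C. \<Union>a\<in>C. I +>\<^bsub>A\<^esub> (c \<odot>\<^bsub>A\<^esub> a)))"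

text \<open>Derivations are extensional, i.e. \<^const>\<open>undefined\<close> outside the carrier, so that a
  derivation is determined by its values on the algebra.\<close>

definition derivations :: "('a::field, 'b) module \<Rightarrow> ('b \<Rightarrow> 'b) set" where
  "derivations A =
     {d \<in> LinearCombinations.module_hom class_ring A A \<inter> extensional (carrier A).
        \<forall>a\<in>carrier A. \<forall>b\<in>carrier A. d (a \<otimes>\<^bsub>A\<^esub> b) = (d a \<otimes>\<^bsub>A\<^esub> b) \<oplus>\<^bsub>A\<^esub> (a \<otimes>\<^bsub>A\<^esub> d b)}"

definition inner_derivations :: "('a::field, 'b) module \<Rightarrow> ('b \<Rightarrow> 'b) set" where
  "inner_derivations A =
     (\<lambda>a. \<lambda>b\<in>carrier A. (a \<otimes>\<^bsub>A\<^esub> b) \<ominus>\<^bsub>A\<^esub> (b \<otimes>\<^bsub>A\<^esub> a)) ` carrier A"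

definition Der :: "('a::field, 'b) module \<Rightarrow> ('a, 'b \<Rightarrow> 'b) module" where
  "Der A =
     \<lparr>carrier = derivations A,
      mult = (\<lambda>d e. \<lambda>a\<in>carrier A. d (e a) \<ominus>\<^bsub>A\<^esub> e (d a)),
      one = undefined,
      zero = (\<lambda>a\<in>carrier A. \<zero>\<^bsub>A\<^esub>),
      add = (\<lambda>d e. \<lambda>a\<in>carrier A. d a \<oplus>\<^bsub>A\<^esub> e a),
      smult = (\<lambda>c d. \<lambda>a\<in>carrier A. c \<odot>\<^bsub>A\<^esub> d a)\<rparr>"

definition HH1 :: "('a::field, 'b) module \<Rightarrow> ('a, ('b \<Rightarrow> 'b) set) module" where
  "HH1 A = alg_quot (Der A) (inner_derivations A)"

section \<open>Lie algebra notions\<close>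

definition lie_ideal :: "('a::field, 'b) module \<Rightarrow> 'b set \<Rightarrow> bool" where
  "lie_ideal L I \<longleftrightarrow>
     VectorSpace.subspace class_ring I L \<and> (\<forall>a\<in>carrier L. \<forall>b\<in>I. a \<otimes>\<^bsub>L\<^esub> b \<in> I)"

definition lie_center :: "('a, 'b) module \<Rightarrow> 'b set" where
  "lie_center L = {z \<in> carrier L. \<forall>a\<in>carrier L. z \<otimes>\<^bsub>L\<^esub> a = \<zero>\<^bsub>L\<^esub>}"

definition lie_derived :: "('a::field, 'b) module \<Rightarrow> 'b set" where
  "lie_derived L =
     LinearCombinations.module.span class_ring L
       {a \<otimes>\<^bsub>L\<^esub> b | a b. a \<in> carrier L \<and> b \<in> carrier L}"

definition direct_sum_of_ideals :: "('a::field, 'b) module \<Rightarrow> 'b set \<Rightarrow> 'b set \<Rightarrow> bool" where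
  "direct_sum_of_ideals L U W \<longleftrightarrow>
     lie_ideal L U \<and> lie_ideal L W \<and> U <+>\<^bsub>L\<^esub> W = carrier L \<and> U \<inter> W = {\<zero>\<^bsub>L\<^esub>}"

section \<open>The free algebra on two generators\<close>

datatype 'g word = Word "'g list"

instantiation word :: (type) monoid_add
begin

definition zero_word :: "'a word" where
  "zero_word = Word []"

fun plus_word :: "'a word \<Rightarrow> 'a word \<Rightarrow> 'a word" where
  "plus_word (Word u) (Word v) = Word (u @ v)"

instance
proof
  fix a b c :: "'a word"
  show "a + b + c = a + (b + c)"
    by (cases a; cases b; cases c) simp
  show "0 + a = a"
    by (cases a) (simp add: zero_word_def)
  show "a + 0 = a"
    by (cases a) (simp add: zero_word_def)
qed

end

text \<open>\<^typ>\<open>'g word\<close>, the free monoid, is a separate type because \<^const>\<open>times\<close> on \<^typ>\<open>'w \<Rightarrow>\<^sub>0 'a\<close> is the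
  convolution product with respect to an additively written monoid; thus \<^typ>\<open>'g word \<Rightarrow>\<^sub>0 'a\<close>
  is the monoid algebra of the free monoid, i.e. the free associative algebra.\<close>

definition free_algebra :: "('a::field, 'g word \<Rightarrow>\<^sub>0 'a) module" where
  "free_algebra =
     \<lparr>carrier = UNIV, mult = (*), one = 1, zero = 0, add = (+),
      smult = (\<lambda>c p. Poly_Mapping.single 0 c * p)\<rparr>"

definition gen :: "'g \<Rightarrow> 'g word \<Rightarrow>\<^sub>0 'a::field" where
  "gen g = Poly_Mapping.single (Word [g]) 1"

definition poly_at :: "'a::field poly \<Rightarrow> ('g word \<Rightarrow>\<^sub>0 'a) \<Rightarrow> ('g word \<Rightarrow>\<^sub>0 'a)" where
  "poly_at p t = (\<Sum>i\<le>degree p. Poly_Mapping.single 0 (coeff p i) * t ^ i)"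

section \<open>The algebra \<open>A\<^sub>h\<close>\<close>

text \<open>\<open>Y\<close> is the generator usually written with a hat, so \<open>Y X - X Y = h(X)\<close>.\<close>

datatype generator = X | Y

definition Ah_ideal :: "'a::field poly \<Rightarrow> (generator word \<Rightarrow>\<^sub>0 'a) set" where
  "Ah_ideal h = Idl\<^bsub>free_algebra\<^esub> {gen Y * gen X - gen X * gen Y - poly_at h (gen X)}"

definition Ah :: "'a::field poly \<Rightarrow> ('a, (generator word \<Rightarrow>\<^sub>0 'a) set) module" where
  "Ah h = alg_quot free_algebra (Ah_ideal h)"

definition Ah_class ::
  "'a::field poly \<Rightarrow> (generator word \<Rightarrow>\<^sub>0 'a) \<Rightarrow> (generator word \<Rightarrow>\<^sub>0 'a) set" where
  "Ah_class h p = Ah_ideal h +>\<^bsub>free_algebra\<^esub> p"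

definition D_der ::
  "'a::field poly \<Rightarrow> 'a poly
     \<Rightarrow> (generator word \<Rightarrow>\<^sub>0 'a) set \<Rightarrow> (generator word \<Rightarrow>\<^sub>0 'a) set" where
  "D_der h g =
     (THE d. d \<in> derivations (Ah h) \<and>
        d (Ah_class h (gen X)) = \<zero>\<^bsub>Ah h\<^esub> \<and>
        d (Ah_class h (gen Y)) = Ah_class h (poly_at g (gen X)))"

definition D_HH1 ::
  "'a::field poly \<Rightarrow> 'a poly
     \<Rightarrow> ((generator word \<Rightarrow>\<^sub>0 'a) set \<Rightarrow> (generator word \<Rightarrow>\<^sub>0 'a) set) set" where
  "D_HH1 h g = inner_derivations (Ah h) +>\<^bsub>Der (Ah h)\<^esub> D_der h g"

text \<open>The ideal of all \<open>r\<close> with \<open>h dvd h' r\<close> is nonzero for \<open>h \<noteq> 0\<close>, so its monic generator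
  exists and is unique.\<close>

definition pi_poly :: "'a::field poly \<Rightarrow> 'a poly" where
  "pi_poly h = (THE p. lead_coeff p = 1 \<and> (\<forall>r. h dvd pderiv h * r \<longleftrightarrow> p dvd r))"

end

theory Submission
  imports
    Defs
    "HOL-Computational_Algebra.Polynomial_Factorial"
    "HOL-Computational_Algebra.Polynomial_FPS"
begin

text \<open>
  The cohomology is computed inside an algebra of differential operators. The ground field \<open>F\<close> is
  infinite, so some point \<open>pt\<close> has \<open>h(pt) \<noteq> 0\<close>; Taylor expansion at \<open>pt\<close> embeds \<open>F[x]\<close> into \<open>B = F[[t]]\<close> as a
  differential ring in which \<open>h\<close> is invertible. Sending \<open>x\<close> to a multiplication and the second
  generator to \<open>h \<partial>\<close> identifies \<open>A\<^sub>h\<close> with the algebra \<open>A\<close> of operators \<open>\<Sum> h\<^sup>i p\<^sub>i \<partial>\<^sup>i\<close> with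
  polynomials \<open>p\<^sub>i\<close> (\<open>range_rep\<close>, \<open>kernel_rep\<close>). Power series are used because in \<open>B\<close> every
  equation \<open>h G' = -g\<close> has a solution, and then \<open>D\<^sub>g\<close> is the commutator with \<open>G\<close>: derivations
  that are not induced by any operator with rational coefficients become commutators as well. In fact
  (\<open>derivation_of_AA\<close>) the derivations of \<open>A\<close> are exactly the commutators with elements of the
  normalizer \<open>N\<close>, the space of operators \<open>G + \<Sum>\<^sub>i f\<^sub>i \<partial>\<^sup>i\<close> (\<open>i \<ge> 1\<close>) with \<open>h G'\<close> a polynomial and
  \<open>f\<^sub>i\<close> in \<open>\<pi> h\<^bsup>i-1\<^esup> F[x]\<close>. An operator of \<open>N\<close> commuting with \<open>A\<close> is a constant, so \<open>HH\<^sup>1(A\<^sub>h)\<close> is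
  \<open>N/A\<close> with the commutator bracket.

  Write \<open>h = c \<pi>\<close>. Two subspaces of \<open>N\<close> containing \<open>A\<close> are cut out coefficient by coefficient:
  \<open>Z\<close>, where the constant term \<open>L\<close> has \<open>\<pi> L'\<close> polynomial and the other coefficients are those of
  \<open>A\<close>; and \<open>W\<close>, where the constant term lies in \<open>c\<^bsup>-1\<^esup> F[x]\<close> and the other coefficients are those of
  \<open>N\<close>. In \<open>N/A\<close> the first is the center (\<open>ZZ_iff\<close>): the derivatives of such an \<open>L\<close> have only
  poles small enough to be absorbed by \<open>f\<^sub>i\<close>, and conversely bracketing with a \<open>G\<close> such that
  \<open>h G' = 1\<close> detects the top coefficient, bracketing with \<open>\<pi> \<partial>\<close> the constant term. The second is
  the derived algebra (\<open>NN_com_WW\<close>, \<open>WW_generated\<close>): the constant term of a bracket is a value of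
  an operator at some \<open>G\<close>, and the same two kinds of brackets produce everything in \<open>W\<close>.

  What remains is arithmetic of rational functions. That \<open>Z + W = N\<close> (\<open>ZZ_plus_WW\<close>) is Hermite
  reduction: \<open>g/h\<close> is the derivative of a fraction with denominator \<open>c\<close> plus a fraction with
  denominator \<open>\<pi>\<close>. That \<open>Z \<inter> W = A\<close> (\<open>ZZ_inter_WW\<close>) is its uniqueness: a derivative has no simple
  poles. Finally \<open>D\<^bsub>tc\<^esub>\<close> is the class of an \<open>L\<close> with \<open>\<pi> L' = -t\<close>, which lies in \<open>A\<close> only if
  \<open>\<pi>\<close> divides \<open>t\<close>; so the center is parametrized by the remainders modulo \<open>\<pi>\<close>
  (\<open>center_classes\<close>, \<open>center_dim\<close>).
\<close>

section \<open>Irreducible factors of polynomials over a field\<close>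

lemma poly_ideal_generator:
  fixes J :: "'a::field poly set"
  assumes ne: "\<exists>x\<in>J. x \<noteq> 0"
    and add: "\<And>x y. x \<in> J \<Longrightarrow> y \<in> J \<Longrightarrow> x + y \<in> J"
    and mult: "\<And>x y. x \<in> J \<Longrightarrow> y * x \<in> J"
  obtains d where "d \<in> J" "d \<noteq> 0" "\<And>x. x \<in> J \<longleftrightarrow> d dvd x"
proof -
  define P where "P d \<longleftrightarrow> d \<in> J \<and> d \<noteq> 0" for d
  have "\<exists>d. P d" using ne by (auto simp: P_def)
  then obtain d where d: "P d" and least: "\<And>y. P y \<Longrightarrow> degree d \<le> degree y"
    using ex_has_least_nat[of P _ degree] by metis
  have "d dvd x" if "x \<in> J" for x
  proof -
    have "x mod d = x + (- (x div d)) * d"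
      by (simp add: minus_div_mult_eq_mod [symmetric])
    then have "x mod d \<in> J"
      using add mult that d by (metis P_def)
    then have "x mod d = 0"
      using least[of "x mod d"] degree_mod_less[of d x] d by (fastforce simp: P_def)
    then show ?thesis by auto
  qed
  moreover have "x \<in> J" if "d dvd x" for x
    using that d mult by (auto simp: P_def mult.commute elim!: dvdE)
  ultimately show ?thesis using that[of d] d by (auto simp: P_def)
qed

text \<open>
  The ideal generated by \<open>p\<close> and \<open>k\<close> is the whole ring, so \<open>k\<close> is invertible modulo \<open>p\<close>.
\<close>

lemma irreducible_solve_cong:
  fixes p k g :: "'a::field poly"
  assumes irr: "irreducible p" and nd: "\<not> p dvd k"
  obtains t where "p dvd g - t * k"
proof -
  define J where "J = {u * p + v * k | u v. True}"
  have J1: "x + y \<in> J" if "x \<in> J" "y \<in> J" for x y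
  proof -
    from that obtain u v u' v' where "x = u * p + v * k" "y = u' * p + v' * k"
      by (auto simp: J_def)
    then have "x + y = (u + u') * p + (v + v') * k" by (simp add: algebra_simps)
    then show ?thesis unfolding J_def by blast
  qed
  have J2: "y * x \<in> J" if "x \<in> J" for x y
  proof -
    from that obtain u v where "x = u * p + v * k" by (auto simp: J_def)
    then have "y * x = (y * u) * p + (y * v) * k" by (simp add: algebra_simps)
    then show ?thesis unfolding J_def by blast
  qed
  have p: "p \<in> J" unfolding J_def by (rule CollectI, rule exI[of _ 1], rule exI[of _ 0]) simp
  have k: "k \<in> J" unfolding J_def by (rule CollectI, rule exI[of _ 0], rule exI[of _ 1]) simp
  have "p \<noteq> 0" using irr by auto
  have "\<exists>x\<in>J. x \<noteq> 0" using p \<open>p \<noteq> 0\<close> by blast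
  then obtain d where d: "d \<in> J" "\<And>x. x \<in> J \<longleftrightarrow> d dvd x"
    using poly_ideal_generator[OF _ J1 J2] by blast
  obtain e where e: "p = d * e" using d(2) p by blast
  have "\<not> e dvd 1"
  proof
    assume "e dvd 1"
    then have "p dvd d" using e by (metis dvd_mult_unit_iff dvd_refl mult_unit_dvd_iff)
    then show False using nd d(2) k dvd_trans by blast
  qed
  then have "d dvd 1" using irr e irreducibleD by blast
  then have "g \<in> J" using d(2) dvd_trans one_dvd by blast
  then obtain u v where "g = u * p + v * k" by (auto simp: J_def)
  then have "p dvd g - v * k" by simp
  then show ?thesis using that by blast
qed

lemma irreducible_dvd_mult:
  fixes p a b :: "'a::field poly"
  assumes "irreducible p" and "p dvd a * b"
  shows "p dvd a \<or> p dvd b"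
  using assms field_poly_irreducible_imp_prime prime_elem_dvd_multD by blast

lemma degree_irreducible_pos:
  fixes p :: "'a::field poly"
  assumes "irreducible p"
  shows "degree p > 0"
  using assms by (metis gr_zeroI irreducible_def is_unit_iff_degree)

lemma irreducible_factor_exists:
  fixes w :: "'a::field poly"
  assumes "degree w > 0"
  shows "\<exists>p. irreducible p \<and> p dvd w"
  using assms
proof (induction "degree w" arbitrary: w rule: less_induct)
  case less
  show ?case
  proof (cases "irreducible w")
    case False
    then obtain a b where ab: "w = a * b" "\<not> a dvd 1" "\<not> b dvd 1"
    proof -
      assume *: "\<And>a b. w = a * b \<Longrightarrow> \<not> a dvd 1 \<Longrightarrow> \<not> b dvd 1 \<Longrightarrow> thesis"
      have "w \<noteq> 0" using less.prems by auto
      moreover from this have "\<not> w dvd 1" using less.prems is_unit_iff_degree[of w] by auto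
      ultimately show thesis using False * unfolding irreducible_def by blast
    qed
    then have ne: "a \<noteq> 0" "b \<noteq> 0" using less.prems by auto
    then have "degree a > 0" "degree b > 0" using ab is_unit_iff_degree by auto
    then have "\<exists>p. irreducible p \<and> p dvd a"
      using less.hyps[of a] ab ne by (auto simp: degree_mult_eq)
    then show ?thesis using ab by (meson dvd_mult2)
  qed auto
qed

lemma irreducible_not_dvd_pderiv:
  fixes p :: "'a::field_char_0 poly"
  assumes "irreducible p"
  shows "\<not> p dvd pderiv p"
proof
  assume "p dvd pderiv p"
  moreover have pos: "degree p > 0" using assms degree_irreducible_pos by blast
  moreover have "pderiv p \<noteq> 0" using pos by (simp add: pderiv_eq_0_iff)
  ultimately have "degree p \<le> degree (pderiv p)" by (simp add: dvd_imp_degree_le)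
  then show False using pos by (simp add: degree_pderiv)
qed

lemma split_off_power:
  fixes w p :: "'a::field poly"
  assumes "w \<noteq> 0" and "irreducible p"
  obtains k b where "w = p ^ k * b" "\<not> p dvd b"
proof -
  have "\<exists>k b. w = p ^ k * b \<and> \<not> p dvd b"
    using assms(1)
  proof (induction "degree w" arbitrary: w rule: less_induct)
    case less
    show ?case
    proof (cases "p dvd w")
      case True
      then obtain w' where w': "w = p * w'" by blast
      have "degree w' < degree w"
        using w' less.prems degree_irreducible_pos[OF assms(2)] by (auto simp: degree_mult_eq)
      then obtain k b where "w' = p ^ k * b" "\<not> p dvd b" using less.hyps w' less.prems by force
      then show ?thesis using w' by (intro exI[of _ "Suc k"] exI[of _ b]) simp
    next
      case False
      then show ?thesis by (intro exI[of _ 0] exI[of _ w]) simp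
    qed
  qed
  then show ?thesis using that by blast
qed

text \<open>
  The logarithmic derivative of \<open>p\<^sup>k b\<close>, freed of denominators. It is used to compare the powers of
  \<open>p\<close> dividing a polynomial and its derivative.
\<close>

lemma mult_pderiv_power_mult:
  fixes p b :: "'a::field poly"
  shows "p * pderiv (p ^ k * b) = p ^ k * (of_nat k * pderiv p * b + p * pderiv b)"
proof (induction k)
  case (Suc k)
  have "p * pderiv (p ^ Suc k * b) = pderiv p * p * (p ^ k * b) + p * (p * pderiv (p ^ k * b))"
    by (simp add: pderiv_mult algebra_simps)
  also have "\<dots> = p ^ Suc k * (of_nat (Suc k) * pderiv p * b + p * pderiv b)"
    unfolding Suc by (simp add: algebra_simps)
  finally show ?case .
qed simp

section \<open>The radical of a polynomial and Hermite reduction\<close>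

text \<open>
  The defining property of \<open>\<pi>\<^sub>h\<close>, without the normalization to leading coefficient 1. In
  characteristic 0 it makes \<open>r\<close> the product of the distinct prime factors of \<open>h\<close> up to a unit, which
  is the content of \<open>irreducible_factor_dvd\<close> and \<open>squarefree\<close>.
\<close>

locale radical =
  fixes h r :: "'a::field_char_0 poly"
  assumes h_nonzero: "h \<noteq> 0"
    and annihilates: "\<And>q. h dvd pderiv h * q \<longleftrightarrow> r dvd q"
begin

lemma r_dvd_h: "r dvd h"
  using annihilates[of h] by simp

lemma r_nonzero: "r \<noteq> 0"
  using r_dvd_h h_nonzero by auto

definition c where "c = h div r"

lemma h_eq: "h = c * r"
  unfolding c_def using r_dvd_h by simp

lemma c_nonzero: "c \<noteq> 0"
  using h_eq h_nonzero by auto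

text \<open>
  If \<open>p\<^sup>k\<close> is the exact power of \<open>p\<close> in \<open>h\<close>, then \<open>p\<^bsup>k-1\<^esup>\<close> is the exact power in \<open>h'\<close>, because
  \<open>p\<close> does not divide \<open>k p'\<close> in characteristic 0; the missing factor has to come from \<open>r\<close>.
\<close>

lemma irreducible_factor_dvd:
  assumes p: "irreducible p" and ph: "p dvd h"
  shows "p dvd r"
proof -
  obtain k b where kb: "h = p ^ k * b" "\<not> p dvd b" using split_off_power h_nonzero p by blast
  have k: "k > 0" using kb ph by (metis gr_zeroI mult_1 power_0)
  have p0: "p \<noteq> 0" using p by auto
  have "p * h dvd p * (pderiv h * r)" using annihilates[of r] by simp
  also have "p * (pderiv h * r) = p ^ k * ((of_nat k * pderiv p * b + p * pderiv b) * r)"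
    using mult_pderiv_power_mult[of p k b] kb by (metis mult.assoc)
  finally have "p ^ k * (p * b) dvd p ^ k * ((of_nat k * pderiv p * b + p * pderiv b) * r)"
    using kb by (simp add: ac_simps)
  then have "p dvd (of_nat k * pderiv p * b + p * pderiv b) * r"
    using p0 by (metis dvd_mult_cancel_left dvd_mult_left power_not_zero)
  moreover have "\<not> p dvd of_nat k * pderiv p * b + p * pderiv b"
  proof
    assume "p dvd of_nat k * pderiv p * b + p * pderiv b"
    then have "p dvd of_nat k * pderiv p * b" by (simp add: dvd_add_left_iff)
    then have "p dvd smult (of_nat k) (pderiv p * b)"
      by (simp add: of_nat_poly)
    then have "p dvd pderiv p * b"
      using k by (simp add: dvd_smult_iff)
    then show False
      using irreducible_dvd_mult[OF p] irreducible_not_dvd_pderiv[OF p] kb(2) by blast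
  qed
  ultimately show ?thesis using irreducible_dvd_mult[OF p] by blast
qed

text \<open>
  If \<open>p\<^sup>2\<close> divided \<open>r\<close>, then \<open>h = c r\<close> would have so many factors \<open>p\<close> that \<open>p\<close> divides
  \<open>h'/c\<close>. Then \<open>r/p\<close> already annihilates \<open>h'\<close> modulo \<open>h\<close>, contradicting the minimality of \<open>r\<close>.
\<close>

lemma squarefree:
  assumes p: "irreducible p"
  shows "\<not> p * p dvd r"
proof
  assume "p * p dvd r"
  then obtain s where "r = p * p * s" by (rule dvdE)
  then have s: "r = p * (p * s)" by (simp only: mult.assoc)
  have p0: "p \<noteq> 0" using p by auto
  have "h dvd pderiv h * r" using annihilates[of r] by simp
  then obtain q' where "pderiv h * r = h * q'" by (rule dvdE)
  then have "r * pderiv h = r * (c * q')" using h_eq by (simp add: ac_simps)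
  then have q: "pderiv h = c * q'" using r_nonzero by simp
  obtain k b where kb: "c = p ^ k * b" "\<not> p dvd b" using split_off_power c_nonzero p by blast
  have "p dvd q'"
  proof -
    define w where "w = of_nat k * pderiv p * b + p * pderiv b"
    have w: "p * pderiv c = p ^ k * w"
      using mult_pderiv_power_mult[of p k b] kb by (simp add: w_def)
    have "(p ^ k * p) * (b * q') = p * pderiv (c * r)"
      using q kb h_eq by (simp add: ac_simps)
    also have "\<dots> = p * pderiv c * r + p * c * pderiv r"
      by (simp add: pderiv_mult algebra_simps)
    also have "p * pderiv c * r = (p ^ k * p) * (p * (w * s))"
      unfolding w by (subst s) (simp add: ac_simps)
    also have "pderiv r = p * (2 * pderiv p * s + p * pderiv s)"
      by (subst s) (simp add: pderiv_mult algebra_simps)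
    also have "p * c * (p * (2 * pderiv p * s + p * pderiv s))
        = (p ^ k * p) * (p * (b * (2 * pderiv p * s + p * pderiv s)))"
      by (simp add: kb(1) ac_simps)
    also have "(p ^ k * p) * (p * (w * s)) + (p ^ k * p) * (p * (b * (2 * pderiv p * s + p * pderiv s)))
        = (p ^ k * p) * (p * (w * s + b * (2 * pderiv p * s + p * pderiv s)))"
      by (simp add: distrib_left)
    finally have "b * q' = p * (w * s + b * (2 * pderiv p * s + p * pderiv s))"
      using p0 by (simp del: mult_cancel_left add: mult_left_cancel)
    then have "p dvd b * q'" by simp
    then show ?thesis using irreducible_dvd_mult[OF p] kb(2) by blast
  qed
  then obtain q'' where "q' = p * q''" by blast
  then have "pderiv h * (p * s) = h * q''"
    using q s h_eq by (simp add: ac_simps)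
  then have "r dvd p * s" using annihilates[of "p * s"] by simp
  then have "p * (p * s) dvd 1 * (p * s)" using s by simp
  then have "p dvd 1" using r_nonzero s dvd_mult_cancel_right by (metis mult_zero_right)
  then show False using p by (simp add: irreducible_not_unit)
qed

text \<open>
  The derivation \<open>r d/dx\<close> preserves the ideal of each prime factor of \<open>h\<close>, hence of each divisor.
\<close>

lemma dvd_r_mult_pderiv:
  assumes "w dvd h"
  shows "w dvd r * pderiv w"
  using assms
proof (induction "degree w" arbitrary: w rule: less_induct)
  case less
  have w0: "w \<noteq> 0" using less.prems h_nonzero by auto
  show ?case
  proof (cases "degree w = 0")
    case True
    then have "w dvd 1" using w0 is_unit_iff_degree by blast
    then show ?thesis by (meson dvd_trans one_dvd)
  next
    case False
    then obtain p where p: "irreducible p" "p dvd w" using irreducible_factor_exists by blast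
    then obtain v where v: "w = p * v" by blast
    have "degree v < degree w"
      using v w0 degree_irreducible_pos[OF p(1)] by (auto simp: degree_mult_eq)
    moreover have "v dvd h" using v less.prems by (metis dvd_mult_right)
    ultimately have "v dvd r * pderiv v" using less.hyps by blast
    then have "p * v dvd p * (r * pderiv v)" by simp
    moreover have "p * v dvd r * v * pderiv p"
      using irreducible_factor_dvd[OF p(1)] p(2) less.prems dvd_trans
      by (meson dvd_mult2 dvd_refl mult_dvd_mono)
    ultimately have "p * v dvd r * v * pderiv p + p * (r * pderiv v)" by (rule dvd_add[rotated])
    then show ?thesis by (simp add: v pderiv_mult algebra_simps)
  qed
qed

text \<open>
  The quotient \<open>k = r w'/w\<close> is \<open>n p' r/p\<close> modulo \<open>p\<close>, where \<open>n\<close> is the exponent of \<open>p\<close> in \<open>w\<close>;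
  no factor of this is divisible by \<open>p\<close>.
\<close>

lemma log_derivative_coprime:
  assumes wh: "w dvd h" and k: "r * pderiv w = w * k"
    and p: "irreducible p" and pw: "p dvd w"
  shows "\<not> p dvd k"
proof
  assume pk: "p dvd k"
  have p0: "p \<noteq> 0" using p by auto
  have w0: "w \<noteq> 0" using wh h_nonzero by auto
  obtain q where q: "r = p * q" using irreducible_factor_dvd[OF p] pw wh dvd_trans by blast
  obtain n b where nb: "w = p ^ n * b" "\<not> p dvd b" using split_off_power w0 p by blast
  have n: "n > 0" using nb pw by (metis gr_zeroI mult_1 power_0)
  have "p ^ n * (b * k) = q * (p * pderiv w)" using k q nb by (simp add: ac_simps)
  also have "\<dots> = p ^ n * (q * (of_nat n * pderiv p * b + p * pderiv b))"
    using mult_pderiv_power_mult[of p n b] nb by (simp add: ac_simps)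
  finally have "b * k = q * (of_nat n * pderiv p * b + p * pderiv b)"
    using p0 by (simp del: of_nat_mult)
  then have "b * k = q * (of_nat n * pderiv p * b) + p * (q * pderiv b)"
    by (simp add: algebra_simps)
  then have "q * (of_nat n * pderiv p * b) = b * k - p * (q * pderiv b)" by simp
  then have "p dvd q * (of_nat n * pderiv p * b)" using pk by simp
  then have "p dvd smult (of_nat n) (q * (pderiv p * b))" by (simp add: of_nat_poly)
  then have "p dvd q * (pderiv p * b)" using n by (simp add: dvd_smult_iff)
  then have "p dvd q"
    using irreducible_dvd_mult[OF p] irreducible_not_dvd_pderiv[OF p] nb(2) by blast
  then show False using squarefree[OF p] q by (simp add: mult_dvd_mono)
qed

lemma log_derivative_exists:
  assumes "w dvd h"
  obtains k where "r * pderiv w = w * k"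
  using dvd_r_mult_pderiv[OF assms] by blast

text \<open>
  Divided by \<open>c\<^sup>2 r\<close>, the identity says \<open>e g/h = -(s/c)' + t/r\<close>. The quotient \<open>w = c/e\<close> bounds the
  part of the denominator still to be removed: for a prime \<open>p\<close> dividing \<open>w\<close> one splits off
  the derivative of \<open>-e u/c\<close> with \<open>u\<close> such that the remaining numerator is divisible by \<open>p\<close>, which is a
  linear congruence for \<open>u\<close> modulo \<open>p\<close> with the coefficient \<open>r w'/w\<close> invertible modulo \<open>p\<close>.
\<close>

lemma hermite_reduction_step:
  assumes "c = e * w"
  shows "\<exists>s t. e * g * c = r * (s * pderiv c - pderiv s * c) + c * c * t"
  using assms
proof (induction "degree w" arbitrary: e w g rule: less_induct)
  case less
  have w0: "w \<noteq> 0" using less.prems c_nonzero by auto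
  have wh: "w dvd h" using less.prems h_eq by simp
  show ?case
  proof (cases "degree w = 0")
    case True
    then obtain v where v: "1 = w * v" using w0 is_unit_iff_degree by blast
    have "e * g * c = e * g * c * (w * v)" using v by simp
    also have "\<dots> = c * c * (g * v)" using less.prems by (simp add: ac_simps)
    finally show ?thesis by (intro exI[of _ 0] exI[of _ "g * v"]) simp
  next
    case False
    then obtain p where p: "irreducible p" "p dvd w" using irreducible_factor_exists by blast
    then obtain v where v: "w = p * v" by blast
    have deg: "degree v < degree w"
      using v w0 degree_irreducible_pos[OF p(1)] by (auto simp: degree_mult_eq)
    obtain k where k: "r * pderiv w = w * k" using log_derivative_exists[OF wh] .
    have "\<not> p dvd k" by (rule log_derivative_coprime[OF wh k p])
    then obtain u where u: "p dvd g - u * k" using irreducible_solve_cong[OF p(1)] by blast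
    \<comment> \<open>The derivative of \<open>u\<close> does not disturb the congruence, since \<open>p\<close> divides \<open>r\<close>.\<close>
    have "p dvd r" using irreducible_factor_dvd[OF p(1)] p(2) wh dvd_trans by blast
    then have "p dvd g - u * k + r * pderiv u" using u by simp
    then obtain g' where g': "g - u * k + r * pderiv u = p * g'" by blast
    have "c = (e * p) * v" using less.prems v by (simp add: ac_simps)
    from less.hyps[OF deg this, of g']
    obtain s t where st: "e * p * g' * c = r * (s * pderiv c - pderiv s * c) + c * c * t" by blast
    have wr: "e * u * pderiv c - pderiv (e * u) * c = e * e * (u * pderiv w - pderiv u * w)"
      unfolding less.prems by (simp add: pderiv_mult algebra_simps)
    have "r * (e * u * pderiv c - pderiv (e * u) * c)
        = e * e * (u * (r * pderiv w) - r * pderiv u * w)"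
      unfolding wr by (simp add: algebra_simps)
    also have "\<dots> = e * c * (u * k - r * pderiv u)"
      unfolding k less.prems by (simp add: algebra_simps)
    finally have "e * g * c = r * (e * u * pderiv c - pderiv (e * u) * c) + e * c * (p * g')"
      unfolding g'[symmetric] by (simp add: algebra_simps)
    also have "e * c * (p * g') = r * (s * pderiv c - pderiv s * c) + c * c * t"
      using st by (simp add: ac_simps)
    finally have "e * g * c
        = r * ((e * u + s) * pderiv c - pderiv (e * u + s) * c) + c * c * t"
      by (simp add: pderiv_add algebra_simps)
    then show ?thesis by blast
  qed
qed

lemma hermite_reduction:
  obtains s t where "g * c = r * (s * pderiv c - pderiv s * c) + c * c * t"
  using hermite_reduction_step[of 1 c g] by auto

text \<open>
  The hypothesis says that \<open>(s/c)'\<close> has the squarefree denominator \<open>r\<close>, i.e. only simple poles; so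
  \<open>s/c\<close> has no poles at all. Common factors \<open>e\<close> of \<open>s\<close> and \<open>c\<close> are split off one prime at a time.
\<close>

lemma hermite_unique_step:
  assumes "c = e * w" and "s = e * u"
    and "c * c * t = r * (pderiv c * s - c * pderiv s)"
  shows "c dvd s"
  using assms
proof (induction "degree w" arbitrary: e w u rule: less_induct)
  case less
  have w0: "w \<noteq> 0" and e0: "e \<noteq> 0" using less.prems c_nonzero by auto
  have wh: "w dvd h" using less.prems h_eq by simp
  show ?case
  proof (cases "degree w = 0")
    case True
    then have "w dvd 1" using w0 is_unit_iff_degree by blast
    then have "w dvd u" by (meson dvd_trans one_dvd)
    then show ?thesis using less.prems by simp
  next
    case False
    then obtain p where p: "irreducible p" "p dvd w" using irreducible_factor_exists by blast
    then obtain v where v: "w = p * v" by blast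
    have deg: "degree v < degree w"
      using v w0 degree_irreducible_pos[OF p(1)] by (auto simp: degree_mult_eq)
    obtain k where k: "r * pderiv w = w * k" using log_derivative_exists[OF wh] .
    have wr: "pderiv c * s - c * pderiv s = e * e * (pderiv w * u - w * pderiv u)"
      unfolding less.prems(1,2) by (simp add: pderiv_mult algebra_simps)
    have "e * e * w * (w * t) = c * c * t" using less.prems(1) by (simp add: ac_simps)
    also have "\<dots> = e * e * (r * pderiv w * u - w * (r * pderiv u))"
      unfolding less.prems(3) wr by (simp add: algebra_simps)
    also have "\<dots> = e * e * w * (k * u - r * pderiv u)"
      unfolding k by (simp add: algebra_simps)
    finally have "w * t = k * u - r * pderiv u" using e0 w0 by simp
    then have "k * u = w * t + r * pderiv u" by simp
    moreover have "p dvd r" using irreducible_factor_dvd[OF p(1)] p(2) wh dvd_trans by blast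
    ultimately have "p dvd k * u" using p(2) by simp
    then have "p dvd u"
      using irreducible_dvd_mult[OF p(1)] log_derivative_coprime[OF wh k p] by blast
    then obtain u' where "u = p * u'" by blast
    then have "s = (e * p) * u'" "c = (e * p) * v" using less.prems v by (simp_all add: ac_simps)
    then show ?thesis using less.hyps[OF deg] less.prems(3) by blast
  qed
qed

lemma hermite_unique:
  assumes "c * c * t = r * (pderiv c * s - c * pderiv s)"
  shows "c dvd s"
  using hermite_unique_step[of 1 c s s t] assms by simp

end

lemma pi_poly_radical:
  fixes h :: "'a::field_char_0 poly"
  assumes "h \<noteq> 0"
  shows "radical h (pi_poly h)"
proof -
  let ?J = "{q. h dvd pderiv h * q}"
  have add: "x + y \<in> ?J" if "x \<in> ?J" "y \<in> ?J" for x y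
    using that by (simp add: distrib_left)
  have mult: "y * x \<in> ?J" if "x \<in> ?J" for x y
    using that by (metis dvd_mult mem_Collect_eq mult.left_commute)
  obtain d where d: "d \<noteq> 0" "\<And>x. x \<in> ?J \<longleftrightarrow> d dvd x"
  proof (rule poly_ideal_generator[of ?J])
    show "\<exists>x\<in>?J. x \<noteq> 0" using assms by (intro bexI[of _ h]) auto
  qed (use add mult in auto)
  define q where "q = smult (inverse (lead_coeff d)) d"
  have q: "lead_coeff q = 1" "\<And>x. h dvd pderiv h * x \<longleftrightarrow> q dvd x"
    using d by (auto simp: q_def smult_dvd_iff)
  have "p = q" if "lead_coeff p = 1" "\<forall>x. h dvd pderiv h * x \<longleftrightarrow> p dvd x" for p
  proof -
    have pq: "p dvd q" using that(2) q(2)[of q] by simp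
    have qp: "q dvd p" using that(2) q(2)[of p] by simp
    from pq obtain v where v: "q = p * v" by (rule dvdE)
    have ne: "p \<noteq> 0" "q \<noteq> 0" using that(1) q(1) by auto
    then have "v \<noteq> 0" using v by auto
    then have "degree v = 0"
      using dvd_imp_degree_le[OF qp] v ne by (simp add: degree_mult_eq)
    moreover have "lead_coeff v = 1" using v that(1) q(1) by (simp add: lead_coeff_mult)
    ultimately have "v = 1" by (auto simp: one_pCons elim!: degree_eq_zeroE)
    then show ?thesis using v by simp
  qed
  then have "pi_poly h = q" unfolding pi_poly_def using q by (intro the_equality) auto
  then show ?thesis using q assms by (simp add: radical_def)
qed

section \<open>Differential operators on power series\<close>

text \<open>
  Linear endomorphisms of \<open>F[[t]]\<close> form a noncommutative ring, so that associativity and the Jacobi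
  identity for differential operators need no computation with symbols.
\<close>

typedef (overloaded) 'a endo =
  "{f :: 'a::field_char_0 fps \<Rightarrow> 'a fps.
      (\<forall>u v. f (u + v) = f u + f v) \<and> (\<forall>k u. f (fps_const k * u) = fps_const k * f u)}"
  morphisms app Endo
  by (rule exI[of _ id]) simp

setup_lifting type_definition_endo

instantiation endo :: (field_char_0) ring_1
begin

lift_definition zero_endo :: "'a endo" is "\<lambda>_. 0" by simp
lift_definition one_endo :: "'a endo" is "\<lambda>u. u" by simp
lift_definition plus_endo :: "'a endo \<Rightarrow> 'a endo \<Rightarrow> 'a endo" is "\<lambda>f g u. f u + g u"
  by (simp add: algebra_simps)
lift_definition minus_endo :: "'a endo \<Rightarrow> 'a endo \<Rightarrow> 'a endo" is "\<lambda>f g u. f u - g u"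
  by (simp add: algebra_simps)
lift_definition uminus_endo :: "'a endo \<Rightarrow> 'a endo" is "\<lambda>f u. - f u"
  by simp
lift_definition times_endo :: "'a endo \<Rightarrow> 'a endo \<Rightarrow> 'a endo" is "\<lambda>f g u. f (g u)"
  by simp

instance
proof
  show "(0::'a endo) \<noteq> 1" by transfer (metis zero_neq_one)
qed (transfer; simp add: fun_eq_iff algebra_simps)+

end

lemma endo_eqI: "(\<And>u. app v u = app w u) \<Longrightarrow> v = w"
  by (metis app_inject ext)

lemma app_simps [simp]:
  "app 0 u = 0" "app 1 u = u" "app (v + w) u = app v u + app w u"
  "app (v - w) u = app v u - app w u" "app (- v) u = - app v u" "app (v * w) u = app v (app w u)"
  by (transfer; simp)+

lemma app_add: "app v (x + y) = app v x + app v y"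
  by transfer simp

lemma app_0 [simp]: "app v 0 = 0"
  using app_add[of v 0 0] by simp

lift_definition mul :: "'a::field_char_0 fps \<Rightarrow> 'a endo" is "\<lambda>b u. b * u"
  by (simp add: algebra_simps)

lift_definition dif :: "'a::field_char_0 endo" is fps_deriv
  by simp

lemma app_mul [simp]: "app (mul b) u = b * u" by transfer simp
lemma app_dif [simp]: "app dif u = fps_deriv u" by transfer simp

lemma mul_simps:
  "mul 0 = 0" "mul 1 = 1" "mul (a + b) = mul a + mul b" "mul (a - b) = mul a - mul b"
  "mul (- a) = - mul a" "mul (a * b) = mul a * mul b"
  by (rule endo_eqI; simp add: algebra_simps)+

lemma mul_commute: "mul a * mul b = mul b * mul a"
  by (metis mul_simps(6) mult.commute)

lemma mul_eq_iff: "mul a = mul b \<longleftrightarrow> a = b"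
  by (metis app_mul mult.right_neutral)

lemma dif_mul: "dif * mul b = mul b * dif + mul (fps_deriv b)"
  by (rule endo_eqI) (simp add: algebra_simps)

text \<open>
  This is the linearity of endomorphisms; it makes \<open>endo\<close> an algebra over the ground field.
\<close>

lemma mul_const_central: "w * mul (fps_const k) = mul (fps_const k) * w"
proof (rule endo_eqI)
  fix u
  have "app w (fps_const k * u) = fps_const k * app w u" by transfer simp
  then show "app (w * mul (fps_const k)) u = app (mul (fps_const k) * w) u" by simp
qed

definition scal :: "'a::field_char_0 \<Rightarrow> 'a endo \<Rightarrow> 'a endo" where
  "scal k w = mul (fps_const k) * w"

lemma scal_simps:
  "scal k (v + w) = scal k v + scal k w" "scal k (v - w) = scal k v - scal k w"
  "scal (k + l) w = scal k w + scal l w" "scal k (scal l w) = scal (k * l) w" "scal 1 w = w"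
  "scal k v * w = scal k (v * w)" "v * scal k w = scal k (v * w)" "scal k 0 = 0" "scal 0 w = 0"
proof -
  show "v * scal k w = scal k (v * w)"
    unfolding scal_def by (metis mul_const_central mult.assoc)
  show "scal (k + l) w = scal k w + scal l w"
    unfolding scal_def fps_const_add[symmetric] mul_simps by (simp add: algebra_simps)
  show "scal k (scal l w) = scal (k * l) w"
    unfolding scal_def fps_const_mult[symmetric] mul_simps by (simp add: mult.assoc)
qed (simp_all add: scal_def algebra_simps mul_simps)

lemma vector_space_scal: "vector_space scal"
  by unfold_locales (simp_all add: scal_simps)

definition op :: "'a::field_char_0 fps poly \<Rightarrow> 'a endo" where
  "op P = (\<Sum>i\<le>degree P. mul (coeff P i) * dif ^ i)"

lemma op_bound: "degree P \<le> n \<Longrightarrow> op P = (\<Sum>i\<le>n. mul (coeff P i) * dif ^ i)"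
  unfolding op_def by (rule sum.mono_neutral_left) (auto simp: coeff_eq_0 mul_simps)

lemma op_0 [simp]: "op 0 = 0"
  by (simp add: op_def mul_simps)

lemma op_add: "op (P + Q) = op P + op Q"
proof -
  let ?n = "max (degree P) (degree Q)"
  have "degree (P + Q) \<le> ?n" by (rule degree_add_le_max)
  then show ?thesis
    using op_bound[of P ?n] op_bound[of Q ?n] op_bound[of "P + Q" ?n]
    by (simp add: mul_simps distrib_right sum.distrib)
qed

lemma op_minus: "op (- P) = - op P"
  by (simp add: op_def mul_simps sum_negf)

lemma op_diff: "op (P - Q) = op P - op Q"
  using op_add[of P "- Q"] by (simp add: op_minus)

lemma op_sum: "op (\<Sum>x\<in>A. f x) = (\<Sum>x\<in>A. op (f x))"
  by (induction A rule: infinite_finite_induct) (simp_all add: op_add)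

lemma op_monom: "op (monom b n) = mul b * dif ^ n"
proof -
  have "op (monom b n) = (\<Sum>i\<le>n. mul (coeff (monom b n) i) * dif ^ i)"
    by (rule op_bound) (rule degree_monom_le)
  also have "\<dots> = (\<Sum>i\<in>{n}. mul (coeff (monom b n) i) * dif ^ i)"
    by (rule sum.mono_neutral_right) (auto simp: mul_simps)
  finally show ?thesis by simp
qed

lemma op_pCons: "op (pCons b P) = mul b + op P * dif"
proof -
  have "op (pCons b P) = (\<Sum>i\<le>Suc (degree P). mul (coeff (pCons b P) i) * dif ^ i)"
    by (rule op_bound) (rule degree_pCons_le)
  also have "\<dots> = mul b + (\<Sum>i\<le>degree P. mul (coeff P i) * dif ^ Suc i)"
    by (subst sum.atMost_Suc_shift) simp
  also have "(\<Sum>i\<le>degree P. mul (coeff P i) * dif ^ Suc i) = op P * dif"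
    by (simp add: op_def sum_distrib_right mult.assoc power_commutes)
  finally show ?thesis .
qed

lemma app_op_1: "app (op P) 1 = coeff P 0"
  by (cases P) (simp add: op_pCons)

lemma fps_deriv_surj: "\<exists>v. fps_deriv v = (u :: 'a::field_char_0 fps)"
  using fps_deriv_fps_integral[of u 0] by blast

text \<open>
  Evaluation at 1 yields the constant coefficient; once it vanishes, the operator factors through
  \<open>\<partial>\<close>, which is surjective, and the order can be lowered. So symbols are unique.
\<close>

lemma op_eq_0_iff [simp]: "op P = 0 \<longleftrightarrow> P = 0"
proof
  show "op P = 0 \<Longrightarrow> P = 0"
  proof (induction P)
    case (pCons b P)
    have b: "b = 0" using pCons.prems app_op_1[of "pCons b P"] by simp
    have "op P = 0"
    proof (rule endo_eqI)
      fix u :: "'a fps"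
      obtain v where "fps_deriv v = u" using fps_deriv_surj by blast
      then have "app (op P) u = app (op (pCons b P)) v" by (simp add: op_pCons b)
      then show "app (op P) u = app 0 u" using pCons.prems by simp
    qed
    then show ?case using pCons.IH b by simp
  qed simp
qed simp

lemma op_eq_iff: "op P = op Q \<longleftrightarrow> P = Q"
  using op_eq_0_iff[of "P - Q"] by (simp add: op_diff)

lemma dif_op: "dif * op P = op (pCons 0 P + map_poly fps_deriv P)"
proof (induction P)
  case (pCons b P)
  have "dif * op (pCons b P) = mul (fps_deriv b) + mul b * dif + (dif * op P) * dif"
    by (simp add: op_pCons distrib_left dif_mul mult.assoc)
  also have "\<dots> = op (pCons 0 (pCons b P) + map_poly fps_deriv (pCons b P))"
    by (simp add: pCons.IH op_pCons op_add map_poly_pCons mul_simps algebra_simps)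
  finally show ?case .
qed simp

definition diff_ops :: "'a::field_char_0 endo set" where
  "diff_ops = range op"

lemma op_in_diff_ops [simp]: "op P \<in> diff_ops" by (simp add: diff_ops_def)

lemma diff_ops_add: "v \<in> diff_ops \<Longrightarrow> w \<in> diff_ops \<Longrightarrow> v + w \<in> diff_ops"
  by (auto simp: diff_ops_def op_add[symmetric])
lemma diff_ops_diff: "v \<in> diff_ops \<Longrightarrow> w \<in> diff_ops \<Longrightarrow> v - w \<in> diff_ops"
  by (auto simp: diff_ops_def op_diff[symmetric])
lemma mul_in_diff_ops: "mul b \<in> diff_ops"
  using op_in_diff_ops[of "[:b:]"] by (simp add: op_pCons)
lemma diff_ops_mult_dif: "v \<in> diff_ops \<Longrightarrow> v * dif \<in> diff_ops"
proof -
  assume "v \<in> diff_ops"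
  then obtain P where "v = op P" by (auto simp: diff_ops_def)
  then have "v * dif = op (pCons 0 P)" by (simp add: op_pCons mul_simps)
  then show ?thesis by simp
qed

lemma op_mult_mul_in_diff_ops: "op P * mul b \<in> diff_ops"
proof (induction P arbitrary: b)
  case 0
  then show ?case using mul_in_diff_ops[of 0] by (simp add: mul_simps)
next
  case (pCons f P)
  have "op (pCons f P) * mul b = mul (f * b) + (op P * mul b) * dif + op P * mul (fps_deriv b)"
    by (simp add: op_pCons mul_simps dif_mul distrib_left distrib_right mult.assoc)
  then show ?case
    by (simp add: diff_ops_add diff_ops_mult_dif mul_in_diff_ops pCons.IH)
qed

text \<open>
  Closure under products, obtained by induction on the right factor, guarantees that commutators of
  differential operators have symbols without computing them.
\<close>

lemma diff_ops_mult: "v \<in> diff_ops \<Longrightarrow> w \<in> diff_ops \<Longrightarrow> v * w \<in> diff_ops"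
proof -
  have "op P * op Q \<in> diff_ops" for P Q :: "'a fps poly"
  proof (induction Q)
    case 0
    then show ?case using mul_in_diff_ops[of 0] by (simp add: mul_simps)
  next
    case (pCons b Q)
    have "op P * op (pCons b Q) = op P * mul b + (op P * op Q) * dif"
      by (simp add: op_pCons algebra_simps)
    then show ?case by (simp add: diff_ops_add diff_ops_mult_dif op_mult_mul_in_diff_ops pCons.IH)
  qed
  then show "v \<in> diff_ops \<Longrightarrow> w \<in> diff_ops \<Longrightarrow> v * w \<in> diff_ops" unfolding diff_ops_def by auto
qed

definition com :: "'a::ring \<Rightarrow> 'a \<Rightarrow> 'a" where
  "com v w = v * w - w * v"

lemma com_simps:
  "com (u + v) w = com u w + com v w" "com w (u + v) = com w u + com w v"
  "com (u - v) w = com u w - com v w" "com w (u - v) = com w u - com w v"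
  "com (- v) w = - com v w" "com w (- v) = - com w v" "com v v = 0"
  "com 0 w = 0" "com w 0 = 0"
  by (simp_all add: com_def algebra_simps)

lemma com_swap: "com v w = - com w v" by (simp add: com_def)

lemma com_mult: "com w (u * v) = com w u * v + u * com w v"
  by (simp add: com_def algebra_simps)

lemma com_com: "com (com v w) a = com v (com w a) - com w (com v a)"
  by (simp add: com_def algebra_simps)

lemma com_sum: "com (\<Sum>x\<in>A. f x) w = (\<Sum>x\<in>A. com (f x) w)"
  by (induction A rule: infinite_finite_induct) (simp_all add: com_simps)

lemma com_scal: "com (scal k v) w = scal k (com v w)" "com v (scal k w) = scal k (com v w)"
  by (simp_all add: com_def scal_simps)

lemma diff_ops_com: "v \<in> diff_ops \<Longrightarrow> w \<in> diff_ops \<Longrightarrow> com v w \<in> diff_ops"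
  unfolding com_def by (intro diff_ops_diff diff_ops_mult)

lemma com_mul_mul: "com (mul a) (mul b) = 0"
  by (simp add: com_def mul_commute)

text \<open>
  The Leibniz rule, as an identity of operators.
\<close>

lemma dif_power_mul:
  "dif ^ n * mul g = op (\<Sum>k\<le>n. monom (of_nat (n choose k) * (fps_deriv ^^ (n - k)) g) k)"
proof (induction n)
  case 0
  show ?case by (simp add: op_monom)
next
  case (Suc n)
  define Q where "Q n = (\<Sum>k\<le>n. monom (of_nat (n choose k) * (fps_deriv ^^ (n - k)) g) k)" for n
  have cQ: "coeff (Q n) k = of_nat (n choose k) * (fps_deriv ^^ (n - k)) g" for n k
    by (simp add: Q_def coeff_sum binomial_eq_0)
  have "dif ^ Suc n * mul g = dif * op (Q n)" using Suc by (simp add: Q_def mult.assoc)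
  also have "\<dots> = op (Q (Suc n))"
    unfolding dif_op
  proof (rule arg_cong[where f = op], rule poly_eqI)
    fix k
    show "coeff (pCons 0 (Q n) + map_poly fps_deriv (Q n)) k = coeff (Q (Suc n)) k"
    proof (cases k)
      case (Suc m)
      consider "m < n" | "m = n" | "m > n" by linarith
      then show ?thesis
      proof cases
        case 1
        then have "n - m = Suc (n - Suc m)" by simp
        then show ?thesis
          by (simp add: Suc cQ coeff_map_poly fps_deriv_mult algebra_simps)
      qed (simp_all add: Suc cQ coeff_map_poly binomial_eq_0)
    qed (simp add: cQ coeff_map_poly)
  qed
  finally show ?case by (simp add: Q_def)
qed

text \<open>
  The symbol of \<open>[f \<partial>\<^sup>n, g]\<close>, i.e. the Leibniz expansion without its leading term.
\<close>

definition com_symbol :: "'a::field_char_0 fps \<Rightarrow> nat \<Rightarrow> 'a fps \<Rightarrow> 'a fps poly" where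
  "com_symbol f n g = (\<Sum>k<n. monom (f * of_nat (n choose k) * (fps_deriv ^^ (n - k)) g) k)"

lemma coeff_com_symbol:
  "coeff (com_symbol f n g) k = (if k < n then f * of_nat (n choose k) * (fps_deriv ^^ (n - k)) g else 0)"
  by (simp add: com_symbol_def coeff_sum)

lemma op_smult: "op (smult b P) = mul b * op P"
  by (induction P) (simp_all add: op_pCons mul_simps distrib_left mult.assoc)

lemma com_monom_mul: "com (mul f * dif ^ n) (mul g) = op (com_symbol f n g)"
proof -
  have "mul f * dif ^ n * mul g
      = op (smult f (\<Sum>k\<le>n. monom (of_nat (n choose k) * (fps_deriv ^^ (n - k)) g) k))"
    unfolding op_smult dif_power_mul[symmetric] by (simp add: mult.assoc)
  also have "smult f (\<Sum>k\<le>n. monom (of_nat (n choose k) * (fps_deriv ^^ (n - k)) g) k)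
      = com_symbol f n g + monom (f * g) n"
    by (rule poly_eqI) (auto simp: coeff_sum coeff_com_symbol binomial_eq_0 mult.assoc)
  finally show ?thesis
    by (simp add: com_def op_add op_monom mul_simps mul_commute mult.assoc[symmetric])
qed

lemma com_monom_dif:
  "com (mul f * dif ^ n) (mul g * dif)
     = op (pCons 0 (com_symbol f n g) - monom (g * fps_deriv f) n)"
proof -
  have "com (mul f * dif ^ n) (mul g * dif)
      = com (mul f * dif ^ n) (mul g) * dif + mul g * com (mul f * dif ^ n) dif"
    by (rule com_mult)
  also have "com (mul f * dif ^ n) dif = - (mul (fps_deriv f) * dif ^ n)"
    using dif_mul[of f] by (simp add: com_def algebra_simps power_commutes)
      (metis add_diff_cancel_left' mult.assoc distrib_right)
  finally show ?thesis
    by (simp add: com_monom_mul op_diff op_pCons op_monom mul_simps mult.assoc)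
qed

text \<open>
  All spaces of operators that matter are given by a condition on each coefficient separately, which
  reduces sums, intersections and inclusions to coefficients.
\<close>

definition ops_in :: "(nat \<Rightarrow> 'a::field_char_0 fps set) \<Rightarrow> 'a endo set" where
  "ops_in S = {op P | P. \<forall>i. coeff P i \<in> S i}"

lemma op_in_ops_in_iff: "op P \<in> ops_in S \<longleftrightarrow> (\<forall>i. coeff P i \<in> S i)"
  by (auto simp: ops_in_def op_eq_iff)

lemma ops_in_subset_diff_ops: "ops_in S \<subseteq> diff_ops"
  by (auto simp: ops_in_def)

lemma ops_in_mono: "(\<And>i. S i \<subseteq> T i) \<Longrightarrow> ops_in S \<subseteq> ops_in T"
  by (auto simp: ops_in_def)

definition linear_set :: "'a::field_char_0 fps set \<Rightarrow> bool" where
  "linear_set U \<longleftrightarrow> 0 \<in> U \<and> (\<forall>a\<in>U. \<forall>b\<in>U. a + b \<in> U) \<and> (\<forall>k. \<forall>a\<in>U. fps_const k * a \<in> U)"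

lemma linear_setD:
  assumes "linear_set U"
  shows "0 \<in> U" "a \<in> U \<Longrightarrow> b \<in> U \<Longrightarrow> a + b \<in> U" "a \<in> U \<Longrightarrow> fps_const k * a \<in> U"
    "a \<in> U \<Longrightarrow> - a \<in> U" "a \<in> U \<Longrightarrow> b \<in> U \<Longrightarrow> a - b \<in> U"
    "a \<in> U \<Longrightarrow> of_nat n * a \<in> U"
proof -
  show *: "- a \<in> U" if "a \<in> U" for a
    using assms that unfolding linear_set_def
    by (metis fps_const_1_eq_1 fps_const_neg minus_mult_left mult_1)
  show "a \<in> U \<Longrightarrow> b \<in> U \<Longrightarrow> a - b \<in> U"
    using assms *[of b] unfolding linear_set_def by (metis uminus_add_conv_diff add.commute)
  show "a \<in> U \<Longrightarrow> of_nat n * a \<in> U"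
    using assms unfolding linear_set_def by (metis fps_of_nat)
qed (use assms in \<open>auto simp: linear_set_def\<close>)

locale graded_space =
  fixes S :: "nat \<Rightarrow> 'a::field_char_0 fps set"
  assumes linear: "linear_set (S i)"
begin

lemma ops_in_0: "0 \<in> ops_in S"
  using op_in_ops_in_iff[of 0 S] linear linear_setD(1) by fastforce

lemma ops_in_add: "v \<in> ops_in S \<Longrightarrow> w \<in> ops_in S \<Longrightarrow> v + w \<in> ops_in S"
proof -
  assume "v \<in> ops_in S" "w \<in> ops_in S"
  then obtain P Q where "v = op P" "w = op Q" "\<And>i. coeff P i \<in> S i" "\<And>i. coeff Q i \<in> S i"
    by (auto simp: ops_in_def)
  then show ?thesis by (simp add: op_add[symmetric] op_in_ops_in_iff linear_setD(2)[OF linear])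
qed

lemma ops_in_diff: "v \<in> ops_in S \<Longrightarrow> w \<in> ops_in S \<Longrightarrow> v - w \<in> ops_in S"
proof -
  assume "v \<in> ops_in S" "w \<in> ops_in S"
  then obtain P Q where "v = op P" "w = op Q" "\<And>i. coeff P i \<in> S i" "\<And>i. coeff Q i \<in> S i"
    by (auto simp: ops_in_def)
  then show ?thesis by (simp add: op_diff[symmetric] op_in_ops_in_iff linear_setD(5)[OF linear])
qed

lemma ops_in_minus: "v \<in> ops_in S \<Longrightarrow> - v \<in> ops_in S"
  using ops_in_diff[OF ops_in_0] by simp

lemma ops_in_scal: "v \<in> ops_in S \<Longrightarrow> scal k v \<in> ops_in S"
proof -
  assume "v \<in> ops_in S"
  then obtain P where "v = op P" "\<And>i. coeff P i \<in> S i" by (auto simp: ops_in_def)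
  then show ?thesis
    by (simp add: scal_def op_smult[symmetric] op_in_ops_in_iff linear_setD(3)[OF linear])
qed

lemma ops_in_sum: "(\<And>x. x \<in> A \<Longrightarrow> f x \<in> ops_in S) \<Longrightarrow> (\<Sum>x\<in>A. f x) \<in> ops_in S"
  by (induction A rule: infinite_finite_induct) (auto intro: ops_in_0 ops_in_add)

lemma ops_in_monom: "f \<in> S n \<Longrightarrow> mul f * dif ^ n \<in> ops_in S"
  unfolding op_monom[symmetric] op_in_ops_in_iff using linear_setD(1)[OF linear] by auto

lemma ops_in_mul: "f \<in> S 0 \<Longrightarrow> mul f \<in> ops_in S"
  using ops_in_monom[of f 0] by simp

end

lemma ops_in_induct [consumes 1, case_names add monom]:
  assumes w: "w \<in> ops_in S"
    and add: "\<And>v w. Q v \<Longrightarrow> Q w \<Longrightarrow> Q (v + w)"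
    and monom: "\<And>f n. f \<in> S n \<Longrightarrow> Q (mul f * dif ^ n)"
  shows "Q w"
proof -
  obtain P where P: "w = op P" "\<And>i. coeff P i \<in> S i" using w by (auto simp: ops_in_def)
  have "Q (\<Sum>i\<le>n. mul (coeff P i) * dif ^ i)" for n
  proof (induction n)
    case (Suc n)
    show ?case unfolding sum.atMost_Suc by (rule add[OF Suc monom[OF P(2)]])
  qed (use monom[OF P(2), of 0] in simp)
  then show ?thesis by (simp add: P op_def)
qed

section \<open>The algebra, its normalizer and two subspaces\<close>

lemma poly_antiderivative: "\<exists>q. pderiv q = (p :: 'a::field_char_0 poly)"
proof -
  let ?q = "\<Sum>i\<le>degree p. monom (coeff p i / of_nat (Suc i)) (Suc i)"
  have "pderiv ?q = p"
    by (rule poly_eqI) (simp add: coeff_pderiv coeff_sum coeff_eq_0 del: of_nat_Suc)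
  then show ?thesis by blast
qed

lemma mult_deriv_power:
  "K * fps_deriv (K ^ n) = of_nat n * fps_deriv K * (K :: 'a::field_char_0 fps) ^ n"
proof (induction n)
  case (Suc n)
  have "K * fps_deriv (K ^ Suc n) = K * fps_deriv K * K ^ n + K * (K * fps_deriv (K ^ n))"
    by (simp add: algebra_simps)
  then show ?case unfolding Suc by (simp add: algebra_simps)
qed simp

lemma symbol_antiderivative:
  fixes P :: "'a::field_char_0 fps poly"
  obtains U where "pderiv U = P" and "coeff U 0 = 0"
    and "\<And>i. coeff U (Suc i) = fps_const (1 / of_nat (Suc i)) * coeff P i"
proof -
  define U where "U = (\<Sum>i\<le>degree P. monom (fps_const (1 / of_nat (Suc i)) * coeff P i) (Suc i))"
  have c: "coeff U (Suc i) = fps_const (1 / of_nat (Suc i)) * coeff P i" for i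
    by (simp add: U_def coeff_sum coeff_eq_0 del: of_nat_Suc)
  have "pderiv U = P"
  proof (rule poly_eqI)
    fix i
    have "of_nat (Suc i) * fps_const (1 / of_nat (Suc i) :: 'a) = 1"
      by (simp add: fps_of_nat[symmetric] del: of_nat_Suc)
    then show "coeff (pderiv U) i = coeff P i"
      by (simp add: coeff_pderiv c mult.assoc[symmetric] del: of_nat_Suc)
  qed
  moreover have "coeff U 0 = 0" by (simp add: U_def coeff_sum)
  ultimately show ?thesis using c that by blast
qed

text \<open>
  Expanding at a point where \<open>h\<close> does not vanish makes \<open>h\<close> invertible as a power series. The images
  of \<open>h\<close>, \<open>c\<close> and \<open>r = \<pi>\<close> under the Taylor expansion \<open>emb\<close> are \<open>H\<close>, \<open>C\<close> and \<open>\<rho>\<close>, and \<open>RR\<close> is the image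
  of the polynomial ring.
\<close>

locale Ah_model = radical h r for h r :: "'a::field_char_0 poly" +
  fixes pt :: 'a
  assumes h_pt: "poly h pt \<noteq> 0"
begin

definition emb :: "'a poly \<Rightarrow> 'a fps" where
  "emb p = fps_of_poly (pcompose p [:pt, 1:])"

lemma emb_simps:
  "emb 0 = 0" "emb 1 = 1" "emb (p + q) = emb p + emb q" "emb (p - q) = emb p - emb q"
  "emb (- p) = - emb p" "emb (p * q) = emb p * emb q" "emb [:k:] = fps_const k"
  "emb (pderiv p) = fps_deriv (emb p)" "emb (smult k p) = fps_const k * emb p"
  by (simp_all add: emb_def pcompose_add pcompose_diff pcompose_uminus pcompose_mult pcompose_1
      fps_of_poly_simps fps_of_poly_const fps_of_poly_pderiv[symmetric] pderiv_pcompose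
      pcompose_smult pderiv_pCons one_pCons[symmetric])

lemma emb_eq_iff: "emb p = emb q \<longleftrightarrow> p = q"
proof -
  have "pcompose (p - q) [:pt, 1:] = 0 \<longleftrightarrow> p - q = 0" by (rule pcompose_eq_0_iff) simp
  then show ?thesis by (simp add: emb_def fps_of_poly_eq_iff pcompose_diff)
qed

abbreviation "H \<equiv> emb h"
abbreviation "C \<equiv> emb c"
abbreviation "\<rho> \<equiv> emb r"

lemma H_eq: "H = C * \<rho>" using h_eq emb_simps(6) by metis

lemma H_nth_0: "fps_nth H 0 \<noteq> 0"
  using h_pt by (simp add: emb_def pcompose_coeff_0)

lemma nonzero: "H \<noteq> 0" "C \<noteq> 0" "\<rho> \<noteq> 0"
  using H_nth_0 H_eq by (metis fps_zero_nth, metis mult_zero_left fps_zero_nth, metis mult_zero_right fps_zero_nth)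

lemma inverse_H: "H * inverse H = 1"
  using H_nth_0 inverse_mult_eq_1' by blast

lemma C_nth_0: "fps_nth C 0 \<noteq> 0"
  using H_nth_0 by (auto simp: H_eq fps_mult_nth_0)

definition RR :: "'a fps set" where "RR = range emb"

lemma emb_RR [simp]: "emb p \<in> RR" by (simp add: RR_def)

lemma RR_add [simp]: "u \<in> RR \<Longrightarrow> v \<in> RR \<Longrightarrow> u + v \<in> RR"
  by (auto simp: RR_def emb_simps(3)[symmetric])
lemma RR_diff [simp]: "u \<in> RR \<Longrightarrow> v \<in> RR \<Longrightarrow> u - v \<in> RR"
  by (auto simp: RR_def emb_simps(4)[symmetric])
lemma RR_minus [simp]: "u \<in> RR \<Longrightarrow> - u \<in> RR"
  by (auto simp: RR_def emb_simps(5)[symmetric])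
lemma RR_mult [simp]: "u \<in> RR \<Longrightarrow> v \<in> RR \<Longrightarrow> u * v \<in> RR"
  by (auto simp: RR_def emb_simps(6)[symmetric])
lemma RR_const [simp]: "fps_const k \<in> RR"
  using emb_RR[of "[:k:]"] by (simp add: emb_simps)
lemma RR_0 [simp]: "0 \<in> RR" using emb_RR[of 0] by (simp add: emb_simps)
lemma RR_1 [simp]: "1 \<in> RR" using emb_RR[of 1] by (simp add: emb_simps)
lemma RR_of_nat [simp]: "of_nat n \<in> RR"
  by (simp add: fps_of_nat[symmetric])
lemma RR_deriv [simp]: "u \<in> RR \<Longrightarrow> fps_deriv u \<in> RR"
  by (auto simp: RR_def emb_simps(8)[symmetric])
lemma RR_power [simp]: "u \<in> RR \<Longrightarrow> u ^ n \<in> RR"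
  by (induction n) simp_all
lemma RR_higher_deriv [simp]: "u \<in> RR \<Longrightarrow> (fps_deriv ^^ n) u \<in> RR"
  by (induction n) simp_all

text \<open>
  The coefficients of \<open>\<partial>\<^sup>i\<close> allowed in \<open>A\<close> (below \<open>AA\<close>), in its normalizer \<open>N\<close> (\<open>NN\<close>), and in the
  subspaces \<open>Z\<close> and \<open>W\<close> of \<open>N\<close> (\<open>ZZ\<close> and \<open>WW\<close>) that will turn out to be the preimages of the center and of the derived algebra of
  \<open>N/A\<close>. The constant terms in \<open>N\<close> and \<open>Z\<close> are power series, in general not rational: they are
  primitives of fractions with denominator \<open>h\<close> and \<open>\<pi>\<close>, respectively.
\<close>

definition A_coeff :: "nat \<Rightarrow> 'a fps set" where
  "A_coeff i = {H ^ i * u | u. u \<in> RR}"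

definition N_coeff :: "nat \<Rightarrow> 'a fps set" where
  "N_coeff i = (case i of 0 \<Rightarrow> {G. H * fps_deriv G \<in> RR} | Suc m \<Rightarrow> {\<rho> * H ^ m * u | u. u \<in> RR})"

definition Z_coeff :: "nat \<Rightarrow> 'a fps set" where
  "Z_coeff i = (if i = 0 then {L. \<rho> * fps_deriv L \<in> RR} else A_coeff i)"

definition W_coeff :: "nat \<Rightarrow> 'a fps set" where
  "W_coeff i = (if i = 0 then {G. C * G \<in> RR} else N_coeff i)"

lemma N_coeff_simps:
  "G \<in> N_coeff 0 \<longleftrightarrow> H * fps_deriv G \<in> RR"
  "f \<in> N_coeff (Suc m) \<longleftrightarrow> (\<exists>u\<in>RR. f = \<rho> * H ^ m * u)"
  by (auto simp: N_coeff_def)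

lemma A_coeff_iff: "f \<in> A_coeff i \<longleftrightarrow> (\<exists>u\<in>RR. f = H ^ i * u)"
  by (auto simp: A_coeff_def)

lemma A_coeffI: "k \<le> n \<Longrightarrow> u \<in> RR \<Longrightarrow> H ^ n * u \<in> A_coeff k"
proof -
  assume "k \<le> n" "u \<in> RR"
  then have "H ^ n * u = H ^ k * (H ^ (n - k) * u)" by (simp add: power_add[symmetric] mult.assoc[symmetric])
  then show ?thesis using \<open>u \<in> RR\<close> unfolding A_coeff_iff
    by (intro bexI[of _ "H ^ (n - k) * u"]) simp_all
qed

lemma linear_set_multiples: "linear_set {K * u | u. u \<in> RR}"
  unfolding linear_set_def
proof (intro conjI ballI allI)
  show "0 \<in> {K * u | u. u \<in> RR}" by (rule CollectI, rule exI[of _ 0]) simp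
  fix a b assume "a \<in> {K * u | u. u \<in> RR}" "b \<in> {K * u | u. u \<in> RR}"
  then obtain u v where uv: "a = K * u" "b = K * v" "u \<in> RR" "v \<in> RR" by blast
  then have "a + b = K * (u + v)" by (simp add: distrib_left)
  then show "a + b \<in> {K * u | u. u \<in> RR}" using RR_add[OF uv(3,4)] by blast
next
  fix k a assume "a \<in> {K * u | u. u \<in> RR}"
  then obtain u where u: "a = K * u" "u \<in> RR" by blast
  then have "fps_const k * a = K * (fps_const k * u)" by (simp add: ac_simps)
  then show "fps_const k * a \<in> {K * u | u. u \<in> RR}" using RR_mult[OF RR_const u(2)] by blast
qed

lemma linear_set_deriv: "linear_set {G. K * fps_deriv G \<in> RR}"
  unfolding linear_set_def
proof (intro conjI ballI allI)
  fix k a assume "a \<in> {G. K * fps_deriv G \<in> RR}"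
  moreover have "K * fps_deriv (fps_const k * a) = fps_const k * (K * fps_deriv a)"
    by (simp add: ac_simps)
  ultimately show "fps_const k * a \<in> {G. K * fps_deriv G \<in> RR}"
    by (simp only: mem_Collect_eq RR_mult RR_const)
qed (auto simp: distrib_left)

lemma linear_set_div: "linear_set {G. K * G \<in> RR}"
  unfolding linear_set_def
proof (intro conjI ballI allI)
  fix k a assume "a \<in> {G. K * G \<in> RR}"
  moreover have "K * (fps_const k * a) = fps_const k * (K * a)"
    by (simp add: ac_simps)
  ultimately show "fps_const k * a \<in> {G. K * G \<in> RR}"
    by (simp only: mem_Collect_eq RR_mult RR_const)
qed (auto simp: distrib_left)

sublocale A: graded_space A_coeff
  by unfold_locales (simp add: A_coeff_def linear_set_multiples)
sublocale N: graded_space N_coeff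
  by unfold_locales (auto simp: N_coeff_def linear_set_multiples linear_set_deriv split: nat.split)
sublocale Z: graded_space Z_coeff
  by unfold_locales (auto simp: Z_coeff_def linear_set_deriv A.linear)
sublocale W: graded_space W_coeff
  by unfold_locales (auto simp: W_coeff_def linear_set_div N.linear)

definition "AA = ops_in A_coeff"
definition "NN = ops_in N_coeff"
definition "ZZ = ops_in Z_coeff"
definition "WW = ops_in W_coeff"

lemmas A_closed = A.ops_in_0[folded AA_def] A.ops_in_add[folded AA_def] A.ops_in_diff[folded AA_def]
  A.ops_in_minus[folded AA_def] A.ops_in_scal[folded AA_def]
lemmas N_closed = N.ops_in_0[folded NN_def] N.ops_in_add[folded NN_def] N.ops_in_diff[folded NN_def]
  N.ops_in_minus[folded NN_def] N.ops_in_scal[folded NN_def]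
lemmas Z_closed = Z.ops_in_0[folded ZZ_def] Z.ops_in_add[folded ZZ_def] Z.ops_in_diff[folded ZZ_def]
  Z.ops_in_minus[folded ZZ_def] Z.ops_in_scal[folded ZZ_def]
lemmas W_closed = W.ops_in_0[folded WW_def] W.ops_in_add[folded WW_def] W.ops_in_diff[folded WW_def]
  W.ops_in_minus[folded WW_def] W.ops_in_scal[folded WW_def]

lemma A_coeff_subset_N_coeff: "A_coeff i \<subseteq> N_coeff i"
proof
  fix f assume "f \<in> A_coeff i"
  then obtain u where u: "u \<in> RR" "f = H ^ i * u" using A_coeff_iff by blast
  show "f \<in> N_coeff i"
  proof (cases i)
    case (Suc m)
    have "f = \<rho> * H ^ m * (C * u)" unfolding u(2) Suc power_Suc by (subst H_eq) (simp only: ac_simps)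
    then show ?thesis unfolding Suc N_coeff_simps using u by (intro bexI[of _ "C * u"]) simp_all
  qed (use u in \<open>simp add: N_coeff_simps\<close>)
qed

lemma deriv_quotient:
  assumes "C * G = u"
  shows "C * C * fps_deriv G = C * fps_deriv u - fps_deriv C * u"
  using assms[symmetric] by (simp add: algebra_simps)

text \<open>
  For \<open>G = u/c\<close> the derivative has denominator \<open>c\<^sup>2\<close> at first sight, but only \<open>c \<pi> = h\<close> because \<open>c\<close>
  divides \<open>\<pi> c'\<close>.
\<close>

lemma W_coeff_subset_N_coeff: "W_coeff i \<subseteq> N_coeff i"
proof (cases i)
  case 0
  have "H * fps_deriv G \<in> RR" if G: "C * G \<in> RR" for G
  proof -
    obtain k where k: "r * pderiv c = c * k"
      using log_derivative_exists[of c] h_eq by (metis dvd_triv_left)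
    have PC: "\<rho> * fps_deriv C = C * emb k"
      using k by (metis emb_simps(6,8))
    have "C * C * (H * fps_deriv G) = H * (C * fps_deriv (C * G) - fps_deriv C * (C * G))"
      using deriv_quotient[of G "C * G"] by (simp add: ac_simps)
    also have "\<dots> = C * (C * (\<rho> * fps_deriv (C * G)) - (\<rho> * fps_deriv C) * (C * G))"
      unfolding H_eq by (simp add: algebra_simps)
    also have "\<dots> = C * C * (\<rho> * fps_deriv (C * G) - emb k * (C * G))"
      unfolding PC by (simp add: algebra_simps)
    finally have "H * fps_deriv G = \<rho> * fps_deriv (C * G) - emb k * (C * G)"
      using nonzero by simp
    moreover have "\<rho> * fps_deriv (C * G) - emb k * (C * G) \<in> RR"
      by (simp only: RR_diff RR_mult RR_deriv emb_RR G)
    ultimately show ?thesis by (simp only:)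
  qed
  then show ?thesis unfolding 0 by (auto simp: W_coeff_def N_coeff_simps)
qed (simp add: W_coeff_def)

lemma Z_coeff_subset_N_coeff: "Z_coeff i \<subseteq> N_coeff i"
proof (cases "i = 0")
  case True
  have "H * fps_deriv L \<in> RR" if "\<rho> * fps_deriv L \<in> RR" for L
  proof -
    have "H * fps_deriv L = C * (\<rho> * fps_deriv L)" by (simp add: H_eq mult.assoc)
    then show ?thesis by (simp only: RR_mult emb_RR that)
  qed
  then show ?thesis using True by (auto simp: Z_coeff_def N_coeff_simps)
qed (simp add: Z_coeff_def A_coeff_subset_N_coeff)

lemma A_coeff_subset_Z_coeff: "A_coeff i \<subseteq> Z_coeff i"
  by (auto simp: Z_coeff_def A_coeff_iff)

lemma A_coeff_subset_W_coeff: "A_coeff i \<subseteq> W_coeff i"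
  using A_coeff_subset_N_coeff[of i] by (auto simp: W_coeff_def A_coeff_iff)

lemma subsets: "AA \<subseteq> NN" "AA \<subseteq> ZZ" "AA \<subseteq> WW" "ZZ \<subseteq> NN" "WW \<subseteq> NN" "NN \<subseteq> diff_ops" "AA \<subseteq> diff_ops"
  unfolding AA_def NN_def ZZ_def WW_def
  by (intro ops_in_mono ops_in_subset_diff_ops A_coeff_subset_N_coeff A_coeff_subset_Z_coeff
      A_coeff_subset_W_coeff Z_coeff_subset_N_coeff W_coeff_subset_N_coeff)+

lemma mul_emb_AA [simp]: "mul (emb p) \<in> AA"
  unfolding AA_def by (rule A.ops_in_mul) (simp add: A_coeff_iff)

lemma mul_AA: "u \<in> RR \<Longrightarrow> mul u \<in> AA"
  by (auto simp: RR_def)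

definition yh :: "'a endo" where "yh = mul H * dif"

definition xx :: "'a endo" where "xx = mul (emb [:0, 1:])"

lemma mul_emb_pCons: "mul (emb (pCons k p)) = mul (fps_const k) + xx * mul (emb p)"
proof -
  have "pCons k p = [:k:] + [:0, 1:] * p" by simp
  then show ?thesis unfolding xx_def by (metis emb_simps(3,6,7) mul_simps(3,6))
qed

lemma yh_AA: "yh \<in> AA"
  using A.ops_in_monom[of H 1] A_coeffI[of 1 1 1] by (simp add: yh_def AA_def)

lemma xx_AA: "xx \<in> AA" by (simp add: xx_def)

text \<open>
  A commutator with a polynomial lowers the order without losing powers of \<open>h\<close> in the coefficients, so
  that even a further \<open>\<partial>\<close> on the right is harmless.
\<close>

lemma AA_com_mul:
  assumes "w \<in> AA" "u \<in> RR"
  shows "com w (mul u) \<in> AA" "com w (mul u) * dif \<in> AA"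
proof -
  have "com w (mul u) \<in> AA \<and> com w (mul u) * dif \<in> AA"
    using assms(1) unfolding AA_def
  proof (induction rule: ops_in_induct)
    case (add v w)
    then show ?case by (simp add: com_simps distrib_right A.ops_in_add)
  next
    case (monom f n)
    then obtain v where v: "v \<in> RR" "f = H ^ n * v" using A_coeff_iff by blast
    let ?S = "com_symbol f n u"
    have *: "coeff ?S k \<in> A_coeff j" if "k < n \<Longrightarrow> j \<le> n" for j k
    proof (cases "k < n")
      case True
      have "coeff ?S k = H ^ n * (v * of_nat (n choose k) * (fps_deriv ^^ (n - k)) u)"
        using True by (simp add: coeff_com_symbol v mult.assoc)
      then show ?thesis using A_coeffI[of j n] that[OF True] v(1) assms(2)
        by (simp only: RR_higher_deriv RR_mult RR_of_nat)
    qed (use linear_setD(1)[OF A.linear] in \<open>simp add: coeff_com_symbol\<close>)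
    have "com (mul f * dif ^ n) (mul u) * dif = op (pCons 0 ?S)"
      by (simp add: com_monom_mul op_pCons mul_simps)
    moreover have "op (pCons 0 ?S) \<in> ops_in A_coeff"
      unfolding op_in_ops_in_iff coeff_pCons
      using * linear_setD(1)[OF A.linear] by (auto split: nat.split)
    moreover have "op ?S \<in> ops_in A_coeff" unfolding op_in_ops_in_iff using * by simp
    ultimately show ?case by (simp add: com_monom_mul)
  qed
  then show "com w (mul u) \<in> AA" "com w (mul u) * dif \<in> AA" by simp_all
qed

lemma AA_mul_left: "w \<in> AA \<Longrightarrow> u \<in> RR \<Longrightarrow> mul u * w \<in> AA"
  unfolding AA_def
proof (induction rule: ops_in_induct)
  case (monom f n)
  then obtain v where v: "v \<in> RR" "f = H ^ n * v" using A_coeff_iff by blast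
  then have "u * f \<in> A_coeff n" using A_coeffI[of n n "u * v"] monom by (simp add: ac_simps RR_mult)
  then show ?case using A.ops_in_monom[of "u * f" n] by (simp add: mul_simps mult.assoc)
qed (simp add: distrib_left A.ops_in_add)

lemma AA_mult_mul: "w \<in> AA \<Longrightarrow> u \<in> RR \<Longrightarrow> w * mul u \<in> AA"
proof -
  assume "w \<in> AA" "u \<in> RR"
  then have "com w (mul u) + mul u * w \<in> AA" using AA_com_mul(1) AA_mul_left A_closed(2) by blast
  then show ?thesis by (simp add: com_def)
qed

lemma AA_mult_yh: "w \<in> AA \<Longrightarrow> w * yh \<in> AA"
proof -
  assume w: "w \<in> AA"
  then have "mul H * w * dif \<in> AA"
    unfolding AA_def
  proof (induction rule: ops_in_induct)
    case (monom f n)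
    then obtain v where v: "v \<in> RR" "f = H ^ n * v" using A_coeff_iff by blast
    then have "H * f \<in> A_coeff (Suc n)" using A_coeffI[of "Suc n" "Suc n" v] by (simp add: ac_simps)
    then show ?case using A.ops_in_monom[of "H * f" "Suc n"]
      by (simp add: mul_simps mult.assoc power_commutes)
  qed (simp add: distrib_left distrib_right A.ops_in_add)
  then have "com w (mul H) * dif + mul H * w * dif \<in> AA"
    using AA_com_mul(2)[OF w] A_closed(2) by simp
  then show ?thesis by (simp add: com_def yh_def algebra_simps)
qed

text \<open>
  The operators \<open>h\<^sup>n \<partial>\<^sup>n\<close> are obtained recursively from the generators; this shows that \<open>A\<close> is
  generated by \<open>x\<close> and \<open>h \<partial>\<close>, and gives a normal form in the presented algebra below.
\<close>

lemma yh_power_step: "mul (H ^ Suc n) * dif ^ Suc n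
    = (yh - mul (of_nat n * fps_deriv H)) * (mul (H ^ n) * dif ^ n)"
proof -
  have "H * fps_deriv (H ^ n) = of_nat n * fps_deriv H * H ^ n" by (rule mult_deriv_power)
  then have "mul H * mul (fps_deriv (H ^ n)) = mul (of_nat n * fps_deriv H) * mul (H ^ n)"
    by (metis mul_simps(6))
  moreover have "yh * mul (H ^ n) = mul H * mul (H ^ n) * dif + mul H * mul (fps_deriv (H ^ n))"
    by (simp add: yh_def mult.assoc dif_mul distrib_left)
  ultimately have "yh * mul (H ^ n) = mul (H ^ Suc n) * dif + mul (of_nat n * fps_deriv H) * mul (H ^ n)"
    by (simp add: mul_simps)
  then show ?thesis by (simp add: left_diff_distrib mult.assoc[symmetric] distrib_right)
qed

lemma AA_generated [consumes 1, case_names add mult const x y]: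
  assumes w: "w \<in> AA"
    and add: "\<And>v w. v \<in> AA \<Longrightarrow> w \<in> AA \<Longrightarrow> Q v \<Longrightarrow> Q w \<Longrightarrow> Q (v + w)"
    and mult: "\<And>v w. v \<in> AA \<Longrightarrow> w \<in> AA \<Longrightarrow> Q v \<Longrightarrow> Q w \<Longrightarrow> Q (v * w)"
    and const: "\<And>k. Q (mul (fps_const k))"
    and x: "Q xx" and y: "Q yh"
  shows "Q w"
proof -
  have emb: "Q (mul (emb p))" for p
  proof (induction p)
    case 0
    then show ?case using const[of 0] by (simp add: emb_simps)
  next
    case (pCons k p)
    have "Q (mul (fps_const k) + xx * mul (emb p))"
      using pCons.IH const x xx_AA mult add AA_mult_mul RR_const mul_AA emb_RR mul_emb_AA by metis
    then show ?case by (simp add: mul_emb_pCons)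
  qed
  have dif: "Q (mul (H ^ n) * dif ^ n) \<and> mul (H ^ n) * dif ^ n \<in> AA" for n
  proof (induction n)
    case 0
    then show ?case using const[of 1] mul_emb_AA[of 1] by (simp add: emb_simps)
  next
    case (Suc n)
    have u: "- (of_nat n * fps_deriv H) \<in> RR" by simp
    then have 1: "Q (yh + mul (- (of_nat n * fps_deriv H)))" "yh + mul (- (of_nat n * fps_deriv H)) \<in> AA"
      using add[OF yh_AA _ y] emb mul_AA A_closed(2)[OF yh_AA] by (auto simp: RR_def)
    have "H ^ Suc n \<in> A_coeff (Suc n)" using A_coeffI[of "Suc n" "Suc n" 1] by simp
    then have "mul (H ^ Suc n) * dif ^ Suc n \<in> AA" unfolding AA_def by (rule A.ops_in_monom)
    moreover have "Q (mul (H ^ Suc n) * dif ^ Suc n)"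
      unfolding yh_power_step using mult[OF 1(2) _ 1(1)] Suc by (simp add: mul_simps)
    ultimately show ?case by blast
  qed
  have "Q w \<and> w \<in> AA" using w unfolding AA_def
  proof (induction rule: ops_in_induct)
    case (monom f n)
    then obtain v where v: "v \<in> RR" "f = H ^ n * v" using A_coeff_iff by blast
    have "Q (mul v * (mul (H ^ n) * dif ^ n))"
      using v(1) emb mult[OF mul_AA[OF v(1)]] dif by (auto simp: RR_def)
    then have "Q (mul f * dif ^ n)"
      using v(2) by (metis mul_simps(6) mult.assoc mult.commute)
    then show ?case using A.ops_in_monom[OF monom] by simp
  qed (use add A.ops_in_add in \<open>auto simp: AA_def\<close>)
  then show ?thesis by simp
qed

lemma AA_mult: "v \<in> AA \<Longrightarrow> w \<in> AA \<Longrightarrow> v * w \<in> AA"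
proof -
  assume v: "v \<in> AA" and w: "w \<in> AA"
  from w have "\<forall>v\<in>AA. v * w \<in> AA"
  proof (induction rule: AA_generated)
    case (const k) then show ?case using AA_mult_mul RR_const by blast
  next
    case x then show ?case using AA_mult_mul by (simp add: xx_def)
  next
    case y then show ?case using AA_mult_yh by blast
  next
    case (add v w) then show ?case by (simp add: distrib_left A_closed(2))
  next
    case (mult v w) then show ?case by (metis mult.assoc)
  qed
  then show ?thesis using v by blast
qed

section \<open>Derivations of the algebra are commutators\<close>

text \<open>
  Commutation with \<open>x\<close> is differentiation of symbols with respect to \<open>\<partial>\<close>. Hence every differential
  operator is a commutator with \<open>x\<close>, and among them only multiplications commute with \<open>x\<close>.
\<close>

lemma com_op_xx: "com (op P) xx = op (pderiv P)"
proof (induction P)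
  case (pCons b P)
  have x': "fps_deriv (emb [:0, 1:]) = 1"
    by (simp add: emb_simps(8)[symmetric] pderiv_pCons emb_simps(7))
  \<comment> \<open>The product rule for \<open>[P \<partial>, x]\<close> with \<open>[\<partial>, x] = 1\<close> matches the recursion of \<^const>\<open>pderiv\<close>.\<close>
  have "com (op (pCons b P)) xx = com (mul b) xx + com (op P * dif) xx"
    by (simp add: op_pCons com_simps)
  also have "com (mul b) xx = 0" by (simp add: xx_def com_mul_mul)
  also have "com (op P * dif) xx = op P + com (op P) xx * dif"
    by (simp add: com_def xx_def mult.assoc dif_mul x' mul_simps algebra_simps)
  finally show ?case by (simp add: pCons.IH pderiv_pCons op_add op_pCons mul_simps)
qed (simp add: com_simps)

lemma com_xx_eq_0:
  assumes "v \<in> diff_ops" "com v xx = 0"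
  obtains g where "v = mul g"
proof -
  obtain P where P: "v = op P" using assms(1) by (auto simp: diff_ops_def)
  then have "pderiv P = 0" using assms(2) by (simp add: com_op_xx)
  then have "coeff P (Suc i) = 0" for i
    using coeff_pderiv[of P i] by (simp del: of_nat_Suc)
  then have "P = [:coeff P 0:]"
    by (intro poly_eqI) (simp add: coeff_pCons split: nat.split)
  then have "v = mul (coeff P 0)" using P op_pCons[of "coeff P 0" 0] by simp
  then show ?thesis using that by blast
qed

lemma com_yh_xx: "com yh xx = mul H"
proof -
  have "yh = op [:0, H:]" by (simp add: yh_def op_pCons mul_simps)
  then have "com yh xx = op (pderiv [:0, H:])" by (simp only: com_op_xx)
  then show ?thesis by (simp add: pderiv_pCons op_pCons mul_simps)
qed

lemma com_mul_yh: "com (mul G) yh = - mul (H * fps_deriv G)"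
proof -
  have "com (mul G) yh = op (pCons 0 (com_symbol G 0 H) - monom (H * fps_deriv G) 0)"
    using com_monom_dif[of G 0 H] by (simp add: yh_def)
  also have "\<dots> = - mul (H * fps_deriv G)"
    by (simp add: com_symbol_def op_minus op_monom)
  finally show ?thesis .
qed

text \<open>
  The coefficient of \<open>\<partial>\<^sup>n\<close> in \<open>[f \<partial>\<^sup>n, h \<partial>]\<close> is \<open>n f h' - h f'\<close>, and for \<open>f = h\<^bsup>n-1\<^esup> u\<close> all but
  one of the \<open>n\<close> copies of \<open>f h'\<close> cancel against \<open>h f'\<close>, up to a multiple of \<open>h\<^sup>n\<close>; the lower
  coefficients are divisible by \<open>h\<^bsup>n-1\<^esup>\<close>, which suffices there. So the condition to normalize \<open>A\<close> is
  \<open>h dvd u h'\<close>, for each coefficient separately.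
\<close>

lemma com_monom_yh_mod_AA:
  assumes u: "u \<in> RR" and f: "f = H ^ m * u"
  shows "com (mul f * dif ^ Suc m) yh - mul (f * fps_deriv H) * dif ^ Suc m \<in> AA"
proof -
  let ?n = "Suc m"
  let ?Q = "pCons 0 (com_symbol f ?n H) - monom (H * fps_deriv f) ?n - monom (f * fps_deriv H) ?n"
  have Hf: "H * fps_deriv f = of_nat m * fps_deriv H * f + H ^ ?n * fps_deriv u"
  proof -
    have "H * fps_deriv f = (H * fps_deriv (H ^ m)) * u + H ^ ?n * fps_deriv u"
      by (simp add: f algebra_simps)
    then show ?thesis unfolding mult_deriv_power by (simp add: f ac_simps)
  qed
  have "coeff ?Q k \<in> A_coeff k" for k
  proof (cases k)
    case 0
    then show ?thesis using linear_setD(1)[OF A.linear] by simp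
  next
    case (Suc j)
    consider "j < m" | "j = m" | "j > m" by linarith
    then show ?thesis
    proof cases
      case 1
      then have "coeff ?Q k = H ^ m * (u * of_nat (?n choose j) * (fps_deriv ^^ (?n - j)) H)"
        by (simp add: Suc coeff_com_symbol f mult.assoc del: funpow.simps binomial_Suc_Suc)
      then show ?thesis
        using A_coeffI[of k m] 1 Suc u by (simp del: funpow.simps binomial_Suc_Suc)
    next
      case 2
      then have "coeff ?Q k = of_nat ?n * f * fps_deriv H - H * fps_deriv f - f * fps_deriv H"
        by (simp add: Suc coeff_com_symbol ac_simps del: of_nat_Suc)
      also have "\<dots> = H ^ ?n * (- fps_deriv u)"
        unfolding Hf by (simp add: algebra_simps)
      finally show ?thesis using A_coeffI[of k ?n "- fps_deriv u"] 2 Suc u by simp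
    next
      case 3
      then show ?thesis using linear_setD(1)[OF A.linear] by (simp add: Suc coeff_com_symbol)
    qed
  qed
  then have "op ?Q \<in> AA" unfolding AA_def op_in_ops_in_iff by blast
  then show ?thesis
    unfolding yh_def com_monom_dif by (simp only: op_diff op_monom)
qed

lemma derivation_ext:
  assumes w: "w \<in> AA"
    and D: "\<And>a b. a \<in> AA \<Longrightarrow> b \<in> AA \<Longrightarrow> D (a + b) = D a + D b"
      "\<And>a b. a \<in> AA \<Longrightarrow> b \<in> AA \<Longrightarrow> D (a * b) = D a * b + a * D b"
      "\<And>k. D (mul (fps_const k)) = 0"
    and v: "D xx = com v xx" "D yh = com v yh"
  shows "D w = com v w"
  using w
proof (induction rule: AA_generated)
  case (const k)
  show ?case using D(3) by (simp add: com_def mul_const_central)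
qed (use D(1,2) v in \<open>simp_all add: com_simps com_mult\<close>)

lemma com_eq_0_AA:
  assumes "com v xx = 0" "com v yh = 0" "a \<in> AA"
  shows "com v a = 0"
  using derivation_ext[of a "\<lambda>_. 0" v] assms by simp

lemma rho_deriv_H: "\<exists>u\<in>RR. \<rho> * fps_deriv H = H * u"
proof -
  obtain k where "r * pderiv h = h * k" using log_derivative_exists[OF dvd_refl] .
  then have "\<rho> * fps_deriv H = H * emb k" by (metis emb_simps(6,8))
  then show ?thesis by (intro bexI[of _ "emb k"]) auto
qed

lemma NN_com_yh: "v \<in> NN \<Longrightarrow> com v yh \<in> AA"
  unfolding NN_def
proof (induction rule: ops_in_induct)
  case (monom f n)
  show ?case
  proof (cases n)
    case 0
    then have "H * fps_deriv f \<in> RR" using monom by (simp add: N_coeff_simps)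
    then show ?thesis using 0 A_closed(4) mul_AA by (simp add: com_mul_yh)
  next
    case (Suc m)
    then obtain u where u: "u \<in> RR" "f = H ^ m * (\<rho> * u)"
      using monom by (auto simp: N_coeff_simps ac_simps)
    obtain k where k: "k \<in> RR" "\<rho> * fps_deriv H = H * k" using rho_deriv_H by blast
    have "f * fps_deriv H = H ^ m * u * (\<rho> * fps_deriv H)" by (simp add: u ac_simps)
    also have "\<dots> = H ^ Suc m * (u * k)" unfolding k by (simp add: ac_simps)
    finally have e: "f * fps_deriv H = H ^ Suc m * (u * k)" .
    have "f * fps_deriv H \<in> A_coeff (Suc m)"
      unfolding e using u(1) k(1) by (intro A_coeffI) simp_all
    then have "mul (f * fps_deriv H) * dif ^ Suc m \<in> AA"
      unfolding AA_def by (rule A.ops_in_monom)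
    moreover have "com (mul f * dif ^ Suc m) yh - mul (f * fps_deriv H) * dif ^ Suc m \<in> AA"
      using com_monom_yh_mod_AA[of "\<rho> * u" f m] u by simp
    ultimately show ?thesis unfolding Suc by (metis A_closed(2) diff_add_cancel)
  qed
qed (simp add: com_simps A_closed(2))

lemma NN_com_xx: "v \<in> NN \<Longrightarrow> com v xx \<in> AA"
  unfolding NN_def
proof (induction rule: ops_in_induct)
  case (monom f n)
  show ?case
  proof (cases n)
    case 0
    then show ?thesis using A_closed(1) by (simp add: com_mul_mul xx_def)
  next
    case (Suc m)
    then obtain u where u: "u \<in> RR" "f = \<rho> * H ^ m * u"
      using monom by (auto simp: N_coeff_simps)
    have "com (mul f * dif ^ n) xx = mul (of_nat n * f) * dif ^ m"
      unfolding op_monom[symmetric] com_op_xx by (simp add: pderiv_monom Suc)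
    moreover have e: "of_nat n * f = H ^ m * (of_nat n * \<rho> * u)" by (simp add: u ac_simps)
    have "of_nat n * f \<in> A_coeff m"
      unfolding e using A_coeffI[of m m "of_nat n * \<rho> * u"] u(1) by simp
    ultimately show ?thesis using A.ops_in_monom by (simp add: AA_def)
  qed
qed (simp add: com_simps A_closed(2))

lemma NN_com_AA:
  assumes v: "v \<in> NN" and a: "a \<in> AA"
  shows "com v a \<in> AA"
  using a
proof (induction rule: AA_generated)
  case (const k)
  show ?case using A_closed(1) by (simp add: com_def mul_const_central)
qed (use v in \<open>simp_all add: com_simps com_mult NN_com_xx NN_com_yh A_closed AA_mult\<close>)

text \<open>
  The converse of \<open>NN_com_AA\<close>. By the previous computations \<open>[w, h \<partial>]\<close> agrees modulo \<open>A\<close> with an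
  operator whose coefficients are, up to sign, \<open>h G'\<close> and \<open>f\<^sub>i h'\<close>, so these satisfy the conditions of
  \<open>A\<close>; here the defining property of \<open>\<pi>\<close> enters.
\<close>

lemma normalizer_imp_NN:
  assumes w: "w = op V" and coeffs: "\<And>i. coeff V (Suc i) \<in> A_coeff i" and y: "com w yh \<in> AA"
  shows "w \<in> NN"
proof -
  define d where "d = degree V"
  define T where "T i = (if i = 0 then - (H * fps_deriv (coeff V 0)) else coeff V i * fps_deriv H)" for i
  have each: "com (mul (coeff V i) * dif ^ i) yh - mul (T i) * dif ^ i \<in> AA" for i
  proof (cases i)
    case 0
    then show ?thesis using A_closed(1) by (simp add: T_def com_mul_yh mul_simps)
  next
    case (Suc m)
    obtain u where "u \<in> RR" "coeff V (Suc m) = H ^ m * u" using coeffs[of m] A_coeff_iff by blast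
    then show ?thesis unfolding Suc T_def using com_monom_yh_mod_AA by simp
  qed
  have "com w yh - op (\<Sum>i\<le>d. monom (T i) i)
      = (\<Sum>i\<le>d. com (mul (coeff V i) * dif ^ i) yh - mul (T i) * dif ^ i)"
  proof -
    have "w = (\<Sum>i\<le>d. mul (coeff V i) * dif ^ i)" by (simp add: w op_def d_def)
    then show ?thesis by (simp add: com_sum sum_subtractf op_sum op_monom)
  qed
  also have "\<dots> \<in> AA" unfolding AA_def by (rule A.ops_in_sum) (use each in \<open>simp add: AA_def\<close>)
  finally have "com w yh - (com w yh - op (\<Sum>i\<le>d. monom (T i) i)) \<in> AA"
    using A_closed(3) y by blast
  then have "op (\<Sum>i\<le>d. monom (T i) i) \<in> AA" by simp
  then have "coeff (\<Sum>i\<le>d. monom (T i) i) i \<in> A_coeff i" for i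
    unfolding AA_def op_in_ops_in_iff by blast
  then have T: "T i \<in> A_coeff i" if "i \<le> d" for i
    using that by (simp add: coeff_sum) (metis (mono_tags, lifting))
  have "coeff V i \<in> N_coeff i" for i
  proof (cases "i \<le> d")
    case True
    show ?thesis
    proof (cases i)
      case 0
      have "- (H * fps_deriv (coeff V 0)) \<in> RR"
        using T[OF True] by (simp add: 0 T_def A_coeff_iff)
      then have "- (- (H * fps_deriv (coeff V 0))) \<in> RR" by (rule RR_minus)
      then show ?thesis by (simp add: 0 N_coeff_simps)
    next
      case (Suc m)
      obtain p where p: "coeff V i = H ^ m * emb p"
        using coeffs[of m] Suc A_coeff_iff RR_def by auto
      obtain q where q: "coeff V i * fps_deriv H = H ^ i * emb q"
        using T[OF True] Suc by (auto simp: T_def A_coeff_iff RR_def)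
      have "H ^ m * (emb p * fps_deriv H) = H ^ m * (H * emb q)"
        using q p Suc by (simp add: ac_simps)
      then have "emb p * fps_deriv H = H * emb q" using nonzero by simp
      then have "emb (pderiv h * p) = emb (h * q)" by (simp add: emb_simps ac_simps)
      then have "pderiv h * p = h * q" by (simp only: emb_eq_iff)
      then have "r dvd p" using annihilates[of p] by simp
      then obtain p' where "p = r * p'" by (rule dvdE)
      then have "coeff V i = \<rho> * H ^ m * emb p'" using p by (simp add: emb_simps ac_simps)
      then show ?thesis unfolding Suc N_coeff_simps by (intro bexI[of _ "emb p'"]) simp_all
    qed
  next
    case False
    then show ?thesis using linear_setD(1)[OF N.linear] by (simp add: d_def coeff_eq_0)
  qed
  then show ?thesis unfolding w NN_def op_in_ops_in_iff by blast
qed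

text \<open>
  First \<open>u\<close> is chosen with \<open>[u, x] = D x\<close>. Then \<open>D\<close> and \<open>[u, -]\<close> agree on polynomials, in
  particular on \<open>h = [h \<partial>, x]\<close>, and this forces \<open>D (h \<partial>) - [u, h \<partial>]\<close> to commute with \<open>x\<close>: it is
  multiplication by a power series \<open>g\<close>. A solution of \<open>h G' = -g\<close> corrects \<open>u\<close> by its constant
  term.
\<close>

lemma derivation_of_AA:
  assumes AA: "\<And>a. a \<in> AA \<Longrightarrow> D a \<in> AA"
    and add: "\<And>a b. a \<in> AA \<Longrightarrow> b \<in> AA \<Longrightarrow> D (a + b) = D a + D b"
    and mult: "\<And>a b. a \<in> AA \<Longrightarrow> b \<in> AA \<Longrightarrow> D (a * b) = D a * b + a * D b"
    and const: "\<And>k. D (mul (fps_const k)) = 0"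
  shows "\<exists>w\<in>NN. \<forall>a\<in>AA. D a = com w a"
proof -
  have "D xx \<in> AA" using AA xx_AA by blast
  then obtain P where P: "D xx = op P" "\<And>i. coeff P i \<in> A_coeff i" by (auto simp: AA_def ops_in_def)
  obtain U where U: "pderiv U = P" "coeff U 0 = 0"
      "\<And>i. coeff U (Suc i) = fps_const (1 / of_nat (Suc i)) * coeff P i"
    using symbol_antiderivative by blast
  have u: "com (op U) xx = D xx" by (simp add: com_op_xx U P)
  have D_emb: "D (mul (emb p)) = com (op U) (mul (emb p))" for p
  proof (induction p)
    case 0
    then show ?case using const[of 0] by (simp add: emb_simps mul_simps com_simps)
  next
    case (pCons k p)
    note e = mul_emb_pCons[of k p]
    have "D (mul (emb (pCons k p))) = D xx * mul (emb p) + xx * D (mul (emb p))"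
      unfolding e by (simp add: add mult const mul_AA AA_mult xx_AA)
    also have "\<dots> = com (op U) (mul (emb (pCons k p)))"
      unfolding e pCons.IH u[symmetric] com_simps com_mult
      by (simp add: com_def mul_const_central)
    finally show ?case .
  qed
  have diff: "D (a - b) = D a - D b" if "a \<in> AA" "b \<in> AA" for a b
    using add[of "a - b" b] that A_closed(3) by simp
  define E where "E = D yh - com (op U) yh"
  have "D (mul H) = D (com yh xx)" by (simp add: com_yh_xx)
  also have "\<dots> = D (yh * xx) - D (xx * yh)"
    unfolding com_def by (intro diff AA_mult yh_AA xx_AA)
  also have "\<dots> = com (D yh) xx + com yh (D xx)"
    unfolding mult[OF yh_AA xx_AA] mult[OF xx_AA yh_AA] by (simp add: com_def algebra_simps)
  finally have "com (D yh) xx = com (op U) (com yh xx) - com yh (com (op U) xx)"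
    using D_emb[of h] by (simp add: com_yh_xx u)
  then have E0: "com E xx = 0" by (simp add: E_def com_simps com_com)
  have "E \<in> diff_ops"
    unfolding E_def using AA[OF yh_AA] yh_AA subsets(7) by (intro diff_ops_diff diff_ops_com) auto
  then obtain g where g: "E = mul g" using E0 com_xx_eq_0 by blast
  obtain G where "fps_deriv G = - (inverse H * g)" using fps_deriv_surj by blast
  then have "H * fps_deriv G = - (H * inverse H * g)" by (simp add: mult.assoc)
  then have G: "H * fps_deriv G = - g" by (simp add: inverse_H)
  define w where "w = op (pCons G 0 + U)"
  have w: "w = mul G + op U" by (simp add: w_def op_add op_pCons)
  have wx: "com w xx = D xx"
    using u by (simp add: w com_simps com_mul_mul xx_def)
  have "com w yh = E + com (op U) yh"
    using g by (simp add: w com_simps com_mul_yh G mul_simps)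
  then have wy: "com w yh = D yh" by (simp add: E_def)
  have D: "D a = com w a" if "a \<in> AA" for a
    using that add mult const wx[symmetric] wy[symmetric] by (rule derivation_ext)
  have "w \<in> NN"
  proof (rule normalizer_imp_NN[OF w_def])
    show "coeff (pCons G 0 + U) (Suc i) \<in> A_coeff i" for i
      using U(3)[of i] linear_setD(3)[OF A.linear P(2)] by simp
    show "com w yh \<in> AA" using D yh_AA AA by metis
  qed
  then show ?thesis using D by blast
qed

text \<open>
  Only constants centralize \<open>A\<close>, and constants belong to \<open>A\<close>.
\<close>

lemma com_AA_eq_0:
  assumes v: "v \<in> diff_ops" and "com v xx = 0" "com v yh = 0"
  shows "v \<in> AA"
proof -
  obtain g where g: "v = mul g" using com_xx_eq_0 assms by blast
  then have "mul (H * fps_deriv g) = mul 0" using assms(3) by (simp add: com_mul_yh mul_simps)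
  then have "fps_deriv g = 0" using nonzero mul_eq_iff by (metis mult_eq_0_iff)
  then have "g = fps_const (fps_nth g 0)" by (simp only: fps_deriv_eq_0_iff)
  then show ?thesis using g mul_AA RR_const by metis
qed

section \<open>Center and derived algebra of the normalizer modulo the algebra\<close>

text \<open>
  A commutator of normalizing operators induces a derivation, which is also induced by an element of
  \<open>N\<close>; the two differ by an operator centralizing \<open>A\<close>.
\<close>

lemma NN_com_closed:
  assumes v: "v \<in> NN" and w: "w \<in> NN"
  shows "com v w \<in> NN"
proof -
  \<comment> \<open>The Leibniz rule for \<open>[[v, w], -]\<close> is an instance of \<open>com_mult\<close>, its stability on \<open>A\<close> of the
      Jacobi identity.\<close>
  have "\<exists>u\<in>NN. \<forall>a\<in>AA. com (com v w) a = com u a"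
    by (rule derivation_of_AA)
      (use v w in \<open>simp_all add: com_simps com_mult com_com NN_com_AA A_closed mul_const_central\<close>,
       simp_all add: com_def mul_const_central algebra_simps)
  then obtain u where u: "u \<in> NN" "\<And>a. a \<in> AA \<Longrightarrow> com (com v w) a = com u a" by blast
  have "com v w - u \<in> AA"
    using u v w xx_AA yh_AA subsets(6) by (intro com_AA_eq_0 diff_ops_diff diff_ops_com) (auto simp: com_simps)
  then have "(com v w - u) + u \<in> NN" using subsets(1) u(1) N_closed(2) by blast
  then show ?thesis by simp
qed

text \<open>
  Each differentiation costs one more factor \<open>K\<close> in the denominator, as
  \<open>K (K\<^sup>n)' = n K' K\<^sup>n\<close>.
\<close>

lemma higher_deriv_RR:
  assumes K: "K \<in> RR" and G: "K * fps_deriv G \<in> RR"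
  shows "K ^ Suc j * (fps_deriv ^^ Suc j) G \<in> RR"
proof (induction j)
  case (Suc j)
  let ?G = "(fps_deriv ^^ Suc j) G"
  have "K * fps_deriv (K ^ Suc j * ?G) = (K * fps_deriv (K ^ Suc j)) * ?G + K ^ Suc (Suc j) * fps_deriv ?G"
    by (simp only: fps_deriv_mult power_Suc) (simp only: algebra_simps)
  then have "K ^ Suc (Suc j) * fps_deriv ?G
      = K * fps_deriv (K ^ Suc j * ?G) - of_nat (Suc j) * fps_deriv K * (K ^ Suc j * ?G)"
    unfolding mult_deriv_power by (simp only: algebra_simps)
  also have "\<dots> \<in> RR" by (intro RR_diff RR_mult RR_deriv RR_of_nat K Suc)
  finally show ?case by simp
qed (use G in simp)

text \<open>
  For \<open>\<pi> L'\<close> polynomial, the derivative of order \<open>j\<close> of \<open>L\<close> has denominator \<open>\<pi>\<^sup>j\<close>. In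
  \<open>[f \<partial>\<^sup>n, L]\<close> it multiplies \<open>f\<close>, which contains \<open>\<pi> h\<^bsup>n-1\<^esup>\<close>; as \<open>\<pi>\<close> divides \<open>h\<close>, a factor \<open>h\<^bsup>n-j\<^esup>\<close>
  survives, as required for the coefficient of \<open>\<partial>\<^bsup>n-j\<^esup>\<close>.
\<close>

lemma ZZ_com_NN:
  assumes z: "z \<in> ZZ" and w: "w \<in> NN"
  shows "com z w \<in> AA"
  using z unfolding ZZ_def
proof (induction rule: ops_in_induct)
  case (monom L n)
  show ?case
  proof (cases n)
    case 0
    then have L: "\<rho> * fps_deriv L \<in> RR" using monom by (simp add: Z_coeff_def)
    have "com w (mul L) \<in> AA"
      using w unfolding NN_def
    proof (induction rule: ops_in_induct)
      case (monom f n)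
      have "coeff (com_symbol f n L) k \<in> A_coeff k" for k
      proof (cases "k < n")
        case True
        then obtain m where m: "n = Suc m" by (cases n) auto
        then obtain u where u: "u \<in> RR" "f = \<rho> * H ^ m * u" using monom by (auto simp: N_coeff_simps)
        obtain j where j: "m = k + j" using True m less_eq_Suc_le le_Suc_ex by fastforce
        then have nk: "n - k = Suc j" by (simp add: m)
        have f: "f = \<rho> * (H ^ k * (C * \<rho>) ^ j) * u"
          unfolding u(2) j power_add by (simp only: H_eq)
        have "coeff (com_symbol f n L) k = f * of_nat (n choose k) * (fps_deriv ^^ Suc j) L"
          using True by (simp add: coeff_com_symbol nk del: funpow.simps)
        also have "\<dots> = H ^ k * (C ^ j * u * of_nat (n choose k) * (\<rho> ^ Suc j * (fps_deriv ^^ Suc j) L))"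
          unfolding f by (simp only: power_mult_distrib power_Suc ac_simps)
        finally show ?thesis
          using A_coeffI[of k k] higher_deriv_RR[OF emb_RR L] u(1)
          by (simp only: RR_mult RR_power RR_of_nat emb_RR order_refl)
      qed (use linear_setD(1)[OF A.linear] in \<open>simp add: coeff_com_symbol\<close>)
      then show ?case unfolding com_monom_mul AA_def op_in_ops_in_iff by blast
    qed (simp add: com_simps A_closed(2))
    then show ?thesis unfolding 0 using A_closed(4) com_swap[of "mul L" w] by simp
  next
    case (Suc m)
    then have "L \<in> A_coeff n" using monom by (simp add: Z_coeff_def)
    then have "mul L * dif ^ n \<in> AA" unfolding AA_def by (rule A.ops_in_monom)
    then show ?thesis using NN_com_AA[OF w] A_closed(4) com_swap[of _ w] by metis
  qed
qed (simp add: com_simps A_closed(2))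

lemma mul_NN: "H * fps_deriv G \<in> RR \<Longrightarrow> mul G \<in> NN"
  unfolding NN_def by (rule N.ops_in_mul) (simp add: N_coeff_simps)

lemma rho_dif_NN: "mul \<rho> * dif \<in> NN"
proof -
  have "\<rho> \<in> N_coeff (Suc 0)" unfolding N_coeff_simps by (intro bexI[of _ 1]) simp_all
  then show ?thesis using N.ops_in_monom[of \<rho> "Suc 0"] by (simp add: NN_def)
qed

lemma inverse_H_primitive: obtains G where "H * fps_deriv G = u"
proof -
  obtain G where "fps_deriv G = inverse H * u" using fps_deriv_surj by blast
  then have "H * fps_deriv G = u" using inverse_H by (metis mult.assoc mult_1)
  then show ?thesis using that by blast
qed

text \<open>
  With \<open>h G' = 1\<close>, the top coefficient \<open>f\<close> of \<open>P\<close> reappears as the coefficient \<open>n f/h\<close> of \<open>\<partial>\<^bsup>n-1\<^esup>\<close> in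
  \<open>[P, G]\<close>. If the latter is in \<open>A\<close>, then so is \<open>f \<partial>\<^sup>n\<close>, and it can be subtracted. For the
  remaining constant term one uses \<open>[\<pi> \<partial>, G] = \<pi> G'\<close>.
\<close>

lemma central_mod_AA_imp_ZZ:
  assumes "degree P \<le> n" and "op P \<in> NN" and "\<And>v. v \<in> NN \<Longrightarrow> com (op P) v \<in> AA"
  shows "op P \<in> ZZ"
  using assms
proof (induction n arbitrary: P)
  case 0
  then have P: "P = [:coeff P 0:]" by (metis degree_0_id le_zero_eq)
  define G where "G = coeff P 0"
  have G: "op P = mul G" using P op_pCons[of G 0] by (simp add: G_def)
  have "com (mul G) (mul \<rho> * dif) \<in> AA" using 0(3) rho_dif_NN G by metis
  moreover have "com (mul G) (mul \<rho> * dif) = - mul (\<rho> * fps_deriv G)"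
    using dif_mul[of G] by (simp add: com_mult com_mul_mul) (simp add: com_def mul_simps algebra_simps mul_commute)
  ultimately have "- (- mul (\<rho> * fps_deriv G)) \<in> AA" using A_closed(4) by metis
  then have "op [:\<rho> * fps_deriv G:] \<in> AA" by (simp add: op_pCons)
  then have "\<rho> * fps_deriv G \<in> RR"
    unfolding AA_def op_in_ops_in_iff using A_coeff_iff[of _ 0] by (metis coeff_pCons_0 mult_1 power_0)
  then have "G \<in> Z_coeff 0" by (simp add: Z_coeff_def)
  then show ?case unfolding G ZZ_def by (rule Z.ops_in_mul)
next
  case (Suc n)
  let ?f = "coeff P (Suc n)"
  obtain G where G: "H * fps_deriv G = 1" using inverse_H_primitive by blast
  have "com (op P) (mul G) \<in> AA" using Suc.prems(3) mul_NN G by simp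
  also have "com (op P) (mul G) = op (\<Sum>i\<le>Suc n. com_symbol (coeff P i) i G)"
    using op_bound[OF Suc.prems(1)] by (simp only: com_sum com_monom_mul op_sum)
  finally have "coeff (\<Sum>i\<le>Suc n. com_symbol (coeff P i) i G) n \<in> A_coeff n"
    unfolding AA_def op_in_ops_in_iff by blast
  also have "coeff (\<Sum>i\<le>Suc n. com_symbol (coeff P i) i G) n = of_nat (Suc n) * ?f * fps_deriv G"
    by (simp add: coeff_sum coeff_com_symbol ac_simps del: of_nat_Suc)
  finally obtain u where u: "u \<in> RR" "of_nat (Suc n) * ?f * fps_deriv G = H ^ n * u"
    using A_coeff_iff by blast
  have "of_nat (Suc n) * ?f = H * (of_nat (Suc n) * ?f * fps_deriv G)"
    using G by (metis mult.left_commute mult.right_neutral)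
  also have "\<dots> = H ^ Suc n * u" unfolding u(2) by (simp add: mult.assoc)
  finally have "fps_const (1 / of_nat (Suc n)) * (of_nat (Suc n) * ?f)
      = H ^ Suc n * (fps_const (1 / of_nat (Suc n)) * u)" by (simp only: ac_simps)
  moreover have "fps_const (1 / of_nat (Suc n)) * (of_nat (Suc n) * ?f) = ?f"
    by (simp add: fps_of_nat[symmetric] mult.assoc[symmetric] del: of_nat_Suc)
  ultimately have "?f = H ^ Suc n * (fps_const (1 / of_nat (Suc n)) * u)" by metis
  then have f: "op (monom ?f (Suc n)) \<in> AA"
    unfolding op_monom AA_def using u(1) A_coeffI[of "Suc n" "Suc n"]
    by (intro A.ops_in_monom) (metis RR_const RR_mult order_refl)
  define P' where "P' = P - monom ?f (Suc n)"
  have P': "op P' = op P - op (monom ?f (Suc n))" by (simp add: P'_def op_diff)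
  have "degree P' \<le> n"
  proof (rule degree_le, intro allI impI)
    fix i assume "n < i"
    then show "coeff P' i = 0"
      using Suc.prems(1) by (cases "i = Suc n") (auto simp: P'_def coeff_eq_0)
  qed
  moreover have "op P' \<in> NN" unfolding P' using Suc.prems(2) f subsets(1) N_closed(3) by blast
  moreover have "com (op P') v \<in> AA" if "v \<in> NN" for v
  proof -
    have "com (op P) v + com v (op (monom ?f (Suc n))) \<in> AA"
      using Suc.prems(3) NN_com_AA[OF that f] that A_closed(2) by blast
    then show ?thesis unfolding P' com_simps using com_swap[of "op (monom ?f (Suc n))" v] by simp
  qed
  ultimately have "op P' \<in> ZZ" using Suc.IH by blast
  then have "op P' + op (monom ?f (Suc n)) \<in> ZZ" using f subsets(2) Z_closed(2) by blast
  then show ?case by (simp add: P')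
qed

lemma ZZ_iff: "z \<in> ZZ \<longleftrightarrow> z \<in> NN \<and> (\<forall>v\<in>NN. com z v \<in> AA)"
proof
  show "z \<in> ZZ \<Longrightarrow> z \<in> NN \<and> (\<forall>v\<in>NN. com z v \<in> AA)" using ZZ_com_NN subsets(4) by blast
  assume z: "z \<in> NN \<and> (\<forall>v\<in>NN. com z v \<in> AA)"
  then obtain P where "z = op P" using subsets(6) diff_ops_def by blast
  then show "z \<in> ZZ" using central_mod_AA_imp_ZZ[of P] z by blast
qed

text \<open>
  The constant coefficient of an operator is its value at 1. The last property controls the constant
  coefficient of a commutator: \<open>f \<partial>\<^sup>i\<close> applied to \<open>K\<close> has denominator \<open>c\<close>, since \<open>f\<close> contains
  \<open>\<pi> h\<^bsup>i-1\<^esup>\<close> and the derivative of order \<open>i\<close> of \<open>K\<close> has denominator \<open>h\<^sup>i\<close>.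
\<close>

lemma NN_split:
  assumes v: "v \<in> NN"
  obtains G v1 where "v = mul G + v1" "H * fps_deriv G \<in> RR" "v1 \<in> NN" "app v1 1 = 0"
    "\<And>K. H * fps_deriv K \<in> RR \<Longrightarrow> C * app v1 K \<in> RR"
proof -
  have "\<exists>G v1. v = mul G + v1 \<and> H * fps_deriv G \<in> RR \<and> v1 \<in> NN \<and> app v1 1 = 0
     \<and> (\<forall>K. H * fps_deriv K \<in> RR \<longrightarrow> C * app v1 K \<in> RR)"
    using v unfolding NN_def
  proof (induction rule: ops_in_induct)
    case (add v w)
    then obtain G v1 K w1 where *: "v = mul G + v1" "H * fps_deriv G \<in> RR" "v1 \<in> NN" "app v1 1 = 0"
        "\<forall>L. H * fps_deriv L \<in> RR \<longrightarrow> C * app v1 L \<in> RR"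
        "w = mul K + w1" "H * fps_deriv K \<in> RR" "w1 \<in> NN" "app w1 1 = 0"
        "\<forall>L. H * fps_deriv L \<in> RR \<longrightarrow> C * app w1 L \<in> RR"
      unfolding NN_def by blast
    then have "v + w = mul (G + K) + (v1 + w1)" by (simp add: mul_simps)
    moreover have "H * fps_deriv (G + K) \<in> RR" using * by (simp add: distrib_left)
    moreover have "v1 + w1 \<in> NN" using * N_closed(2) by blast
    ultimately show ?case using *
      by (intro exI[of _ "G + K"] exI[of _ "v1 + w1"]) (simp add: NN_def[symmetric] distrib_left)
  next
    case (monom f n)
    show ?case
    proof (cases n)
      case 0
      then have "H * fps_deriv f \<in> RR" using monom by (simp add: N_coeff_simps)
      then show ?thesis unfolding 0
        by (intro exI[of _ f] exI[of _ 0]) (simp add: N.ops_in_0)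
    next
      case (Suc m)
      have one: "(fps_deriv ^^ Suc m) 1 = (0 :: 'a fps)"
      proof -
        have "(fps_deriv ^^ m) 0 = (0 :: 'a fps)" by (induction m) simp_all
        then show ?thesis by (simp add: funpow_swap1 del: fps_deriv_eq_0_iff)
      qed
      have app: "app (mul f * dif ^ n) K = f * (fps_deriv ^^ n) K" for K
      proof -
        have "app (dif ^ n) K = (fps_deriv ^^ n) K" by (induction n) simp_all
        then show ?thesis by simp
      qed
      obtain u where u: "u \<in> RR" "f = \<rho> * H ^ m * u" using monom Suc by (auto simp: N_coeff_simps)
      have "C * app (mul f * dif ^ n) K \<in> RR" if K: "H * fps_deriv K \<in> RR" for K
      proof -
        have "C * app (mul f * dif ^ n) K = C * (f * (fps_deriv ^^ Suc m) K)"
          by (simp only: app) (simp only: Suc)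
        also have "\<dots> = (C * \<rho>) * H ^ m * u * (fps_deriv ^^ Suc m) K"
          unfolding u by (simp only: ac_simps)
        also have "\<dots> = u * (H ^ Suc m * (fps_deriv ^^ Suc m) K)"
          unfolding H_eq[symmetric] power_Suc by (simp only: ac_simps)
        also have "\<dots> \<in> RR" by (intro RR_mult u higher_deriv_RR emb_RR K)
        finally show ?thesis .
      qed
      then show ?thesis using N.ops_in_monom[OF monom] app[of 1] one Suc
        by (intro exI[of _ 0] exI[of _ "mul f * dif ^ n"]) (simp add: mul_simps del: funpow.simps)
    qed
  qed
  then show ?thesis using that by blast
qed

lemma NN_com_WW:
  assumes v: "v \<in> NN" and w: "w \<in> NN"
  shows "com v w \<in> WW"
proof -
  obtain G v1 where G: "v = mul G + v1" "H * fps_deriv G \<in> RR" "app v1 1 = 0"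
      "\<And>K. H * fps_deriv K \<in> RR \<Longrightarrow> C * app v1 K \<in> RR" using NN_split[OF v] by metis
  obtain K w1 where K: "w = mul K + w1" "H * fps_deriv K \<in> RR" "app w1 1 = 0"
      "\<And>K. H * fps_deriv K \<in> RR \<Longrightarrow> C * app w1 K \<in> RR" using NN_split[OF w] by metis
  obtain P where P: "com v w = op P" "\<And>i. coeff P i \<in> N_coeff i"
    using NN_com_closed[OF v w] by (auto simp: NN_def ops_in_def)
  have "coeff P 0 = app (com v w) 1" by (simp add: P app_op_1)
  also have "\<dots> = app v1 K - app w1 G"
    by (simp add: com_def G(1,3) K(1,3) app_add algebra_simps)
  finally have "C * coeff P 0 = C * app v1 K - C * app w1 G" by (simp add: right_diff_distrib)
  also have "\<dots> \<in> RR" using G K by simp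
  finally have "coeff P i \<in> W_coeff i" for i
    using P(2)[of i] by (cases i) (simp_all add: W_coeff_def)
  then show ?thesis unfolding P WW_def op_in_ops_in_iff by blast
qed

text \<open>
  The constants \<open>s/c\<close> are \<open>[\<pi> \<partial>, G]\<close> with \<open>h G' = s\<close>. For the coefficient \<open>f\<close> of \<open>\<partial>\<^bsup>n+1\<^esup>\<close>, the
  commutator of \<open>h f \<partial>\<^bsup>n+2\<^esup>/(n+2)\<close> with a \<open>G\<close> such that \<open>h G' = 1\<close> has the right leading term, and
  the rest has smaller order and still lies in \<open>W\<close>.
\<close>

lemma WW_generated_step:
  assumes add: "\<And>v w. v \<in> U \<Longrightarrow> w \<in> U \<Longrightarrow> v + w \<in> U"
    and com: "\<And>v w. v \<in> NN \<Longrightarrow> w \<in> NN \<Longrightarrow> com v w \<in> U"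
  shows "degree P \<le> n \<Longrightarrow> op P \<in> WW \<Longrightarrow> op P \<in> U"
proof (induction n arbitrary: P)
  case 0
  then have P: "P = [:coeff P 0:]" by (metis degree_0_id le_zero_eq)
  define S where "S = coeff P 0"
  have S: "op P = mul S" using P op_pCons[of S 0] by (simp add: S_def)
  have CS: "C * S \<in> RR" using 0(2) unfolding WW_def op_in_ops_in_iff S_def
    by (metis (mono_tags, lifting) W_coeff_def mem_Collect_eq)
  obtain G where G: "H * fps_deriv G = C * S" using inverse_H_primitive by blast
  then have "C * (\<rho> * fps_deriv G) = C * S" by (simp add: H_eq mult.assoc)
  then have rG: "\<rho> * fps_deriv G = S" using nonzero by simp
  have "com (mul \<rho> * dif) (mul G) = mul \<rho> * mul (fps_deriv G)"
    using dif_mul[of G] by (simp add: com_def algebra_simps mul_commute)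
      (simp add: mult.assoc[symmetric] mul_commute)
  also have "\<dots> = mul S" by (simp add: mul_simps(6)[symmetric] rG)
  finally have "com (mul \<rho> * dif) (mul G) = op P" using S by simp
  then show ?case using com[OF rho_dif_NN mul_NN[of G]] G CS by simp
next
  case (Suc n)
  let ?f = "coeff P (Suc n)" and ?k = "fps_const (1 / of_nat (Suc (Suc n))) :: 'a fps"
  have k: "?k * of_nat (Suc (Suc n)) = 1"
    by (simp add: fps_of_nat[symmetric] del: of_nat_Suc)
  have fW: "?f \<in> W_coeff (Suc n)" using Suc.prems(2) unfolding WW_def op_in_ops_in_iff by blast
  then obtain u where u: "u \<in> RR" "?f = \<rho> * H ^ n * u" by (auto simp: W_coeff_def N_coeff_simps)
  \<comment> \<open>The factor \<open>h\<close> compensates \<open>G' = 1/h\<close>, and \<open>1/(n+2)\<close> the exponent brought down by the commutator.\<close>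
  define v where "v = mul (?k * H * ?f) * dif ^ Suc (Suc n)"
  have "?k * H * ?f = \<rho> * H ^ Suc n * (?k * u)" by (simp add: u ac_simps)
  then have "?k * H * ?f \<in> N_coeff (Suc (Suc n))"
    unfolding N_coeff_simps using u(1) by (intro bexI[of _ "?k * u"]) simp_all
  then have v: "v \<in> NN" unfolding v_def NN_def by (rule N.ops_in_monom)
  obtain G where G: "H * fps_deriv G = 1" using inverse_H_primitive by blast
  then have GN: "mul G \<in> NN" by (intro mul_NN) simp
  define Q where "Q = com_symbol (?k * H * ?f) (Suc (Suc n)) G"
  have Q: "com v (mul G) = op Q" unfolding v_def Q_def com_monom_mul ..
  have cQ: "coeff Q (Suc n) = ?f"
  proof -
    have "coeff Q (Suc n) = ?k * H * ?f * of_nat (Suc (Suc n)) * fps_deriv G"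
      by (simp add: Q_def coeff_com_symbol del: of_nat_Suc)
    also have "\<dots> = (?k * of_nat (Suc (Suc n))) * (H * fps_deriv G) * ?f" by (simp only: ac_simps)
    finally show ?thesis unfolding k G by simp
  qed
  have "degree (P - Q) \<le> n"
  proof (rule degree_le, intro allI impI)
    fix i assume "n < i"
    then show "coeff (P - Q) i = 0"
      using Suc.prems(1) cQ by (cases "i = Suc n") (auto simp: coeff_eq_0 Q_def coeff_com_symbol)
  qed
  moreover have "op (P - Q) \<in> WW"
    unfolding op_diff using Suc.prems(2) NN_com_WW[OF v GN] Q W_closed(3) by simp
  ultimately have "op (P - Q) \<in> U" using Suc.IH by blast
  then have "op (P - Q) + op Q \<in> U" using add com[OF v GN] Q by simp
  then show ?case by (simp add: op_diff)
qed

lemma WW_generated: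
  assumes "\<And>v w. v \<in> U \<Longrightarrow> w \<in> U \<Longrightarrow> v + w \<in> U"
    and "\<And>v w. v \<in> NN \<Longrightarrow> w \<in> NN \<Longrightarrow> com v w \<in> U"
  shows "WW \<subseteq> U"
  using WW_generated_step[OF assms] subsets(5,6) unfolding diff_ops_def by blast

text \<open>
  For \<open>h G' = g\<close>, Hermite reduction of \<open>g/h\<close> splits off from \<open>G\<close> the fraction \<open>S = -s/c\<close>.
\<close>

lemma ZZ_plus_WW:
  assumes v: "v \<in> NN"
  shows "\<exists>z\<in>ZZ. \<exists>w\<in>WW. v = z + w"
  using v unfolding NN_def
proof (induction rule: ops_in_induct)
  case (add v w)
  then obtain z z' x x' where *: "z \<in> ZZ" "z' \<in> ZZ" "x \<in> WW" "x' \<in> WW" "v = z + x" "w = z' + x'"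
    by blast
  then have "v + w = (z + z') + (x + x')" by simp
  then show ?case using * Z_closed(2) W_closed(2) by blast
next
  case (monom G n)
  show ?case
  proof (cases n)
    case 0
    then obtain g where g: "H * fps_deriv G = emb g" using monom by (auto simp: N_coeff_simps RR_def)
    obtain s t where st: "g * c = r * (s * pderiv c - pderiv s * c) + c * c * t"
      using hermite_reduction by blast
    define S where "S = - (inverse C * emb s)"
    have CS: "C * S = - emb s"
      using inverse_mult_eq_1'[OF C_nth_0] by (simp add: S_def mult.assoc[symmetric])
    have "C * C * (\<rho> * fps_deriv (G - S)) = C * (H * fps_deriv G) - \<rho> * (C * C * fps_deriv S)"
      by (simp add: H_eq algebra_simps)
    also have "\<dots> = C * emb g - \<rho> * (emb s * fps_deriv C - fps_deriv (emb s) * C)"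
      unfolding g deriv_quotient[OF CS] by (simp add: algebra_simps)
    also have "\<dots> = emb (g * c - r * (s * pderiv c - pderiv s * c))"
      by (simp add: emb_simps ac_simps)
    also have "\<dots> = C * C * emb t" unfolding st by (simp add: emb_simps)
    finally have "\<rho> * fps_deriv (G - S) = emb t" using nonzero by simp
    then have "G - S \<in> Z_coeff 0" by (simp add: Z_coeff_def del: fps_deriv_sub)
    then have "mul (G - S) \<in> ZZ" unfolding ZZ_def by (rule Z.ops_in_mul)
    moreover have "S \<in> W_coeff 0" using CS RR_minus[OF emb_RR] by (simp add: W_coeff_def)
    then have "mul S \<in> WW" unfolding WW_def by (rule W.ops_in_mul)
    moreover have "mul G * dif ^ n = mul (G - S) + mul S" by (simp add: 0 mul_simps)
    ultimately show ?thesis by blast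
  next
    case (Suc m)
    then have "mul G * dif ^ n \<in> WW" using monom unfolding WW_def
      by (intro W.ops_in_monom) (simp add: W_coeff_def)
    then show ?thesis using Z_closed(1) by (intro bexI[of _ 0] bexI[of _ "mul G * dif ^ n"]) simp_all
  qed
qed

lemma ZZ_inter_WW: "ZZ \<inter> WW = AA"
proof
  show "AA \<subseteq> ZZ \<inter> WW" using subsets by blast
  have "L \<in> RR" if L: "\<rho> * fps_deriv L \<in> RR" "C * L \<in> RR" for L
  proof -
    obtain t where t: "\<rho> * fps_deriv L = emb t" using L(1) by (auto simp: RR_def)
    obtain s where s: "C * L = emb s" using L(2) by (auto simp: RR_def)
    have "emb (c * c * (- t)) = - (\<rho> * (C * C * fps_deriv L))"
      unfolding emb_simps t[symmetric] by (simp add: ac_simps)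
    also have "\<dots> = emb (r * (pderiv c * s - c * pderiv s))"
      unfolding deriv_quotient[OF s] by (simp add: emb_simps algebra_simps)
    finally have "c * c * (- t) = r * (pderiv c * s - c * pderiv s)" by (simp only: emb_eq_iff)
    then have "c dvd s" by (rule hermite_unique)
    then obtain q where "s = c * q" by (rule dvdE)
    then have "C * L = C * emb q" using s by (simp add: emb_simps)
    then show ?thesis using nonzero by simp
  qed
  then have 0: "{L. \<rho> * fps_deriv L \<in> RR} \<inter> {G. C * G \<in> RR} \<subseteq> RR" by blast
  have *: "f \<in> A_coeff i" if "f \<in> Z_coeff i" "f \<in> W_coeff i" for f i
  proof (cases "i = 0")
    case True
    have "A_coeff 0 = RR" by (auto simp: A_coeff_def)
    then show ?thesis using that 0 unfolding True Z_coeff_def W_coeff_def by auto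
  next
    case False
    then show ?thesis using that(1) by (simp only: Z_coeff_def if_False)
  qed
  show "ZZ \<inter> WW \<subseteq> AA"
  proof
    fix w assume w: "w \<in> ZZ \<inter> WW"
    then obtain P where P: "w = op P" unfolding ZZ_def ops_in_def by blast
    have "coeff P i \<in> A_coeff i" for i
      using w * unfolding P ZZ_def WW_def Int_iff op_in_ops_in_iff by simp
    then show "w \<in> AA" unfolding P AA_def op_in_ops_in_iff by simp
  qed
qed

text \<open>
  Modulo polynomials, \<open>L\<close> is determined by \<open>\<pi> L'\<close> modulo \<open>\<pi>\<close>, because polynomials have polynomial
  primitives.
\<close>

lemma ZZ_normal_form:
  assumes "z \<in> ZZ"
  shows "\<exists>L t. \<rho> * fps_deriv L = emb t \<and> (t = 0 \<or> degree t < degree r) \<and> z - mul L \<in> AA"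
  using assms unfolding ZZ_def
proof (induction rule: ops_in_induct)
  case (add v w)
  then obtain L t L' t' where *: "\<rho> * fps_deriv L = emb t" "t = 0 \<or> degree t < degree r" "v - mul L \<in> AA"
      "\<rho> * fps_deriv L' = emb t'" "t' = 0 \<or> degree t' < degree r" "w - mul L' \<in> AA" by blast
  have "\<rho> * fps_deriv (L + L') = emb (t + t')" by (simp add: distrib_left * emb_simps)
  moreover have "t + t' = 0 \<or> degree (t + t') < degree r"
    using *(2,5) degree_add_less[of t "degree r" t'] by auto
  moreover have "(v - mul L) + (w - mul L') \<in> AA" using * A_closed(2) by blast
  then have "v + w - mul (L + L') \<in> AA" by (simp add: mul_simps algebra_simps)
  ultimately show ?case by blast
next
  case (monom L n)
  show ?case
  proof (cases n)
    case 0
    then obtain t where t: "\<rho> * fps_deriv L = emb t" using monom by (auto simp: Z_coeff_def RR_def)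
    obtain q where q: "pderiv q = t div r" using poly_antiderivative by blast
    have "\<rho> * fps_deriv (L - emb q) = emb (t - r * (t div r))"
      by (simp add: right_diff_distrib t emb_simps q[symmetric])
    also have "t - r * (t div r) = t mod r" by (simp add: minus_mult_div_eq_mod)
    finally have "\<rho> * fps_deriv (L - emb q) = emb (t mod r)" .
    moreover have "t mod r = 0 \<or> degree (t mod r) < degree r" using degree_mod_less r_nonzero by blast
    moreover have "mul L * dif ^ n - mul (L - emb q) \<in> AA" by (simp add: 0 mul_simps)
    ultimately have "\<rho> * fps_deriv (L - emb q) = emb (t mod r) \<and> (t mod r = 0 \<or> degree (t mod r) < degree r)
        \<and> mul L * dif ^ n - mul (L - emb q) \<in> AA"
      by (intro conjI)
    then show ?thesis by (intro exI)
  next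
    case (Suc m)
    then have "L \<in> A_coeff n" using monom by (simp add: Z_coeff_def)
    then have "mul L * dif ^ n - mul 0 \<in> AA" unfolding AA_def mul_simps diff_0_right by (rule A.ops_in_monom)
    then show ?thesis by (intro exI[of _ 0]) (simp add: emb_simps)
  qed
qed

lemma log_primitive_in_AA:
  assumes "\<rho> * fps_deriv L = emb t" "t = 0 \<or> degree t < degree r" "mul L \<in> AA"
  shows "t = 0"
proof (rule ccontr)
  assume t: "t \<noteq> 0"
  have "op [:L:] \<in> AA" using assms(3) by (simp add: op_pCons)
  then have "L \<in> RR"
    unfolding AA_def op_in_ops_in_iff using A_coeff_iff[of _ 0] by (metis coeff_pCons_0 mult_1 power_0)
  then obtain q where "L = emb q" by (auto simp: RR_def)
  then have "emb (r * pderiv q) = emb t" using assms(1) by (simp add: emb_simps)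
  then have "r * pderiv q = t" by (simp only: emb_eq_iff)
  then have "degree r \<le> degree t" using t by (metis dvd_imp_degree_le dvd_triv_left)
  then show False using assms(2) t by simp
qed

end

section \<open>Linear images of subspaces and their quotients\<close>

text \<open>
  The structures of the statement are records on carriers, whereas the computations take place in a
  type with ring operations. A surjection \<open>G\<close> from a subspace \<open>V\<close> of a type-class vector space that
  transports the operations is enough to make the record \<open>L\<close> a vector space and to compute in it.
\<close>

locale linear_image =
  fixes s :: "'a::field \<Rightarrow> 'v::ab_group_add \<Rightarrow> 'v" and V :: "'v set" and G :: "'v \<Rightarrow> 'l"
    and L :: "('a, 'l, 'm) module_scheme"
  assumes scaling: "vector_space s"
    and V_0: "0 \<in> V"
    and V_add: "v \<in> V \<Longrightarrow> w \<in> V \<Longrightarrow> v + w \<in> V"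
    and V_scale: "v \<in> V \<Longrightarrow> s k v \<in> V"
    and carrier_eq: "carrier L = G ` V"
    and zero_eq: "\<zero>\<^bsub>L\<^esub> = G 0"
    and add_eq: "v \<in> V \<Longrightarrow> w \<in> V \<Longrightarrow> G v \<oplus>\<^bsub>L\<^esub> G w = G (v + w)"
    and smult_eq: "v \<in> V \<Longrightarrow> k \<odot>\<^bsub>L\<^esub> G v = G (s k v)"
begin

interpretation vs: vector_space s by (rule scaling)

lemma V_minus: "v \<in> V \<Longrightarrow> - v \<in> V"
  using V_scale[of v "- 1"] by simp

lemma V_diff: "v \<in> V \<Longrightarrow> w \<in> V \<Longrightarrow> v - w \<in> V"
  using V_add[of v "- w"] V_minus by simp

lemma vectorspace: "vectorspace class_ring L"
proof (rule vs_criteria[OF class_field])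
  show "\<forall>v\<in>carrier L. \<exists>w\<in>carrier L. v \<oplus>\<^bsub>L\<^esub> w = \<zero>\<^bsub>L\<^esub>"
    using V_minus by (auto simp: carrier_eq add_eq zero_eq) (metis add.right_inverse add_eq)
qed (auto simp: carrier_eq add_eq zero_eq smult_eq V_0 V_add V_scale ac_simps
    vs.scale_right_distrib vs.scale_left_distrib)

lemma abelian_group: "abelian_group L"
  using vectorspace unfolding vectorspace_def Module.module_def by blast

lemma minus_eq:
  assumes "v \<in> V" "w \<in> V"
  shows "G v \<ominus>\<^bsub>L\<^esub> G w = G (v - w)"
proof -
  interpret L: abelian_group L by (rule abelian_group)
  have "\<ominus>\<^bsub>L\<^esub> G w = G (- w)"
    using assms V_minus by (intro L.minus_equality) (auto simp: add_eq zero_eq carrier_eq)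
  then show ?thesis using assms V_minus by (simp add: a_minus_def add_eq)
qed

lemma subspace_image:
  assumes "U \<subseteq> V" "0 \<in> U" "\<And>v w. v \<in> U \<Longrightarrow> w \<in> U \<Longrightarrow> v + w \<in> U"
    "\<And>k v. v \<in> U \<Longrightarrow> s k v \<in> U"
  shows "VectorSpace.subspace class_ring (G ` U) L"
  unfolding VectorSpace.subspace_def submodule_def
proof (intro conjI vectorspace allI impI)
  show "Module.module class_ring L" using vectorspace unfolding vectorspace_def by blast
  show "G ` U \<subseteq> carrier L" using assms(1) by (auto simp: carrier_eq)
  show "\<zero>\<^bsub>L\<^esub> \<in> G ` U" using assms(2) by (simp add: zero_eq)
  show "v \<oplus>\<^bsub>L\<^esub> w \<in> G ` U" if "v \<in> G ` U" "w \<in> G ` U" for v w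
  proof -
    obtain v' w' where "v = G v'" "w = G w'" "v' \<in> U" "w' \<in> U" using \<open>v \<in> _\<close> \<open>w \<in> _\<close> by blast
    then show ?thesis using assms(1,3) by (simp add: add_eq subset_iff)
  qed
  show "k \<odot>\<^bsub>L\<^esub> v \<in> G ` U" if "k \<in> carrier class_ring" "v \<in> G ` U" for k v
  proof -
    obtain v' where "v = G v'" "v' \<in> U" using \<open>v \<in> _\<close> by blast
    then show ?thesis using assms(1,4) by (simp add: smult_eq subset_iff)
  qed
qed

lemma sum_in_V: "(\<And>x. x \<in> A \<Longrightarrow> g x \<in> V) \<Longrightarrow> (\<Sum>x\<in>A. g x) \<in> V"
  by (induction A rule: infinite_finite_induct) (auto intro: V_0 V_add)

lemma finsum_eq:
  assumes "finite A" "\<And>x. x \<in> A \<Longrightarrow> g x \<in> V"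
  shows "(\<Oplus>\<^bsub>L\<^esub>x\<in>A. G (g x)) = G (\<Sum>x\<in>A. g x)"
proof -
  interpret L: abelian_group L by (rule abelian_group)
  show ?thesis
    using assms
  proof (induction A rule: finite_induct)
    case (insert x A)
    then have "(\<lambda>x. G (g x)) \<in> A \<rightarrow> carrier L" by (auto simp: carrier_eq)
    then show ?case
      using insert by (simp add: L.finsum_insert carrier_eq add_eq sum_in_V)
  qed (simp add: zero_eq)
qed

lemma dim_eq_basis:
  assumes inj: "\<And>v. v \<in> V \<Longrightarrow> G v = \<zero>\<^bsub>L\<^esub> \<Longrightarrow> v = 0"
    and f: "\<And>i. i < n \<Longrightarrow> f i \<in> V"
    and indep: "\<And>a. (\<Sum>i<n. s (a i) (f i)) = 0 \<Longrightarrow> \<forall>i<n. a i = 0"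
    and gen: "\<And>v. v \<in> V \<Longrightarrow> \<exists>a. v = (\<Sum>i<n. s (a i) (f i))"
  shows "vectorspace.fin_dim class_ring L" and "vectorspace.dim class_ring L = n"
proof -
  interpret L: vectorspace class_ring L by (rule vectorspace)
  define B where "B = (\<lambda>i. G (f i)) ` {..<n}"
  have inj_on: "inj_on (\<lambda>i. G (f i)) {..<n}"
  proof (rule inj_onI)
    fix i j assume ij: "i \<in> {..<n}" "j \<in> {..<n}" "G (f i) = G (f j)"
    then have "G (f i - f j) = \<zero>\<^bsub>L\<^esub>"
      using minus_eq[of "f i" "f j"] minus_eq[of "f j" "f j"] f by (simp add: zero_eq)
    moreover have "f i - f j \<in> V" using f ij V_diff by simp
    ultimately have "f i - f j = 0" using inj by blast
    show "i = j"
    proof (rule ccontr)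
      assume ne: "i \<noteq> j"
      let ?a = "\<lambda>k. if k = i then 1 else if k = j then - 1 else 0 :: 'a"
      have "(\<Sum>k<n. s (?a k) (f k)) = (\<Sum>k\<in>{i, j}. s (?a k) (f k))"
        using ij by (intro sum.mono_neutral_right) auto
      also have "\<dots> = f i - f j" using ne by simp
      also have "\<dots> = 0" by fact
      finally have "\<forall>k<n. ?a k = 0" by (rule indep[of ?a])
      then have "?a i = 0" using ij by (simp only: lessThan_iff)
      then show False by simp
    qed
  qed
  have fin: "finite B" and card: "card B = n" and sub: "B \<subseteq> carrier L"
    using card_image[OF inj_on] f by (auto simp: B_def carrier_eq)
  have lincomb: "L.lincomb a B = G (\<Sum>i<n. s (a (G (f i))) (f i))" for a
  proof -
    have "L.lincomb a B = (\<Oplus>\<^bsub>L\<^esub>v\<in>B. a v \<odot>\<^bsub>L\<^esub> v)" by (simp add: L.lincomb_def)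
    also have "\<dots> = (\<Oplus>\<^bsub>L\<^esub>i\<in>{..<n}. a (G (f i)) \<odot>\<^bsub>L\<^esub> G (f i))"
      unfolding B_def using f inj_on by (intro L.finsum_reindex) (auto simp: smult_eq carrier_eq V_scale)
    also have "\<dots> = (\<Oplus>\<^bsub>L\<^esub>i\<in>{..<n}. G (s (a (G (f i))) (f i)))"
      using f by (intro L.finsum_cong') (auto simp: smult_eq carrier_eq V_scale)
    also have "\<dots> = G (\<Sum>i<n. s (a (G (f i))) (f i))"
      using f by (intro finsum_eq) (auto simp: V_scale)
    finally show ?thesis .
  qed
  have "L.gen_set B"
  proof
    show "L.span B \<subseteq> carrier L" by (rule L.span_is_subset2[OF sub])
    show "carrier L \<subseteq> L.span B"
    proof
      fix x assume "x \<in> carrier L"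
      then obtain v where v: "v \<in> V" "x = G v" by (auto simp: carrier_eq)
      obtain a where a: "v = (\<Sum>i<n. s (a i) (f i))" using gen v by blast
      \<comment> \<open>Linear combinations are indexed by vectors, so the coefficients are transported along the
          injective enumeration of the basis.\<close>
      define b where "b x = a (the_inv_into {..<n} (\<lambda>i. G (f i)) x)" for x
      have "b (G (f i)) = a i" if "i < n" for i
        using the_inv_into_f_f[OF inj_on, of i] that by (simp add: b_def)
      then have "x = L.lincomb b B" unfolding lincomb v a by simp
      then show "x \<in> L.span B" unfolding L.finite_span[OF fin sub] by auto
    qed
  qed
  moreover have "L.lin_indpt B"
  proof (rule L.finite_lin_indpt2[OF fin sub])
    fix a assume "L.lincomb a B = \<zero>\<^bsub>L\<^esub>"
    then have "(\<Sum>i<n. s (a (G (f i))) (f i)) = 0"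
      unfolding lincomb using f by (intro inj sum_in_V) (auto simp: V_scale)
    then show "\<forall>v\<in>B. a v = \<zero>\<^bsub>class_ring\<^esub>" using indep[of "\<lambda>i. a (G (f i))"] by (auto simp: B_def)
  qed
  ultimately show "L.fin_dim" "L.dim = n"
    using L.dim_basis[of B] fin sub card unfolding L.basis_def L.fin_dim_def by auto
qed

end

text \<open>
  The quotient of a linear image by the image of a smaller subspace \<open>J\<close>. It applies to the free algebra
  modulo an ideal as well as to derivations modulo inner derivations, whose product is a Lie bracket.
\<close>

locale linear_image_quotient = linear_image s V G A
  for s :: "'a::field \<Rightarrow> 'v::ab_group_add \<Rightarrow> 'v" and V G and A :: "('a, 'l) module" +
  fixes J :: "'v set"
  assumes J_V: "J \<subseteq> V" and J_0: "0 \<in> J"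
    and J_add: "v \<in> J \<Longrightarrow> w \<in> J \<Longrightarrow> v + w \<in> J"
    and J_scale: "v \<in> J \<Longrightarrow> s k v \<in> J"
begin

interpretation vs: vector_space s by (rule scaling)

definition coset :: "'v \<Rightarrow> 'l set" where
  "coset v = G ` J +>\<^bsub>A\<^esub> G v"

lemma J_minus: "v \<in> J \<Longrightarrow> - v \<in> J"
  using J_scale[of v "- 1"] by simp

lemma coset_eq: "v \<in> V \<Longrightarrow> coset v = (\<lambda>j. G (j + v)) ` J"
  unfolding coset_def a_r_coset_def' using J_V by (auto simp: add_eq subset_iff)

lemma coset_cong:
  assumes v: "v \<in> V" and vw: "v - w \<in> J"
  shows "coset v = coset w"
proof -
  have "w - v \<in> J" using J_minus[OF vw] by simp
  then have "w - v + v \<in> V" using V_add J_V v by blast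
  then have w: "w \<in> V" by simp
  have "G (j + v) \<in> coset w" if "j \<in> J" for j
    unfolding coset_eq[OF w] using J_add[OF that vw] by (intro image_eqI[of _ _ "j + (v - w)"]) simp_all
  moreover have "G (j + w) \<in> coset v" if "j \<in> J" for j
    unfolding coset_eq[OF v] using J_add[OF that \<open>w - v \<in> J\<close>]
    by (intro image_eqI[of _ _ "j + (w - v)"]) simp_all
  ultimately show ?thesis using coset_eq v w by auto
qed

lemma coset_union:
  assumes v: "v \<in> V" and g: "\<And>j. j \<in> J \<Longrightarrow> g (j + v) - w \<in> J" and w: "w \<in> V"
  shows "(\<Union>j\<in>J. coset (g (j + v))) = coset w"
proof -
  have "coset (g (j + v)) = coset w" if "j \<in> J" for j
  proof -
    have "w - g (j + v) \<in> J" using J_minus[OF g[OF that]] by simp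
    then show ?thesis using coset_cong[OF w] by simp
  qed
  then show ?thesis using J_0 by blast
qed

lemma quotient_carrier: "carrier (alg_quot A (G ` J)) = coset ` V"
  unfolding alg_quot_def FactRing_def ring.defs module.defs A_RCOSETS_def' coset_def
  by (auto simp: carrier_eq)

lemma quotient_zero: "\<zero>\<^bsub>alg_quot A (G ` J)\<^esub> = coset 0"
  unfolding coset_eq[OF V_0] by (simp add: alg_quot_def FactRing_def ring.defs module.defs)

lemma quotient_add:
  assumes "v \<in> V" "w \<in> V"
  shows "coset v \<oplus>\<^bsub>alg_quot A (G ` J)\<^esub> coset w = coset (v + w)"
proof -
  have "coset v \<oplus>\<^bsub>alg_quot A (G ` J)\<^esub> coset w = coset v <+>\<^bsub>A\<^esub> coset w"
    by (simp add: alg_quot_def FactRing_def ring.defs module.defs)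
  also have "\<dots> = (\<Union>i\<in>J. \<Union>j\<in>J. {G ((i + v) + (j + w))})"
    unfolding set_add_def' using assms J_V by (auto simp: coset_eq add_eq V_add subset_iff)
  also have "\<dots> = (\<lambda>j. G (j + (v + w))) ` J"
  proof (intro subset_antisym subsetI)
    fix x assume "x \<in> (\<Union>i\<in>J. \<Union>j\<in>J. {G ((i + v) + (j + w))})"
    then obtain i j where "i \<in> J" "j \<in> J" "x = G ((i + v) + (j + w))" by blast
    then show "x \<in> (\<lambda>j. G (j + (v + w))) ` J"
      using J_add by (intro image_eqI[of _ _ "i + j"]) (simp_all add: ac_simps)
  next
    fix x assume "x \<in> (\<lambda>j. G (j + (v + w))) ` J"
    then obtain j where "j \<in> J" "x = G ((0 + v) + (j + w))" by (auto simp: ac_simps)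
    then show "x \<in> (\<Union>i\<in>J. \<Union>j\<in>J. {G ((i + v) + (j + w))})" using J_0 by blast
  qed
  finally show ?thesis using assms V_add by (simp add: coset_eq)
qed

lemma quotient_smult:
  assumes "v \<in> V"
  shows "k \<odot>\<^bsub>alg_quot A (G ` J)\<^esub> coset v = coset (s k v)"
proof -
  have "k \<odot>\<^bsub>alg_quot A (G ` J)\<^esub> coset v = (\<Union>a\<in>coset v. G ` J +>\<^bsub>A\<^esub> (k \<odot>\<^bsub>A\<^esub> a))"
    by (simp add: alg_quot_def FactRing_def ring.defs module.defs)
  also have "\<dots> = (\<Union>j\<in>J. coset (s k (j + v)))"
    using assms J_V by (auto simp: coset_eq smult_eq V_add subset_iff coset_def[symmetric])
  also have "\<dots> = coset (s k v)"
    using assms by (intro coset_union V_scale) (simp_all add: vs.scale_right_distrib J_scale)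
  finally show ?thesis .
qed

lemma quotient_mult:
  assumes V: "v \<in> V" "w \<in> V"
    and mult: "\<And>v w. v \<in> V \<Longrightarrow> w \<in> V \<Longrightarrow> G v \<otimes>\<^bsub>A\<^esub> G w = G (m v w)"
    and closed: "\<And>v w. v \<in> V \<Longrightarrow> w \<in> V \<Longrightarrow> m v w \<in> V"
    and ideal: "\<And>i j. i \<in> J \<Longrightarrow> j \<in> J \<Longrightarrow> m (i + v) (j + w) - m v w \<in> J"
  shows "coset v \<otimes>\<^bsub>alg_quot A (G ` J)\<^esub> coset w = coset (m v w)"
proof -
  have "coset v \<otimes>\<^bsub>alg_quot A (G ` J)\<^esub> coset w = (\<Union>a\<in>coset v. \<Union>b\<in>coset w. G ` J +>\<^bsub>A\<^esub> (a \<otimes>\<^bsub>A\<^esub> b))"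
    by (simp add: alg_quot_def FactRing_def ring.defs module.defs rcoset_mult_def)
  also have "\<dots> = (\<Union>i\<in>J. \<Union>j\<in>J. coset (m (i + v) (j + w)))"
    using V J_V by (simp add: coset_eq mult V_add subset_iff coset_def[symmetric])
  also have "\<dots> = coset (m v w)"
  proof -
    have "coset (m (i + v) (j + w)) = coset (m v w)" if "i \<in> J" "j \<in> J" for i j
      using that V J_V closed V_add ideal by (intro coset_cong) (auto simp: subset_iff)
    then show ?thesis using J_0 by blast
  qed
  finally show ?thesis .
qed

lemma linear_image_quotient: "linear_image s V coset (alg_quot A (G ` J))"
  by unfold_locales
    (simp_all add: V_0 V_add V_scale quotient_carrier quotient_zero quotient_add quotient_smult)

end

section \<open>The presented algebra as an algebra of operators\<close>

type_synonym 'a free = "generator word \<Rightarrow>\<^sub>0 'a"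

lemma free_induct [case_names single add]:
  fixes p :: "'g word \<Rightarrow>\<^sub>0 'a::comm_ring_1"
  assumes single: "\<And>w k. Q (Poly_Mapping.single w k)"
    and add: "\<And>p q. Q p \<Longrightarrow> Q q \<Longrightarrow> Q (p + q)"
  shows "Q p"
proof -
  have "Q (\<Sum>w\<in>A. Poly_Mapping.single w (Poly_Mapping.lookup p w))" if "finite A" for A
    using that
  proof (induction A rule: finite_induct)
    case empty
    then show ?case using single[of undefined 0] by simp
  qed (simp add: add single)
  moreover have "p = (\<Sum>w\<in>Poly_Mapping.keys p. Poly_Mapping.single w (Poly_Mapping.lookup p w))"
    by (rule poly_mapping_eqI)
      (auto simp: lookup_sum lookup_single when_def in_keys_iff sum.delta)
  ultimately show ?thesis using finite_keys[of p] by metis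
qed

lemma scalar_central:
  "p * Poly_Mapping.single 0 k = Poly_Mapping.single 0 k * (p :: 'g word \<Rightarrow>\<^sub>0 'a::comm_ring_1)"
  by (induction p rule: free_induct) (simp_all add: mult_single mult.commute distrib_left distrib_right)

lemma poly_at_bound:
  "degree p \<le> n \<Longrightarrow> poly_at p t = (\<Sum>i\<le>n. Poly_Mapping.single 0 (coeff p i) * t ^ i)"
  unfolding poly_at_def by (rule sum.mono_neutral_left) (auto simp: coeff_eq_0)

lemma poly_at_pCons: "poly_at (pCons k p) t = Poly_Mapping.single 0 k + t * poly_at p t"
proof -
  have "poly_at (pCons k p) t
      = (\<Sum>i\<le>Suc (degree p). Poly_Mapping.single 0 (coeff (pCons k p) i) * t ^ i)"
    by (rule poly_at_bound) (rule degree_pCons_le)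
  also have "\<dots> = Poly_Mapping.single 0 k + (\<Sum>i\<le>degree p. Poly_Mapping.single 0 (coeff p i) * t ^ Suc i)"
    by (subst sum.atMost_Suc_shift) simp
  also have "(\<Sum>i\<le>degree p. Poly_Mapping.single 0 (coeff p i) * t ^ Suc i) = t * poly_at p t"
    unfolding poly_at_def sum_distrib_left power_Suc
    by (intro sum.cong refl) (metis mult.assoc scalar_central)
  finally show ?thesis .
qed

lemma poly_at_0 [simp]: "poly_at 0 t = 0"
  by (simp add: poly_at_def)

lemma poly_at_add: "poly_at (p + q) t = poly_at p t + poly_at q t"
  by (induction p q rule: poly_induct2)
    (simp_all add: poly_at_pCons single_add distrib_left ac_simps)

lemma poly_at_smult: "poly_at (smult k p) t = Poly_Mapping.single 0 k * poly_at p t"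
proof (induction p)
  case (pCons a p)
  have "t * (Poly_Mapping.single 0 k * poly_at p t) = Poly_Mapping.single 0 k * (t * poly_at p t)"
    by (metis mult.assoc scalar_central)
  then show ?case by (simp add: poly_at_pCons pCons mult_single distrib_left)
qed simp

lemma poly_at_mult: "poly_at (p * q) t = poly_at p t * poly_at q t"
  by (induction p)
    (simp_all add: poly_at_pCons poly_at_add poly_at_smult distrib_right mult.assoc)

lemma ring_free_algebra: "ring (free_algebra :: ('a::field, 'g word \<Rightarrow>\<^sub>0 'a) module)"
proof (rule ringI)
  show "abelian_group (free_algebra :: ('a, 'g word \<Rightarrow>\<^sub>0 'a) module)"
  proof (rule abelian_groupI)
    show "\<exists>y\<in>carrier free_algebra. y \<oplus>\<^bsub>free_algebra\<^esub> x = \<zero>\<^bsub>free_algebra\<^esub>" for x :: "'g word \<Rightarrow>\<^sub>0 'a"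
      by (rule bexI[of _ "- x"]) (simp_all add: free_algebra_def)
  qed (simp_all add: free_algebra_def ac_simps)
  show "Group.monoid (free_algebra :: ('a, 'g word \<Rightarrow>\<^sub>0 'a) module)"
    by (rule monoidI) (simp_all add: free_algebra_def mult.assoc)
qed (simp_all add: free_algebra_def algebra_simps)

abbreviation "sc k \<equiv> Poly_Mapping.single (0 :: generator word) k"

context Ah_model
begin

fun gen_op :: "generator \<Rightarrow> 'a endo" where
  "gen_op X = xx"
| "gen_op Y = yh"

fun word_op :: "generator word \<Rightarrow> 'a endo" where
  "word_op (Word gs) = prod_list (map gen_op gs)"

definition rep :: "'a free \<Rightarrow> 'a endo" where
  "rep p = (\<Sum>w\<in>Poly_Mapping.keys p. scal (Poly_Mapping.lookup p w) (word_op w))"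

lemma word_op_add: "word_op (u + v) = word_op u * word_op v"
  by (cases u; cases v) simp

lemma rep_add: "rep (p + q) = rep p + rep q"
  unfolding rep_def by (rule setsum_keys_plus_distrib) (simp_all add: scal_simps)

lemma rep_single: "rep (Poly_Mapping.single w k) = scal k (word_op w)"
  by (simp add: rep_def scal_simps)

lemma rep_mult: "rep (p * q) = rep p * rep q"
proof (induction p rule: free_induct)
  case (single u k)
  show ?case
    by (induction q rule: free_induct)
      (simp_all add: rep_single rep_add mult_single word_op_add scal_simps distrib_left mult.commute)
qed (simp add: rep_add distrib_right)

lemma rep_0 [simp]: "rep 0 = 0"
  by (simp add: rep_def)

lemma rep_minus: "rep (- p) = - rep p"
  using rep_add[of p "- p"] by (simp add: eq_neg_iff_add_eq_0 add.commute)

lemma rep_diff: "rep (p - q) = rep p - rep q"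
  using rep_add[of p "- q"] by (simp add: rep_minus)

lemma rep_sum: "rep (\<Sum>x\<in>A. f x) = (\<Sum>x\<in>A. rep (f x))"
  by (induction A rule: infinite_finite_induct) (simp_all add: rep_add)

lemma rep_sc: "rep (sc k) = mul (fps_const k)"
  by (simp add: rep_single zero_word_def scal_def)

lemma rep_gen: "rep (gen X) = xx" "rep (gen Y) = yh"
  by (simp_all add: gen_def rep_single scal_simps)

abbreviation pe :: "'a poly \<Rightarrow> 'a free" where
  "pe p \<equiv> poly_at p (gen X)"

lemma rep_pe: "rep (pe p) = mul (emb p)"
proof (induction p)
  case 0
  then show ?case by (simp add: emb_simps mul_simps)
next
  case (pCons k p)
  then show ?case by (simp add: mul_emb_pCons poly_at_pCons rep_add rep_mult rep_sc rep_gen)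
qed

lemma rep_AA: "rep p \<in> AA"
proof (induction p rule: free_induct)
  case (single w k)
  have "prod_list (map gen_op gs) \<in> AA" for gs
  proof (induction gs)
    case Nil
    then show ?case using mul_AA[OF RR_1] by (simp add: mul_simps)
  next
    case (Cons g gs)
    have "gen_op g \<in> AA" by (cases g) (simp_all add: xx_AA yh_AA)
    then show ?case using Cons AA_mult by simp
  qed
  then have "word_op w \<in> AA" by (cases w) simp
  then show ?case by (simp add: rep_single A_closed(5))
qed (simp add: rep_add A_closed(2))

lemma range_rep: "range rep = AA"
proof
  show "range rep \<subseteq> AA" using rep_AA by blast
  show "AA \<subseteq> range rep"
  proof
    fix w assume "w \<in> AA"
    then show "w \<in> range rep"
    proof (induction rule: AA_generated)
      case (add v w)
      then obtain p q where "v = rep p" "w = rep q" by blast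
      then have "v + w = rep (p + q)" by (simp add: rep_add)
      then show ?case by simp
    next
      case (mult v w)
      then obtain p q where "v = rep p" "w = rep q" by blast
      then have "v * w = rep (p * q)" by (simp add: rep_mult)
      then show ?case by simp
    qed (use rep_sc rep_gen in \<open>metis rangeI\<close>)+
  qed
qed

definition relator :: "'a free" where
  "relator = gen Y * gen X - gen X * gen Y - pe h"

lemma Ah_ideal_eq: "Ah_ideal h = Idl\<^bsub>free_algebra\<^esub> {relator}"
  by (simp add: Ah_ideal_def relator_def)

lemma rep_relator: "rep relator = 0"
  using com_yh_xx by (simp add: relator_def rep_diff rep_mult rep_gen rep_pe com_def)

abbreviation "I \<equiv> Ah_ideal h"

lemma ideal_I: "ideal I free_algebra"
  unfolding Ah_ideal_eq by (rule ring.genideal_ideal[OF ring_free_algebra]) (simp add: free_algebra_def)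

lemma I_closed:
  "0 \<in> I" "p \<in> I \<Longrightarrow> q \<in> I \<Longrightarrow> p + q \<in> I" "p \<in> I \<Longrightarrow> q * p \<in> I" "p \<in> I \<Longrightarrow> p * q \<in> I"
  "relator \<in> I"
proof -
  interpret I: ideal I "free_algebra :: ('a, 'a free) module" by (rule ideal_I)
  show "0 \<in> I" using additive_subgroup.zero_closed[OF I.is_additive_subgroup] by (simp add: free_algebra_def)
  show "p + q \<in> I" if "p \<in> I" "q \<in> I" for p q
    using additive_subgroup.a_closed[OF I.is_additive_subgroup that] by (simp add: free_algebra_def)
  show "q * p \<in> I" if "p \<in> I" for p q
    using I.I_l_closed[OF that, of q] by (simp add: free_algebra_def)
  show "p * q \<in> I" if "p \<in> I" for p q
    using I.I_r_closed[OF that, of q] by (simp add: free_algebra_def)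
  show "relator \<in> I"
    unfolding Ah_ideal_eq using ring.genideal_self'[OF ring_free_algebra, of relator]
    by (simp add: free_algebra_def)
qed

lemma I_subset_kernel: "p \<in> I \<Longrightarrow> rep p = 0"
proof -
  have "ideal {p. rep p = 0} (free_algebra :: ('a, 'a free) module)"
  proof (rule idealI[OF ring_free_algebra])
    show "subgroup {p. rep p = 0} (add_monoid free_algebra)"
    proof (rule group.subgroupI)
      show "Group.group (add_monoid (free_algebra :: ('a, 'a free) module))"
        using ring.is_abelian_group[OF ring_free_algebra] abelian_group.a_group by blast
      fix a :: "'a free" assume a: "a \<in> {p. rep p = 0}"
      have "inv\<^bsub>add_monoid free_algebra\<^esub> a = - a"
        using abelian_group.minus_equality[OF ring.is_abelian_group[OF ring_free_algebra], of "- a" a]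
        by (simp add: a_inv_def free_algebra_def)
      then show "inv\<^bsub>add_monoid free_algebra\<^esub> a \<in> {p. rep p = 0}"
        using a by (simp add: rep_minus)
    qed (auto simp: free_algebra_def rep_add intro: exI[of _ 0])
  qed (auto simp: free_algebra_def rep_mult)
  then have "I \<subseteq> {p. rep p = 0}"
    unfolding Ah_ideal_eq using ring.genideal_minimal[OF ring_free_algebra] rep_relator by blast
  then show "p \<in> I \<Longrightarrow> rep p = 0" by blast
qed

text \<open>
  Preimages of \<open>h\<^sup>i \<partial>\<^sup>i\<close>, following \<open>yh_power_step\<close>. Normal forms are written with them instead of
  the powers of the generator \<open>Y\<close>, since their operators are single monomials.
\<close>

primrec Hdif :: "nat \<Rightarrow> 'a free" where
  "Hdif 0 = 1"
| "Hdif (Suc i) = (gen Y - pe (of_nat i * pderiv h)) * Hdif i"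

lemma rep_Hdif: "rep (Hdif i) = mul (H ^ i) * dif ^ i"
proof (induction i)
  case 0
  have "rep 1 = mul 1" using rep_sc[of 1] by simp
  then show ?case by (simp add: mul_simps)
next
  case (Suc i)
  have "emb (of_nat i) = of_nat i" by (induction i) (simp_all add: emb_simps)
  then show ?case
    unfolding Hdif.simps yh_power_step rep_mult rep_diff rep_gen rep_pe Suc by (simp add: emb_simps)
qed

definition normal :: "'a free set" where
  "normal = {p. \<exists>n f. p - (\<Sum>i\<le>n. pe (f i) * Hdif i) \<in> I}"

lemma I_normal: "p \<in> I \<Longrightarrow> p \<in> normal"
  unfolding normal_def by (rule CollectI, rule exI[of _ 0], rule exI[of _ "\<lambda>_. 0"]) simp

lemma normal_add: "p \<in> normal \<Longrightarrow> q \<in> normal \<Longrightarrow> p + q \<in> normal"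
proof -
  assume "p \<in> normal" "q \<in> normal"
  then obtain n f m g where pq: "p - (\<Sum>i\<le>n. pe (f i) * Hdif i) \<in> I" "q - (\<Sum>i\<le>m. pe (g i) * Hdif i) \<in> I"
    unfolding normal_def by blast
  define f' where "f' i = (if i \<le> n then f i else 0)" for i
  define g' where "g' i = (if i \<le> m then g i else 0)" for i
  have f: "(\<Sum>i\<le>n. pe (f i) * Hdif i) = (\<Sum>i\<le>max n m. pe (f' i) * Hdif i)"
    by (rule sum.mono_neutral_cong_left) (auto simp: f'_def)
  have g: "(\<Sum>i\<le>m. pe (g i) * Hdif i) = (\<Sum>i\<le>max n m. pe (g' i) * Hdif i)"
    by (rule sum.mono_neutral_cong_left) (auto simp: g'_def)
  have "p + q - (\<Sum>i\<le>max n m. pe (f' i + g' i) * Hdif i)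
      = (p - (\<Sum>i\<le>n. pe (f i) * Hdif i)) + (q - (\<Sum>i\<le>m. pe (g i) * Hdif i))"
    unfolding f g by (simp add: poly_at_add distrib_right sum.distrib)
  also have "\<dots> \<in> I" by (rule I_closed(2)[OF pq])
  finally show ?thesis unfolding normal_def
    by (intro CollectI exI[of _ "max n m"] exI[of _ "\<lambda>i. f' i + g' i"])
qed

lemma normal_cong: "q \<in> normal \<Longrightarrow> p - q \<in> I \<Longrightarrow> p \<in> normal"
  using normal_add[of q "p - q"] I_normal[of "p - q"] by simp

lemma normal_monom: "pe f * Hdif i \<in> normal"
proof -
  have "(\<Sum>j\<le>i. pe (if j = i then f else 0) * Hdif j) = (\<Sum>j\<in>{i}. pe (if j = i then f else 0) * Hdif j)"
    by (rule sum.mono_neutral_right) auto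
  then have "pe f * Hdif i - (\<Sum>j\<le>i. pe (if j = i then f else 0) * Hdif j) \<in> I"
    using I_closed(1) by simp
  then show ?thesis unfolding normal_def
    by (intro CollectI exI[of _ i] exI[of _ "\<lambda>j. if j = i then f else 0"])
qed

lemma normal_mult_left:
  assumes "\<And>f i. g * (pe f * Hdif i) \<in> normal" and p: "p \<in> normal"
  shows "g * p \<in> normal"
proof -
  obtain n f where pf: "p - (\<Sum>i\<le>n. pe (f i) * Hdif i) \<in> I" using p unfolding normal_def by blast
  have "g * (\<Sum>i\<le>n. pe (f i) * Hdif i) \<in> normal"
    by (induction n) (simp_all add: assms(1) distrib_left normal_add del: Hdif.simps)
  moreover have "g * p - g * (\<Sum>i\<le>n. pe (f i) * Hdif i) \<in> I"
    using I_closed(3)[OF pf, of g] by (simp add: right_diff_distrib)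
  ultimately show ?thesis by (rule normal_cong)
qed

text \<open>
  The relation extends from \<open>x\<close> to polynomials: \<open>[Y, f(x)] = (h f')(x)\<close>.
\<close>

lemma commutation_mod_I: "gen Y * pe f - pe f * gen Y - pe (h * pderiv f) \<in> I"
proof (induction f)
  case 0
  then show ?case by (simp add: I_closed)
next
  case (pCons k f)
  have "gen Y * pe (pCons k f) - pe (pCons k f) * gen Y - pe (h * pderiv (pCons k f))
      = relator * pe f + gen X * (gen Y * pe f - pe f * gen Y - pe (h * pderiv f))"
  proof -
    have "h * pderiv (pCons k f) = h * f + pCons 0 (h * pderiv f)"
      by (simp add: pderiv_pCons algebra_simps)
    then show ?thesis
      unfolding relator_def
      by (simp add: poly_at_pCons poly_at_add poly_at_mult distrib_left distrib_right
          left_diff_distrib right_diff_distrib mult.assoc scalar_central[of "gen Y" k])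
  qed
  also have "\<dots> \<in> I" by (intro I_closed(2) I_closed(4)[OF I_closed(5)] I_closed(3) pCons.IH)
  finally show ?case .
qed

lemma normal_gen: "p \<in> normal \<Longrightarrow> gen g * p \<in> normal"
proof (rule normal_mult_left)
  fix f :: "'a poly" and i
  show "gen g * (pe f * Hdif i) \<in> normal"
  proof (cases g)
    case X
    have "gen X * (pe f * Hdif i) = pe (pCons 0 f) * Hdif i"
      by (simp add: poly_at_pCons mult.assoc)
    then show ?thesis using X normal_monom by simp
  next
    case Y
    have "(gen Y * pe f - pe f * gen Y - pe (h * pderiv f)) * Hdif i \<in> I"
      by (rule I_closed(4)[OF commutation_mod_I])
    moreover have "(gen Y * pe f - pe f * gen Y - pe (h * pderiv f)) * Hdif i
        = gen Y * (pe f * Hdif i) - (pe f * Hdif (Suc i) + pe (f * (of_nat i * pderiv h) + h * pderiv f) * Hdif i)"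
      by (simp add: poly_at_add poly_at_mult left_diff_distrib right_diff_distrib distrib_right mult.assoc)
    ultimately show ?thesis using Y normal_cong normal_add normal_monom by metis
  qed
qed

lemma normal_sc: "p \<in> normal \<Longrightarrow> sc k * p \<in> normal"
proof (rule normal_mult_left)
  fix f :: "'a poly" and i
  have "sc k * (pe f * Hdif i) = pe (smult k f) * Hdif i"
    by (simp add: poly_at_smult mult.assoc)
  then show "sc k * (pe f * Hdif i) \<in> normal" using normal_monom by simp
qed

lemma all_normal: "p \<in> normal"
proof (induction p rule: free_induct)
  case (single w k)
  have "Poly_Mapping.single (Word gs) 1 \<in> normal" for gs
  proof (induction gs)
    case Nil
    have "pe 1 = 1" using poly_at_pCons[of 1 0 "gen X"] by (simp add: one_pCons)
    then have "Poly_Mapping.single (Word []) 1 = pe 1 * Hdif 0" by (simp add: zero_word_def[symmetric])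
    then show ?case using normal_monom by metis
  next
    case (Cons g gs)
    have "Poly_Mapping.single (Word (g # gs)) 1 = gen g * Poly_Mapping.single (Word gs) (1 :: 'a)"
      by (simp add: gen_def mult_single)
    then show ?case using normal_gen[OF Cons] by simp
  qed
  then have "sc k * Poly_Mapping.single w 1 \<in> normal" by (cases w) (simp add: normal_sc)
  then show ?case by (simp add: mult_single)
qed (rule normal_add)

text \<open>
  Modulo the relation, each element of the free algebra has the normal form \<open>\<Sum> f\<^sub>i(x) H\<^sub>i\<close>, where
  \<open>H\<^sub>i\<close> represents \<open>h\<^sup>i \<partial>\<^sup>i\<close>; as symbols are unique, the operator vanishes only if all \<open>f\<^sub>i\<close> do.
\<close>

lemma kernel_rep: "rep p = 0 \<longleftrightarrow> p \<in> I"
proof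
  assume p: "rep p = 0"
  obtain n f where pf: "p - (\<Sum>i\<le>n. pe (f i) * Hdif i) \<in> I" using all_normal[of p] unfolding normal_def by blast
  then have "rep (\<Sum>i\<le>n. pe (f i) * Hdif i) = 0" using I_subset_kernel[OF pf] p by (simp add: rep_diff)
  moreover have "rep (\<Sum>i\<le>n. pe (f i) * Hdif i) = op (\<Sum>i\<le>n. monom (emb (f i) * H ^ i) i)"
    by (simp add: rep_sum rep_mult rep_pe rep_Hdif op_sum op_monom mul_simps mult.assoc)
  ultimately have "(\<Sum>i\<le>n. monom (emb (f i) * H ^ i) i) = 0" by simp
  then have "coeff (\<Sum>i\<le>n. monom (emb (f i) * H ^ i) i) j = 0" for j by simp
  moreover have "coeff (\<Sum>i\<le>n. monom (emb (f i) * H ^ i) i) j = emb (f j) * H ^ j" if "j \<le> n" for j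
    using that by (simp add: coeff_sum sum.delta)
  ultimately have "emb (f i) * H ^ i = 0" if "i \<le> n" for i
    using that by metis
  then have "f i = 0" if "i \<le> n" for i
    using that nonzero emb_eq_iff[of "f i" 0] by (simp add: emb_simps)
  then have "(\<Sum>i\<le>n. pe (f i) * Hdif i) = 0" by simp
  then show "p \<in> I" using pf by simp
qed (rule I_subset_kernel)

lemma vector_space_free: "vector_space (\<lambda>k p. sc k * p :: 'a free)"
  by unfold_locales (simp_all add: distrib_left distrib_right single_add mult_single mult.assoc[symmetric])

lemma free_quotient: "linear_image_quotient (\<lambda>k p. sc k * p) UNIV (\<lambda>p. p) free_algebra I"
  by (intro linear_image_quotient.intro linear_image.intro linear_image_quotient_axioms.intro
      vector_space_free) (simp_all add: free_algebra_def I_closed)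

interpretation F: linear_image_quotient "\<lambda>k p. sc k * p" UNIV "\<lambda>p. p" "free_algebra :: ('a, 'a free) module" I
  by (rule free_quotient)

lemma Ah_class_eq: "Ah_class h p = F.coset p"
  by (simp add: Ah_class_def F.coset_def)

lemma Ah_class_eq_iff: "Ah_class h p = Ah_class h q \<longleftrightarrow> rep p = rep q"
proof
  assume "Ah_class h p = Ah_class h q"
  moreover have "p \<in> F.coset p" using F.coset_eq[of p] I_closed(1) by force
  ultimately have "p \<in> F.coset q" by (simp add: Ah_class_eq)
  then obtain j where "j \<in> I" "p = j + q" using F.coset_eq[of q] by auto
  then show "rep p = rep q" using I_subset_kernel by (simp add: rep_add)
next
  assume "rep p = rep q"
  then have "p - q \<in> I" using kernel_rep[of "p - q"] by (simp add: rep_diff)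
  then show "Ah_class h p = Ah_class h q" unfolding Ah_class_eq by (intro F.coset_cong) simp_all
qed

text \<open>
  The isomorphism from \<open>A\<close> to the presented algebra; by \<open>kernel_rep\<close> the class is independent of the
  chosen preimage.
\<close>

definition elt :: "'a endo \<Rightarrow> 'a free set" where
  "elt a = Ah_class h (SOME p. rep p = a)"

lemma elt_rep: "elt (rep p) = Ah_class h p"
  unfolding elt_def Ah_class_eq_iff by (rule someI) (rule refl)

lemma elt_eq_iff: "a \<in> AA \<Longrightarrow> b \<in> AA \<Longrightarrow> elt a = elt b \<longleftrightarrow> a = b"
  unfolding range_rep[symmetric] by (auto simp: elt_rep Ah_class_eq_iff)

abbreviation "K \<equiv> Ah h"

lemma elt_linear_image: "linear_image scal AA elt K"
proof -
  have Ah: "alg_quot free_algebra ((\<lambda>p. p) ` I) = K" by (simp add: Ah_def)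
  interpret Q: linear_image "\<lambda>k p. sc k * p" UNIV F.coset K
    using F.linear_image_quotient unfolding Ah .
  show ?thesis
  proof (intro linear_image.intro vector_space_scal)
    show "carrier K = elt ` AA"
      unfolding Q.carrier_eq range_rep[symmetric] image_image elt_rep Ah_class_eq ..
    show "\<zero>\<^bsub>K\<^esub> = elt 0" using elt_rep[of 0] by (simp add: Q.zero_eq Ah_class_eq)
    show "elt v \<oplus>\<^bsub>K\<^esub> elt w = elt (v + w)" if "v \<in> AA" "w \<in> AA" for v w
      using that unfolding range_rep[symmetric]
      by (auto simp: elt_rep rep_add[symmetric] Ah_class_eq Q.add_eq)
    show "k \<odot>\<^bsub>K\<^esub> elt v = elt (scal k v)" if v: "v \<in> AA" for v k
    proof -
      obtain p where p: "v = rep p" using v unfolding range_rep[symmetric] by (rule rangeE)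
      have "scal k v = rep (sc k * p)" by (simp add: p rep_mult rep_sc scal_def)
      then show ?thesis by (simp add: p elt_rep Ah_class_eq Q.smult_eq)
    qed
  qed (simp_all add: A_closed)
qed

sublocale KA: linear_image scal AA elt K
  by (rule elt_linear_image)

lemma elt_mult: "v \<in> AA \<Longrightarrow> w \<in> AA \<Longrightarrow> elt v \<otimes>\<^bsub>K\<^esub> elt w = elt (v * w)"
proof -
  assume "v \<in> AA" "w \<in> AA"
  then obtain p q where pq: "v = rep p" "w = rep q" unfolding range_rep[symmetric] by (elim rangeE)
  have "F.coset p \<otimes>\<^bsub>alg_quot free_algebra ((\<lambda>p. p) ` I)\<^esub> F.coset q = F.coset (p * q)"
  proof (rule F.quotient_mult)
    fix i j assume "i \<in> I" "j \<in> I"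
    then have "i * (j + q) + p * j \<in> I" by (intro I_closed(2) I_closed(4) I_closed(3))
    then show "(i + p) * (j + q) - p * q \<in> I" by (simp add: algebra_simps)
  qed (simp_all add: free_algebra_def)
  then show ?thesis by (simp add: pq rep_mult[symmetric] elt_rep Ah_class_eq Ah_def)
qed

lemma Ah_class_gen: "Ah_class h (gen X) = elt xx" "Ah_class h (gen Y) = elt yh"
  "Ah_class h (pe p) = elt (mul (emb p))"
  using elt_rep[of "gen X"] elt_rep[of "gen Y"] elt_rep[of "pe p"] by (simp_all add: rep_gen rep_pe)

end

section \<open>Derivations of the presented algebra and their classes\<close>

context Ah_model
begin

definition val :: "'a free set \<Rightarrow> 'a endo" where
  "val = inv_into AA elt"

lemma val_elt [simp]: "a \<in> AA \<Longrightarrow> val (elt a) = a"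
  unfolding val_def using elt_eq_iff by (intro inv_into_f_f inj_onI) auto

lemma elt_carrier [simp]: "a \<in> AA \<Longrightarrow> elt a \<in> carrier K"
  by (simp add: KA.carrier_eq)

lemma carrier_K_cases:
  assumes "x \<in> carrier K"
  obtains a where "a \<in> AA" "x = elt a"
  using assms by (auto simp: KA.carrier_eq)

definition der :: "'a endo \<Rightarrow> 'a free set \<Rightarrow> 'a free set" where
  "der w = (\<lambda>x\<in>carrier K. elt (com w (val x)))"

lemma der_elt [simp]: "a \<in> AA \<Longrightarrow> der w (elt a) = elt (com w a)"
  by (simp add: der_def)

lemma fun_eq_derI:
  assumes "d \<in> extensional (carrier K)" and "\<And>a. a \<in> AA \<Longrightarrow> d (elt a) = elt (com w a)"
  shows "d = der w"
proof (rule extensionalityI[OF assms(1)])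
  show "der w \<in> extensional (carrier K)" by (simp add: der_def)
  show "d x = der w x" if "x \<in> carrier K" for x
    using carrier_K_cases[OF that] assms(2) by (metis der_elt)
qed

lemma der_eq_iff:
  assumes "v \<in> NN" "w \<in> NN"
  shows "der v = der w \<longleftrightarrow> v - w \<in> AA \<and> com (v - w) xx = 0 \<and> com (v - w) yh = 0"
proof
  assume eq: "der v = der w"
  have *: "com v a = com w a" if "a \<in> AA" for a
  proof -
    have "elt (com v a) = elt (com w a)" using der_elt[OF that] eq by metis
    then show ?thesis using elt_eq_iff NN_com_AA assms that by blast
  qed
  then have 0: "com (v - w) xx = 0" "com (v - w) yh = 0"
    using xx_AA yh_AA by (simp_all add: com_simps)
  have "v - w \<in> diff_ops" using assms subsets(6) by (intro diff_ops_diff) auto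
  then show "v - w \<in> AA \<and> com (v - w) xx = 0 \<and> com (v - w) yh = 0"
    using com_AA_eq_0 0 by blast
next
  assume "v - w \<in> AA \<and> com (v - w) xx = 0 \<and> com (v - w) yh = 0"
  then have *: "com v a = com w a" if "a \<in> AA" for a
    using com_eq_0_AA[of "v - w" a] that by (simp add: com_simps)
  show "der v = der w"
    by (rule fun_eq_derI) (simp_all add: * der_def)
qed

lemma der_in_derivations:
  assumes w: "w \<in> NN"
  shows "der w \<in> derivations K"
proof -
  have hom: "der w \<in> LinearCombinations.module_hom class_ring K K"
    unfolding LinearCombinations.module_hom_def
  proof (intro CollectI conjI allI impI)
    show "der w \<in> carrier K \<rightarrow> carrier K"
      using w NN_com_AA by (auto elim!: carrier_K_cases)
    show "der w (x \<oplus>\<^bsub>K\<^esub> y) = der w x \<oplus>\<^bsub>K\<^esub> der w y" if "x \<in> carrier K \<and> y \<in> carrier K" for x y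
    proof -
      obtain a b where "a \<in> AA" "x = elt a" "b \<in> AA" "y = elt b" using carrier_K_cases \<open>_ \<and> _\<close> by metis
      then show ?thesis using w by (simp add: KA.add_eq A_closed NN_com_AA com_simps)
    qed
    show "der w (k \<odot>\<^bsub>K\<^esub> x) = k \<odot>\<^bsub>K\<^esub> der w x" if "k \<in> carrier class_ring \<and> x \<in> carrier K" for k x
    proof -
      obtain a where "a \<in> AA" "x = elt a" using carrier_K_cases \<open>_ \<and> _\<close> by metis
      then show ?thesis using w by (simp add: KA.smult_eq A_closed NN_com_AA com_scal)
    qed
  qed
  have "der w (x \<otimes>\<^bsub>K\<^esub> y) = (der w x \<otimes>\<^bsub>K\<^esub> y) \<oplus>\<^bsub>K\<^esub> (x \<otimes>\<^bsub>K\<^esub> der w y)"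
    if xy: "x \<in> carrier K" "y \<in> carrier K" for x y
  proof -
    obtain a b where "a \<in> AA" "x = elt a" "b \<in> AA" "y = elt b" using carrier_K_cases xy by metis
    then show ?thesis using w by (simp add: elt_mult KA.add_eq AA_mult NN_com_AA com_mult)
  qed
  moreover have "der w \<in> extensional (carrier K)" by (simp add: der_def)
  ultimately show ?thesis using hom unfolding derivations_def by blast
qed

lemma derivation_is_der:
  assumes d: "d \<in> derivations K"
  shows "\<exists>w\<in>NN. d = der w"
proof -
  have hom: "d \<in> LinearCombinations.module_hom class_ring K K"
    and ext: "d \<in> extensional (carrier K)"
    and leib: "\<And>x y. x \<in> carrier K \<Longrightarrow> y \<in> carrier K \<Longrightarrow> d (x \<otimes>\<^bsub>K\<^esub> y) = (d x \<otimes>\<^bsub>K\<^esub> y) \<oplus>\<^bsub>K\<^esub> (x \<otimes>\<^bsub>K\<^esub> d y)"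
    using d unfolding derivations_def by auto
  define D where "D a = val (d (elt a))" for a
  have D: "D a \<in> AA" "d (elt a) = elt (D a)" if "a \<in> AA" for a
  proof -
    have "d (elt a) \<in> carrier K" using LinearCombinations.module_hom_closed[OF hom] that by auto
    then obtain b where "b \<in> AA" "d (elt a) = elt b" by (rule carrier_K_cases)
    then show "D a \<in> AA" "d (elt a) = elt (D a)" by (simp_all add: D_def)
  qed
  have add: "D (a + b) = D a + D b" if ab: "a \<in> AA" "b \<in> AA" for a b
  proof -
    have "elt (D (a + b)) = elt (D a + D b)"
      using LinearCombinations.module_hom_add[OF hom, of "elt a" "elt b"] ab D by (simp add: KA.add_eq A_closed)
    then show ?thesis using elt_eq_iff ab D A_closed by metis
  qed
  have scale: "D (scal k a) = scal k (D a)" if a: "a \<in> AA" for k a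
  proof -
    have "elt (D (scal k a)) = elt (scal k (D a))"
      using LinearCombinations.module_hom_smult[OF hom, of k "elt a"] a D by (simp add: KA.smult_eq A_closed)
    then show ?thesis using elt_eq_iff a D A_closed by metis
  qed
  have mult: "D (a * b) = D a * b + a * D b" if ab: "a \<in> AA" "b \<in> AA" for a b
  proof -
    have "elt (D (a * b)) = elt (D a * b + a * D b)"
      using leib[of "elt a" "elt b"] ab D by (simp add: elt_mult KA.add_eq AA_mult)
    then show ?thesis using elt_eq_iff ab D A_closed AA_mult by metis
  qed
  have const: "D (mul (fps_const k)) = 0" for k
  proof -
    have one: "(1 :: 'a endo) \<in> AA" using mul_AA[OF RR_1] by (simp add: mul_simps)
    have "D 1 = 0" using mult[OF one one] by simp
    moreover have "mul (fps_const k) = scal k 1" by (simp add: scal_def)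
    ultimately show ?thesis using scale[OF one] by (simp add: scal_simps)
  qed
  obtain w where w: "w \<in> NN" "\<forall>a\<in>AA. D a = com w a"
    using derivation_of_AA[of D] D(1) add mult const by blast
  have "d = der w" using D(2) w(2) by (intro fun_eq_derI[OF ext]) simp
  then show ?thesis using w(1) by blast
qed

lemma derivations_K: "derivations K = der ` NN"
  using der_in_derivations derivation_is_der by blast

lemma inner_derivations_K: "inner_derivations K = der ` AA"
proof -
  have "(\<lambda>y\<in>carrier K. (elt v \<otimes>\<^bsub>K\<^esub> y) \<ominus>\<^bsub>K\<^esub> (y \<otimes>\<^bsub>K\<^esub> elt v)) = der v" if "v \<in> AA" for v
    using that by (intro fun_eq_derI) (simp_all add: elt_mult KA.minus_eq AA_mult com_def)
  then show ?thesis
    unfolding inner_derivations_def KA.carrier_eq image_image by (intro image_cong) auto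
qed

lemma Der_linear_image: "linear_image scal NN der (Der K)"
proof (intro linear_image.intro vector_space_scal)
  show "carrier (Der K) = der ` NN" by (simp add: Der_def derivations_K)
  show "\<zero>\<^bsub>Der K\<^esub> = der 0"
    unfolding Der_def by (simp, rule fun_eq_derI) (simp_all add: KA.zero_eq com_simps)
  show "der v \<oplus>\<^bsub>Der K\<^esub> der w = der (v + w)" if "v \<in> NN" "w \<in> NN" for v w
    unfolding Der_def using that
    by (simp, intro fun_eq_derI) (simp_all add: KA.add_eq NN_com_AA com_simps)
  show "k \<odot>\<^bsub>Der K\<^esub> der v = der (scal k v)" if "v \<in> NN" for k v
    unfolding Der_def using that
    by (simp, intro fun_eq_derI) (simp_all add: KA.smult_eq NN_com_AA com_scal)
qed (simp_all add: N_closed)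

lemma Der_mult:
  assumes "v \<in> NN" "w \<in> NN"
  shows "der v \<otimes>\<^bsub>Der K\<^esub> der w = der (com v w)"
  unfolding Der_def using assms
  by (simp, intro fun_eq_derI) (simp_all add: KA.minus_eq NN_com_AA com_com)

sublocale HQ: linear_image_quotient scal NN der "Der K" AA
  by (intro linear_image_quotient.intro Der_linear_image linear_image_quotient_axioms.intro)
    (simp_all add: A_closed subsets(1))

abbreviation "cls \<equiv> HQ.coset"

lemma HH1_eq: "HH1 K = alg_quot (Der K) (der ` AA)"
  by (simp add: HH1_def inner_derivations_K)

sublocale HH: linear_image scal NN cls "HH1 K"
  unfolding HH1_eq by (rule HQ.linear_image_quotient)

lemma cls_mult:
  assumes "v \<in> NN" "w \<in> NN"
  shows "cls v \<otimes>\<^bsub>HH1 K\<^esub> cls w = cls (com v w)"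
  unfolding HH1_eq
proof (rule HQ.quotient_mult[OF assms])
  fix i j assume ij: "i \<in> AA" "j \<in> AA"
  have "com i (j + w) + com v j \<in> AA"
    using ij assms NN_com_AA[of v j] NN_com_AA[of "j + w" i] N_closed(2) subsets(1)
      A_closed(2) A_closed(4) com_swap[of i "j + w"] by (metis in_mono)
  then show "com (i + v) (j + w) - com v w \<in> AA" by (simp add: com_simps algebra_simps)
qed (simp_all add: Der_mult NN_com_closed)

lemma cls_eq_iff:
  assumes "v \<in> NN" "w \<in> NN"
  shows "cls v = cls w \<longleftrightarrow> v - w \<in> AA"
proof
  assume "cls v = cls w"
  moreover have "der v \<in> cls v" using HQ.coset_eq[OF assms(1)] A_closed(1) by force
  ultimately obtain j where j: "j \<in> AA" "der v = der (j + w)" using HQ.coset_eq[OF assms(2)] by auto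
  then have "v - (j + w) \<in> AA"
    using der_eq_iff[of v "j + w"] assms subsets(1) N_closed(2) by blast
  then have "v - (j + w) + j \<in> AA" using j A_closed(2) by blast
  then show "v - w \<in> AA" by simp
next
  show "v - w \<in> AA \<Longrightarrow> cls v = cls w" by (rule HQ.coset_cong[OF assms(1)])
qed

lemma cls_eq_zero: "v \<in> NN \<Longrightarrow> cls v = \<zero>\<^bsub>HH1 K\<^esub> \<longleftrightarrow> v \<in> AA"
  using cls_eq_iff[OF _ N_closed(1)] by (simp add: HH.zero_eq)

text \<open>
  \<open>[G, x] = 0\<close> and \<open>[G, h \<partial>] = -h G' = g\<close>, so the commutator with \<open>G\<close> has the values that
  characterize \<open>D\<^sub>g\<close>; a derivation is determined by its values on the generators.
\<close>

lemma D_HH1_eq: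
  assumes G: "H * fps_deriv G = - emb g"
  shows "D_HH1 h g = cls (mul G)"
proof -
  have GN: "mul G \<in> NN" using G RR_minus[OF emb_RR] by (intro mul_NN) simp
  have cx: "com (mul G) xx = 0" by (simp add: xx_def com_mul_mul)
  have cy: "com (mul G) yh = mul (emb g)" by (simp add: com_mul_yh G mul_simps)
  have "D_der h g = der (mul G)"
    unfolding D_der_def
  proof (rule the_equality, intro conjI)
    show "der (mul G) \<in> derivations K" using der_in_derivations[OF GN] .
    show "der (mul G) (Ah_class h (gen X)) = \<zero>\<^bsub>K\<^esub>"
      by (simp add: Ah_class_gen xx_AA cx KA.zero_eq)
    show "der (mul G) (Ah_class h (gen Y)) = Ah_class h (pe g)"
      by (simp add: Ah_class_gen yh_AA cy)
  next
    fix d assume d: "d \<in> derivations K \<and> d (Ah_class h (gen X)) = \<zero>\<^bsub>K\<^esub>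
      \<and> d (Ah_class h (gen Y)) = Ah_class h (pe g)"
    then obtain w where w: "w \<in> NN" "d = der w" using derivation_is_der by blast
    have "elt (com w xx) = elt 0" "elt (com w yh) = elt (mul (emb g))"
      using d by (simp_all add: w Ah_class_gen xx_AA yh_AA KA.zero_eq)
    then have wx: "com w xx = 0" and wy: "com w yh = mul (emb g)"
      using elt_eq_iff NN_com_AA[OF w(1)] xx_AA yh_AA A_closed(1) mul_emb_AA by metis+
    have "com (w - mul G) xx = 0" "com (w - mul G) yh = 0" by (simp_all add: com_simps wx wy cx cy)
    then have eq: "com w a = com (mul G) a" if "a \<in> AA" for a
      using com_eq_0_AA[of "w - mul G" a] that by (simp add: com_simps)
    show "d = der (mul G)" unfolding w(2) by (rule fun_eq_derI) (simp_all add: eq der_def)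
  qed
  then show ?thesis by (simp add: D_HH1_def inner_derivations_K HQ.coset_def)
qed

lemma D_HH1_representative:
  obtains L where "\<rho> * fps_deriv L = emb (- t)" "D_HH1 h (t * c) = cls (mul L)" "mul L \<in> ZZ"
proof -
  obtain L where HL: "H * fps_deriv L = - emb (t * c)" using inverse_H_primitive by blast
  have "C * (\<rho> * fps_deriv L) = C * emb (- t)" using HL by (simp add: H_eq emb_simps ac_simps)
  then have L: "\<rho> * fps_deriv L = emb (- t)" using nonzero by simp
  then have "L \<in> Z_coeff 0" by (simp add: Z_coeff_def)
  then have "mul L \<in> ZZ" unfolding ZZ_def by (rule Z.ops_in_mul)
  then show ?thesis using that L D_HH1_eq[OF HL] by blast
qed

lemma center_eq_classes: "lie_center (HH1 K) = cls ` ZZ"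
proof (intro subset_antisym subsetI)
  fix x assume x: "x \<in> lie_center (HH1 K)"
  then obtain z where z: "z \<in> NN" "x = cls z" by (auto simp: lie_center_def HH.carrier_eq)
  have "com z v \<in> AA" if v: "v \<in> NN" for v
  proof -
    have "x \<otimes>\<^bsub>HH1 K\<^esub> cls v = \<zero>\<^bsub>HH1 K\<^esub>" using x v by (auto simp: lie_center_def HH.carrier_eq)
    then show ?thesis using z v by (simp add: cls_mult cls_eq_zero NN_com_closed)
  qed
  then have "z \<in> ZZ" using ZZ_iff z by blast
  then show "x \<in> cls ` ZZ" using z by blast
next
  fix x assume "x \<in> cls ` ZZ"
  then obtain z where z: "z \<in> ZZ" "x = cls z" by blast
  have zN: "z \<in> NN" using z subsets(4) by blast
  have "x \<otimes>\<^bsub>HH1 K\<^esub> cls v = \<zero>\<^bsub>HH1 K\<^esub>" if v: "v \<in> NN" for v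
    using z zN v ZZ_com_NN by (simp add: cls_mult cls_eq_zero NN_com_closed)
  then show "x \<in> lie_center (HH1 K)" using z zN by (auto simp: lie_center_def HH.carrier_eq)
qed

lemma subspace_ZZ: "VectorSpace.subspace class_ring (cls ` ZZ) (HH1 K)"
  by (rule HH.subspace_image) (simp_all add: subsets Z_closed)

lemma subspace_WW: "VectorSpace.subspace class_ring (cls ` WW) (HH1 K)"
  by (rule HH.subspace_image) (simp_all add: subsets W_closed)

lemma derived_classes_eq: "lie_derived (HH1 K) = cls ` WW"
proof -
  interpret V: vectorspace class_ring "HH1 K" by (rule HH.vectorspace)
  let ?B = "{a \<otimes>\<^bsub>HH1 K\<^esub> b | a b. a \<in> carrier (HH1 K) \<and> b \<in> carrier (HH1 K)}"
  have B: "?B = {cls (com v w) | v w. v \<in> NN \<and> w \<in> NN}"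
  proof (intro subset_antisym subsetI)
    fix x assume "x \<in> ?B"
    then obtain v w where "v \<in> NN" "w \<in> NN" "x = cls v \<otimes>\<^bsub>HH1 K\<^esub> cls w"
      unfolding HH.carrier_eq by blast
    then show "x \<in> {cls (com v w) | v w. v \<in> NN \<and> w \<in> NN}" using cls_mult by blast
  next
    fix x assume "x \<in> {cls (com v w) | v w. v \<in> NN \<and> w \<in> NN}"
    then obtain v w where vw: "v \<in> NN" "w \<in> NN" "x = cls (com v w)" by blast
    then have "x = cls v \<otimes>\<^bsub>HH1 K\<^esub> cls w" by (simp add: cls_mult)
    then show "x \<in> ?B" using vw unfolding HH.carrier_eq by blast
  qed
  have BW: "?B \<subseteq> cls ` WW" unfolding B using NN_com_WW by auto
  have "cls ` WW \<subseteq> carrier (HH1 K)" using subsets(5) by (auto simp: HH.carrier_eq)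
  then have BC: "?B \<subseteq> carrier (HH1 K)" using BW by blast
  have "V.span ?B \<subseteq> cls ` WW"
    using V.span_is_subset[OF BW] V.is_module[OF subspace_WW] by blast
  moreover have "cls ` WW \<subseteq> V.span ?B"
  proof -
    have sub: "submodule class_ring (V.span ?B) (HH1 K)" by (rule V.span_is_submodule[OF BC])
    have "WW \<subseteq> {v \<in> NN. cls v \<in> V.span ?B}"
    proof (rule WW_generated)
      fix v w assume "v \<in> {v \<in> NN. cls v \<in> V.span ?B}" "w \<in> {v \<in> NN. cls v \<in> V.span ?B}"
      then show "v + w \<in> {v \<in> NN. cls v \<in> V.span ?B}"
        using submodule.m_closed[OF sub] N_closed(2) HH.add_eq by (metis (no_types, lifting) mem_Collect_eq)
    next
      fix v w assume vw: "v \<in> NN" "w \<in> NN"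
      then have "cls (com v w) \<in> ?B" unfolding B by blast
      then show "com v w \<in> {v \<in> NN. cls v \<in> V.span ?B}"
        using V.in_own_span[OF BC] NN_com_closed[OF vw] by blast
    qed
    then show ?thesis by blast
  qed
  ultimately show ?thesis unfolding lie_derived_def by blast
qed

lemma direct_sum: "direct_sum_of_ideals (HH1 K) (cls ` ZZ) (cls ` WW)"
  unfolding direct_sum_of_ideals_def lie_ideal_def
proof (intro conjI subspace_ZZ subspace_WW ballI)
  fix a z assume "a \<in> carrier (HH1 K)" "z \<in> cls ` ZZ"
  then obtain v u where vu: "v \<in> NN" "a = cls v" "u \<in> ZZ" "z = cls u" by (auto simp: HH.carrier_eq)
  have uN: "u \<in> NN" using vu subsets(4) by blast
  have "com v u \<in> AA" using ZZ_com_NN[OF vu(3,1)] com_swap[of v u] A_closed(4) by metis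
  then have "com v u \<in> ZZ" using subsets(2) by blast
  then show "a \<otimes>\<^bsub>HH1 K\<^esub> z \<in> cls ` ZZ" using vu uN by (simp add: cls_mult)
next
  fix a z assume "a \<in> carrier (HH1 K)" "z \<in> cls ` WW"
  then obtain v u where vu: "v \<in> NN" "a = cls v" "u \<in> WW" "z = cls u" by (auto simp: HH.carrier_eq)
  have uN: "u \<in> NN" using vu subsets(5) by blast
  then show "a \<otimes>\<^bsub>HH1 K\<^esub> z \<in> cls ` WW" using vu NN_com_WW by (simp add: cls_mult)
next
  have "cls ` ZZ <+>\<^bsub>HH1 K\<^esub> cls ` WW = {cls (z + w) | z w. z \<in> ZZ \<and> w \<in> WW}"
  proof -
    have "cls z \<oplus>\<^bsub>HH1 K\<^esub> cls w = cls (z + w)" if "z \<in> ZZ" "w \<in> WW" for z w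
      using that subsets(4,5) by (intro HH.add_eq) auto
    then show ?thesis unfolding set_add_def' by auto
  qed
  also have "\<dots> = cls ` NN"
  proof (intro subset_antisym subsetI)
    fix x assume "x \<in> {cls (z + w) | z w. z \<in> ZZ \<and> w \<in> WW}"
    then show "x \<in> cls ` NN" using subsets(4,5) N_closed(2) by blast
  next
    fix x assume "x \<in> cls ` NN"
    then show "x \<in> {cls (z + w) | z w. z \<in> ZZ \<and> w \<in> WW}" using ZZ_plus_WW by blast
  qed
  finally show "cls ` ZZ <+>\<^bsub>HH1 K\<^esub> cls ` WW = carrier (HH1 K)" by (simp add: HH.carrier_eq)
next
  show "cls ` ZZ \<inter> cls ` WW = {\<zero>\<^bsub>HH1 K\<^esub>}"
  proof (intro subset_antisym subsetI)
    fix x assume "x \<in> cls ` ZZ \<inter> cls ` WW"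
    then obtain z w where zw: "z \<in> ZZ" "x = cls z" "w \<in> WW" "x = cls w" by blast
    have N: "z \<in> NN" "w \<in> NN" using zw subsets(4,5) by auto
    then have "z - w \<in> WW" using cls_eq_iff zw subsets(3) by blast
    then have "(z - w) + w \<in> WW" using W_closed(2) zw(3) by blast
    then have "z \<in> AA" using ZZ_inter_WW zw(1) by auto
    then show "x \<in> {\<zero>\<^bsub>HH1 K\<^esub>}" using zw(2) cls_eq_zero N by simp
  next
    fix x assume "x \<in> {\<zero>\<^bsub>HH1 K\<^esub>}"
    then show "x \<in> cls ` ZZ \<inter> cls ` WW" using Z_closed(1) W_closed(1) by (auto simp: HH.zero_eq)
  qed
qed

abbreviation "remainders \<equiv> {t :: 'a poly. t = 0 \<or> degree t < degree r}"

lemma center_classes: "cls ` ZZ = (\<lambda>t. D_HH1 h (t * c)) ` remainders"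
proof (intro subset_antisym subsetI)
  fix x assume "x \<in> cls ` ZZ"
  then obtain z where z: "z \<in> ZZ" "x = cls z" by blast
  obtain L t where L: "\<rho> * fps_deriv L = emb t" "t = 0 \<or> degree t < degree r" "z - mul L \<in> AA"
    using ZZ_normal_form[OF z(1)] by blast
  have "H * fps_deriv L = - emb (- t * c)"
  proof -
    have "H * fps_deriv L = C * (\<rho> * fps_deriv L)" by (simp only: H_eq mult.assoc)
    then show ?thesis unfolding L(1) by (simp add: emb_simps ac_simps)
  qed
  then have D: "D_HH1 h (- t * c) = cls (mul L)" "H * fps_deriv L \<in> RR"
    by (rule D_HH1_eq) (use \<open>H * fps_deriv L = - emb (- t * c)\<close> RR_minus[OF emb_RR] in metis)
  have "cls z = cls (mul L)" using L(3) z(1) subsets(4) D(2) by (subst cls_eq_iff) (auto intro: mul_NN)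
  then have "x = D_HH1 h (- t * c)" using z D by simp
  moreover have "- t \<in> remainders" using L(2) by simp
  ultimately show "x \<in> (\<lambda>t. D_HH1 h (t * c)) ` remainders" by blast
next
  fix x assume "x \<in> (\<lambda>t. D_HH1 h (t * c)) ` remainders"
  then obtain t where "x = D_HH1 h (t * c)" by blast
  then show "x \<in> cls ` ZZ" using D_HH1_representative[of t] by (metis image_eqI)
qed

text \<open>
  The classes of \<open>D\<^bsub>tc\<^esub>\<close> depend linearly on \<open>t\<close>, as \<open>L\<close> can be chosen additively in
  \<open>\<pi> L' = -t\<close>. This coordinates the center by polynomials of bounded degree, whose monomials give a
  basis.
\<close>

lemma center_linear_image:
  "linear_image smult remainders (\<lambda>t. D_HH1 h (t * c)) ((HH1 K)\<lparr>carrier := cls ` ZZ\<rparr>)"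
proof -
  have vs: "vector_space (smult :: 'a \<Rightarrow> 'a poly \<Rightarrow> 'a poly)"
    by unfold_locales (simp_all add: smult_add_right smult_add_left)
  have H_mult: "H * fps_deriv L = - emb (t * c)" if "\<rho> * fps_deriv L = emb (- t)" for L t
  proof -
    have "H * fps_deriv L = C * (\<rho> * fps_deriv L)" by (simp only: H_eq mult.assoc)
    then show ?thesis unfolding that by (simp add: emb_simps ac_simps)
  qed
  show ?thesis
  proof (intro linear_image.intro vs)
    show "s + t \<in> remainders" if "s \<in> remainders" "t \<in> remainders" for s t
      using that degree_add_less[of s "degree r" t] by auto
    show "smult k t \<in> remainders" if "t \<in> remainders" for k t
      using that by (cases "k = 0") auto
    show "carrier ((HH1 K)\<lparr>carrier := cls ` ZZ\<rparr>) = (\<lambda>t. D_HH1 h (t * c)) ` remainders"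
      by (simp add: center_classes)
    show "\<zero>\<^bsub>(HH1 K)\<lparr>carrier := cls ` ZZ\<rparr>\<^esub> = D_HH1 h (0 * c)"
      using D_HH1_eq[of 0 0] by (simp add: HH.zero_eq emb_simps mul_simps)
    show "D_HH1 h (s * c) \<oplus>\<^bsub>(HH1 K)\<lparr>carrier := cls ` ZZ\<rparr>\<^esub> D_HH1 h (t * c) = D_HH1 h ((s + t) * c)" for s t
    proof -
      obtain L where L: "\<rho> * fps_deriv L = emb (- s)" "D_HH1 h (s * c) = cls (mul L)" "mul L \<in> ZZ"
        by (rule D_HH1_representative)
      obtain M where M: "\<rho> * fps_deriv M = emb (- t)" "D_HH1 h (t * c) = cls (mul M)" "mul M \<in> ZZ"
        by (rule D_HH1_representative)
      have "\<rho> * fps_deriv (L + M) = emb (- (s + t))" by (simp add: distrib_left L M emb_simps)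
      then have "D_HH1 h ((s + t) * c) = cls (mul (L + M))" by (intro D_HH1_eq H_mult)
      then show ?thesis using L M subsets(4) by (simp add: HH.add_eq mul_simps subset_iff)
    qed
    show "k \<odot>\<^bsub>(HH1 K)\<lparr>carrier := cls ` ZZ\<rparr>\<^esub> D_HH1 h (t * c) = D_HH1 h (smult k t * c)" for k t
    proof -
      obtain L where L: "\<rho> * fps_deriv L = emb (- t)" "D_HH1 h (t * c) = cls (mul L)" "mul L \<in> ZZ"
        by (rule D_HH1_representative)
      have "\<rho> * fps_deriv (fps_const k * L) = fps_const k * (\<rho> * fps_deriv L)" by (simp add: ac_simps)
      also have "\<dots> = emb (- smult k t)" unfolding L by (simp add: emb_simps)
      finally have "D_HH1 h (smult k t * c) = cls (mul (fps_const k * L))" by (intro D_HH1_eq H_mult)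
      then show ?thesis using L subsets(4) by (simp add: HH.smult_eq scal_def mul_simps subset_iff)
    qed
  qed simp_all
qed

lemma center_dim:
  "vectorspace.fin_dim class_ring ((HH1 K)\<lparr>carrier := cls ` ZZ\<rparr>)"
  "vectorspace.dim class_ring ((HH1 K)\<lparr>carrier := cls ` ZZ\<rparr>) = degree r"
proof -
  interpret C: linear_image smult remainders "\<lambda>t. D_HH1 h (t * c)" "(HH1 K)\<lparr>carrier := cls ` ZZ\<rparr>"
    by (rule center_linear_image)
  have inj: "t = 0" if t: "t \<in> remainders" "D_HH1 h (t * c) = \<zero>\<^bsub>(HH1 K)\<lparr>carrier := cls ` ZZ\<rparr>\<^esub>" for t
  proof -
    obtain L where L: "\<rho> * fps_deriv L = emb (- t)" "D_HH1 h (t * c) = cls (mul L)" "mul L \<in> ZZ"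
      by (rule D_HH1_representative)
    then have "mul L \<in> AA" using t(2) cls_eq_zero[of "mul L"] subsets(4) by auto
    then have "- t = 0" using t(1) by (intro log_primitive_in_AA[OF L(1)]) auto
    then show ?thesis by simp
  qed
  have coeff: "coeff (\<Sum>i<degree r. smult (a i) (monom 1 i)) j = (if j < degree r then a j else 0)"
    for a :: "nat \<Rightarrow> 'a" and j
    by (simp add: coeff_sum smult_monom sum.delta)
  have f: "monom 1 i \<in> remainders" if "i < degree r" for i
    using that by (simp add: degree_monom_eq)
  have indep: "\<forall>i<degree r. a i = 0" if "(\<Sum>i<degree r. smult (a i) (monom 1 i)) = 0" for a :: "nat \<Rightarrow> 'a"
    using coeff[of a] that by (metis coeff_0)
  have gen: "\<exists>a. t = (\<Sum>i<degree r. smult (a i) (monom 1 i))" if "t \<in> remainders" for t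
  proof (rule exI[of _ "coeff t"], rule poly_eqI)
    show "coeff t j = coeff (\<Sum>i<degree r. smult (coeff t i) (monom 1 i)) j" for j
      unfolding coeff using that by (auto simp: coeff_eq_0)
  qed
  show "vectorspace.fin_dim class_ring ((HH1 K)\<lparr>carrier := cls ` ZZ\<rparr>)"
    "vectorspace.dim class_ring ((HH1 K)\<lparr>carrier := cls ` ZZ\<rparr>) = degree r"
    using C.dim_eq_basis[of "degree r" "monom 1"] inj f indep gen by blast+
qed

end

theorem theorem5p13:
  fixes h :: "'a::field_char_0 poly"
  assumes "h \<noteq> 0"
  shows "direct_sum_of_ideals (HH1 (Ah h)) (lie_center (HH1 (Ah h))) (lie_derived (HH1 (Ah h)))
    \<and> lie_center (HH1 (Ah h)) =
           {D_HH1 h (r * (h div pi_poly h)) | r. r = 0 \<or> degree r < degree (pi_poly h)}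
    \<and> vectorspace.fin_dim class_ring ((HH1 (Ah h))\<lparr>carrier := lie_center (HH1 (Ah h))\<rparr>)
    \<and> vectorspace.dim class_ring ((HH1 (Ah h))\<lparr>carrier := lie_center (HH1 (Ah h))\<rparr>)
           = degree (pi_poly h)"
proof -
  obtain pt where "poly h pt \<noteq> 0" using assms poly_all_0_iff_0 by blast
  then interpret Ah_model h "pi_poly h" pt
    using pi_poly_radical[OF assms] by (simp add: Ah_model_def Ah_model_axioms_def)
  have "lie_center (HH1 K) = {D_HH1 h (r * (h div pi_poly h)) | r. r = 0 \<or> degree r < degree (pi_poly h)}"
    unfolding center_eq_classes center_classes c_def by blast
  then show ?thesis using direct_sum center_dim unfolding center_eq_classes derived_classes_eq by simp
qed

end
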